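(* Let $L$ be a finite extension of $K$ and let $B=(B_{ij})\in\mathrm{Mat}_{d\times d}(L[t,\tau])$ with $\deg_\tau(B)=r$ and $\deg_t(B)=u$. Assume that $\partial B\in\mathrm{Mat}_{d\times d}(L[t])$ is in Jordan canonical form with $\det(\partial B)\neq 0$. For each $2\leq k\leq d$, let $D_k\in\mathrm{Div}(L)$ be any effective divisor with $$\deg(D_k)>\max\Big\{2g_L-2,\;(rk+1)(k-1)\big(u+(rk+1)(k-1)u+1\big)q^{r(k-1)}\mathrm{ht}(B)_\infty+g_L-1\Big\}.$$ Then there exists a matrix $A_D\in\mathrm{Mat}_{d\times d}(L[t,\tau])$ of the lower triangular form $$A_D=\begin{pmatrix} 1 & & & \\ a_{21} & a_{22} & & \\ \vdots & & \ddots & \\ a_{d1} & \cdots & \cdots & a_{dd} \end{pmatrix}$$ such that $A_DB$ is an upper triangular matrix and the following properties hold. 1. For each $2\leq k\leq d$, $a_{kk}\neq 0$. 2. The diagonal entries of $A_DB$ are all non-zero. 3. For each $2\leq k\leq d$, $\max\{\deg_\tau(a_{k1}),\dots,\deg_\tau(a_{kk})\}\leq r(k-1)$. 4. For each $2\leq k\leq d$, $\max\{\deg_t(a_{k1}),\dots,\deg_t(a_{kk})\}\leq(rk+1)(k-1)u$. 5. For each $2\leq k\leq d$, $a_{k\ell}\in\big(\mathcal{L}(D_k)\otimes_{\mathbb{F}_q}\mathbb{F}_q[t]\big)[\tau]$ for all $1\leq\ell\leq k$.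
   Context: $\mathbb{F}_q$ is a finite field with $q$ elements, $K=\mathbb{F}_q(\theta)$, and $\mathbb{C}_\infty$ is the completion of an algebraic closure of $\mathbb{F}_q(\!(1/\theta)\!)$; $L\subset\mathbb{C}_\infty$ is a finite extension of $K$ corresponding to a smooth projective curve $X_L$ defined over $\mathbb{F}_q$ (so $\mathbb{F}_q$ is the full constant field of $L$), $g_L$ is the genus of $X_L$, $M_L$ is the set of places of $L$, and $\mathrm{Div}(L)$ its divisor group. For $D=\sum_v a_v\cdot(v)$, $\deg(D)=\sum_v a_v\deg(v)$, and $\mathcal{L}(D)=\{f\in L^\times\mid\mathrm{div}(f)+D\geq 0\}\cup\{0\}$. $\mathcal{L}(D)\otimes_{\mathbb{F}_q}\mathbb{F}_q[t]$ is identified with the set of polynomials in $L[t]$ with all coefficients in $\mathcal{L}(D)$, and $(\mathcal{L}(D)\otimes_{\mathbb{F}_q}\mathbb{F}_q[t])[\tau]$ with the elements $\sum_i f_i\tau^i\in L[t,\tau]$ with all $f_i\in\mathcal{L}(D)\otimes_{\mathbb{F}_q}\mathbb{F}_q[t]$. $L[t,\tau]$ is the twisted polynomial ring with $\alpha t=t\alpha$, $t\tau=\tau t$, $\tau\alpha=\alpha^q\tau$ for $\alpha\in L$. Every element is written uniquely as $f=\sum_i f_i\tau^i$ with $f_i\in L[t]$; $\partial f:=f_0$, and $\partial$ is applied entrywise to matrices. $\deg_\tau$ and $\deg_t$ denote the degrees in $\tau$ and $t$, and for a matrix the maximum over its entries. For $F=\sum_i f_it^i\in L[t]$ and $v\in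 M_L$ set $\mathrm{ord}_v(F)=\min_i\mathrm{ord}_v(f_i)$. For $B=(B_{ij})$ with $B_{ij}=\sum_k B_{ij}^{[k]}\tau^k$, $B_{ij}^{[k]}\in L[t]$, set $\mathrm{ord}_v(B)=\min_{i,j,k}\mathrm{ord}_v(B_{ij}^{[k]})$, $\mathrm{div}(B)_\infty=\sum_{v\in M_L}-\min\{\mathrm{ord}_v(B),0\}\cdot(v)$ and $\mathrm{ht}(B)_\infty=\deg(\mathrm{div}(B)_\infty)$. Jordan canonical form is the upper triangular one (1's, where they occur, on the superdiagonal). *)

theory Defs
  imports
    "HOL-Library.Extended"
    "HOL-Library.FuncSet"
    "HOL-Library.Cardinality"
    "HOL-Computational_Algebra.Computational_Algebra"
    "Jordan_Normal_Form.Jordan_Normal_Form"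
begin

section \<open>Function fields over a finite field\<close>

text \<open>
  The finite field \<open>\<F>\<^sub>q\<close> is a type \<open>'k\<close> of sort finite and field, with \<open>q = CARD('k)\<close>, and
  \<open>K = \<F>\<^sub>q(\<theta>)\<close> is the type \<open>'k poly fract\<close>.  An extension \<open>L\<close> of \<open>K\<close> is a field type
  \<open>'l\<close> together with a homomorphism \<open>emb\<close> from \<open>K\<close> to \<open>L\<close>.
\<close>

definition const_emb :: "('k::field poly fract \<Rightarrow> 'l::field) \<Rightarrow> 'k \<Rightarrow> 'l" where
  "const_emb emb c = emb (Fract [:c:] 1)"

locale function_field = field_hom emb
  for emb :: "'k::{finite,field} poly fract \<Rightarrow> 'l::field" +
  assumes finite_degree: "\<exists>S. finite S \<and> Modules.module.span (\<lambda>c x. emb c * x) S = UNIV"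
    and full_constant_field:
      "\<And>x. (\<exists>p. p \<noteq> 0 \<and> poly (map_poly (const_emb emb) p) x = 0) \<Longrightarrow> x \<in> range (const_emb emb)"

text \<open>
  A place is represented by its normalised discrete valuation, with \<open>ord(0) = \<infinity>\<close>.  The value
  \<open>-\<infinity>\<close> of the type of extended integers never occurs.
\<close>

type_synonym 'l valuation = "'l \<Rightarrow> int extended"

definition places :: "('k::field poly fract \<Rightarrow> 'l::field) \<Rightarrow> 'l valuation set" where
  "places emb = {v.
     (\<forall>x. v x = Pinf \<longleftrightarrow> x = 0) \<and>
     (\<forall>x. v x \<noteq> Minf) \<and>
     (\<forall>x y. v (x * y) = v x + v y) \<and>
     (\<forall>x y. min (v x) (v y) \<le> v (x + y)) \<and>
     (\<exists>x. v x = Fin 1) \<and>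
     (\<forall>c. c \<noteq> 0 \<longrightarrow> v (const_emb emb c) = Fin 0)}"

definition valuation_ring :: "'l valuation \<Rightarrow> 'l set" where
  "valuation_ring v = {x. Fin 0 \<le> v x}"

definition max_ideal :: "'l valuation \<Rightarrow> 'l set" where
  "max_ideal v = {x. Fin 0 < v x}"

text \<open>
  \<open>B\<close> is a set of representatives of an \<open>\<F>\<^sub>q\<close>-basis of the residue field of \<open>v\<close>: every residue
  class is, in exactly one way, an \<open>\<F>\<^sub>q\<close>-linear combination of the classes of the elements of \<open>B\<close>.
\<close>

definition residue_basis ::
    "('k::field poly fract \<Rightarrow> 'l::field) \<Rightarrow> 'l valuation \<Rightarrow> 'l set \<Rightarrow> bool" where
  "residue_basis emb v B \<longleftrightarrow> finite B \<and> B \<subseteq> valuation_ring v \<and>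
     (\<forall>x\<in>valuation_ring v. \<exists>!c. c \<in> B \<rightarrow>\<^sub>E UNIV \<and>
        x - (\<Sum>b\<in>B. const_emb emb (c b) * b) \<in> max_ideal v)"

definition place_degree ::
    "('k::field poly fract \<Rightarrow> 'l::field) \<Rightarrow> 'l valuation \<Rightarrow> nat" where
  "place_degree emb v = (THE n. \<exists>B. residue_basis emb v B \<and> card B = n)"

subsection \<open>Divisors, Riemann--Roch spaces and the genus\<close>

type_synonym 'l divisor = "'l valuation \<Rightarrow> int"

definition divisors :: "('k::field poly fract \<Rightarrow> 'l::field) \<Rightarrow> 'l divisor set" where
  "divisors emb = {D. finite {v. D v \<noteq> 0} \<and> {v. D v \<noteq> 0} \<subseteq> places emb}"

definition effective :: "'l divisor \<Rightarrow> bool" where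
  "effective D \<longleftrightarrow> (\<forall>v. 0 \<le> D v)"

definition div_degree :: "('k::field poly fract \<Rightarrow> 'l::field) \<Rightarrow> 'l divisor \<Rightarrow> int" where
  "div_degree emb D = (\<Sum>v | D v \<noteq> 0. D v * int (place_degree emb v))"

definition RR_space :: "('k::field poly fract \<Rightarrow> 'l::field) \<Rightarrow> 'l divisor \<Rightarrow> 'l set" where
  "RR_space emb D =
     {f. f \<noteq> 0 \<and> (\<forall>v\<in>places emb. Fin 0 \<le> v f + Fin (D v))} \<union> {0}"

definition RR_dim :: "('k::field poly fract \<Rightarrow> 'l::field) \<Rightarrow> 'l divisor \<Rightarrow> nat" where
  "RR_dim emb D = vector_space.dim (\<lambda>c x. const_emb emb c * x) (RR_space emb D)"

text \<open>
  The genus of a function field is the maximum of \<open>deg A - dim \<L>(A) + 1\<close> over all divisors \<open>A\<close>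
  (Stichtenoth, Algebraic Function Fields and Codes, Definition 1.4.15).
\<close>

definition genus :: "('k::field poly fract \<Rightarrow> 'l::field) \<Rightarrow> int" where
  "genus emb = (GREATEST g. \<exists>A\<in>divisors emb. g = div_degree emb A - int (RR_dim emb A) + 1)"

section \<open>Twisted polynomials\<close>

text \<open>
  An element \<open>\<Sum>\<^sub>i f\<^sub>i \<tau>\<^sup>i\<close> of \<open>L[t,\<tau>]\<close> with \<open>f\<^sub>i \<in> L[t]\<close> is represented by the polynomial over
  \<open>L[t]\<close> (in \<open>\<tau>\<close>) with coefficients \<open>f\<^sub>i\<close>.  Addition is that of \<open>'l poly poly\<close>; the product is
  \<^emph>\<open>not\<close> the commutative product of that type but the operation \<open>tmult\<close> below.
\<close>

type_synonym 'l tpoly = "'l poly poly"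

definition twist :: "nat \<Rightarrow> nat \<Rightarrow> 'l::field poly \<Rightarrow> 'l poly" where
  "twist q i f = map_poly (\<lambda>a. a ^ (q ^ i)) f"

definition tmult :: "nat \<Rightarrow> 'l::field tpoly \<Rightarrow> 'l tpoly \<Rightarrow> 'l tpoly" where
  "tmult q f g =
     (\<Sum>i\<le>degree f. \<Sum>j\<le>degree g. monom (coeff f i * twist q i (coeff g j)) (i + j))"

definition tmat_mult :: "nat \<Rightarrow> 'l::field tpoly mat \<Rightarrow> 'l tpoly mat \<Rightarrow> 'l tpoly mat" where
  "tmat_mult q A B = mat (dim_row A) (dim_col B)
     (\<lambda>(i,j). \<Sum>l<dim_col A. tmult q (A $$ (i,l)) (B $$ (l,j)))"

definition partial_mat :: "'l::field tpoly mat \<Rightarrow> 'l poly mat" where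
  "partial_mat B = map_mat (\<lambda>b. coeff b 0) B"

definition jordan_canonical_form :: "'a::{zero,one} mat \<Rightarrow> bool" where
  "jordan_canonical_form A \<longleftrightarrow> (\<exists>n_as. 0 \<notin> fst ` set n_as \<and> A = jordan_matrix n_as)"

text \<open>The degrees of \<open>0\<close> are \<open>0\<close> here.\<close>

definition deg_tau :: "'l::field tpoly \<Rightarrow> nat" where
  "deg_tau b = degree b"

definition deg_t :: "'l::field tpoly \<Rightarrow> nat" where
  "deg_t b = (MAX i\<in>{..degree b}. degree (coeff b i))"

definition mat_deg_tau :: "'l::field tpoly mat \<Rightarrow> nat" where
  "mat_deg_tau B = (MAX (i,j)\<in>{..<dim_row B} \<times> {..<dim_col B}. deg_tau (B $$ (i,j)))"

definition mat_deg_t :: "'l::field tpoly mat \<Rightarrow> nat" where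
  "mat_deg_t B = (MAX (i,j)\<in>{..<dim_row B} \<times> {..<dim_col B}. deg_t (B $$ (i,j)))"

text \<open>Matrix entries indexed from 1.\<close>

definition entry :: "'a mat \<Rightarrow> nat \<Rightarrow> nat \<Rightarrow> 'a" where
  "entry A i j = A $$ (i - 1, j - 1)"

subsection \<open>Heights\<close>

definition ord_poly :: "'l valuation \<Rightarrow> 'l::field poly \<Rightarrow> int extended" where
  "ord_poly v F = (MIN i\<in>{..degree F}. v (coeff F i))"

definition ord_tpoly :: "'l valuation \<Rightarrow> 'l::field tpoly \<Rightarrow> int extended" where
  "ord_tpoly v b = (MIN k\<in>{..degree b}. ord_poly v (coeff b k))"

definition ord_mat :: "'l valuation \<Rightarrow> 'l::field tpoly mat \<Rightarrow> int extended" where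
  "ord_mat v B = (MIN (i,j)\<in>{..<dim_row B} \<times> {..<dim_col B}. ord_tpoly v (B $$ (i,j)))"

text \<open>At a place, the minimum below is an integer.\<close>

definition div_infinity ::
    "('k::field poly fract \<Rightarrow> 'l::field) \<Rightarrow> 'l tpoly mat \<Rightarrow> 'l divisor" where
  "div_infinity emb B v =
     (if v \<in> places emb then - (THE n. Fin n = min (ord_mat v B) (Fin 0)) else 0)"

definition height_infinity ::
    "('k::field poly fract \<Rightarrow> 'l::field) \<Rightarrow> 'l tpoly mat \<Rightarrow> int" where
  "height_infinity emb B = div_degree emb (div_infinity emb B)"

section \<open>Twisted polynomials with coefficients in a Riemann--Roch space\<close>

definition RR_space_t :: "('k::field poly fract \<Rightarrow> 'l::field) \<Rightarrow> 'l divisor \<Rightarrow> 'l poly set" where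
  "RR_space_t emb D = {F. \<forall>i. coeff F i \<in> RR_space emb D}"

definition RR_space_t_tau ::
    "('k::field poly fract \<Rightarrow> 'l::field) \<Rightarrow> 'l divisor \<Rightarrow> 'l tpoly set" where
  "RR_space_t_tau emb D = {f. \<forall>i. coeff f i \<in> RR_space_t emb D}"

section \<open>Basic checks\<close>

lemma coeff_twist: "q > 0 \<Longrightarrow> coeff (twist q i f) n = coeff f n ^ (q ^ i)"
  by (simp add: twist_def coeff_map_poly)

lemma twist_0 [simp]: "twist q i 0 = 0"
  by (simp add: twist_def)

lemma coeff_tmult:
  "coeff (tmult q f g) n = (\<Sum>i\<le>n. coeff f i * twist q i (coeff g (n - i)))"
proof -
  have "coeff (tmult q f g) n =
      (\<Sum>i\<le>degree f. \<Sum>j\<le>degree g. if i + j = n then coeff f i * twist q i (coeff g j) else 0)"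
    by (simp add: tmult_def coeff_sum)
  also have "\<dots> = (\<Sum>i\<le>degree f. if i \<le> n then coeff f i * twist q i (coeff g (n - i)) else 0)"
  proof (rule sum.cong[OF refl])
    fix i
    show "(\<Sum>j\<le>degree g. if i + j = n then coeff f i * twist q i (coeff g j) else 0) =
      (if i \<le> n then coeff f i * twist q i (coeff g (n - i)) else 0)"
    proof (cases "i \<le> n")
      case True
      then have "(\<Sum>j\<le>degree g. if i + j = n then coeff f i * twist q i (coeff g j) else 0) =
        (\<Sum>j\<le>degree g. if j = n - i then coeff f i * twist q i (coeff g j) else 0)"
        by (intro sum.cong) auto
      also have "\<dots> = coeff f i * twist q i (coeff g (n - i))"
        by (auto simp: coeff_eq_0)
      finally show ?thesis using True by simp
    qed (auto intro!: sum.neutral)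
  qed
  also have "\<dots> = (\<Sum>i\<in>{..degree f} \<inter> {..n}. coeff f i * twist q i (coeff g (n - i)))"
    by (subst sum.inter_restrict) auto
  also have "\<dots> = (\<Sum>i\<le>n. coeff f i * twist q i (coeff g (n - i)))"
    by (rule sum.mono_neutral_left) (auto simp: coeff_eq_0)
  finally show ?thesis .
qed

lemma tmult_monom:
  "tmult q (monom a m) (monom b n) = monom (a * twist q m b) (m + n)"
  by (rule poly_eqI)
     (auto simp: coeff_tmult if_distrib[of "\<lambda>c. c * _"] if_distrib[of "twist q _"] cong: if_cong)

lemma twist_pCons:
  assumes "q > 0" shows "twist q i (pCons a f) = pCons (a ^ (q ^ i)) (twist q i f)"
  using assms by (intro poly_eqI) (simp add: coeff_twist coeff_pCons split: nat.split)

lemma tau_times_const: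
  assumes "q > 0"
  shows "tmult q (monom 1 1) [:[:\<alpha>:]:] = tmult q [:[:\<alpha> ^ q:]:] (monom 1 1)"
  using tmult_monom[of q 1 1 "[:\<alpha>:]" 0] tmult_monom[of q "[:\<alpha> ^ q:]" 0 1 1] assms
  by (simp add: twist_pCons monom_0 one_pCons)

lemma tau_times_t:
  assumes "q > 0"
  shows "tmult q (monom 1 1) [:[:0, 1 :: 'l::field:]:] = tmult q [:[:0, 1:]:] (monom 1 1)"
  using tmult_monom[of q 1 1 "[:0, 1 :: 'l:]" 0] tmult_monom[of q "[:0, 1 :: 'l:]" 0 1 1] assms
  by (simp add: twist_pCons monom_0 one_pCons zero_power)

lemma twist_mult:
  assumes q: "q > 0" and frob: "\<And>a b :: 'l::field. (a + b) ^ q = a ^ q + b ^ q"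
  shows "twist q i (f + g :: 'l poly) = twist q i f + twist q i g"
    and "twist q i (f * g) = twist q i f * twist q i g"
    and "twist q i (twist q j f) = twist q (i + j) f"
proof -
  have add: "(a + b) ^ (q ^ i) = a ^ (q ^ i) + b ^ (q ^ i)" for a b :: 'l
  proof (induction i)
    case (Suc i)
    have "(a + b) ^ (q ^ Suc i) = ((a + b) ^ (q ^ i)) ^ q"
      by (simp only: power_Suc power_mult [symmetric] mult.commute)
    then show ?case
      by (simp add: Suc frob power_mult [symmetric] mult.commute)
  qed simp
  show "twist q i (f + g :: 'l poly) = twist q i f + twist q i g" for f g
    using q by (intro poly_eqI) (simp add: coeff_twist add)
  have sum: "(sum h S) ^ (q ^ i) = (\<Sum>x\<in>S. h x ^ (q ^ i))" for h :: "nat \<Rightarrow> 'l" and S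
    using q by (induction S rule: infinite_finite_induct) (simp_all add: add)
  show "twist q i (f * g) = twist q i f * twist q i g"
    using q by (intro poly_eqI) (simp add: coeff_twist coeff_mult sum power_mult_distrib)
  show "twist q i (twist q j f) = twist q (i + j) f"
    using q by (intro poly_eqI)
      (simp add: coeff_twist power_mult [symmetric] power_add mult.commute)
qed

lemma tmult_assoc:
  assumes q: "q > 0" and frob: "\<And>a b :: 'l::field. (a + b) ^ q = a ^ q + b ^ q"
  shows "tmult q (tmult q f g) (h :: 'l tpoly) = tmult q f (tmult q g h)"
proof (rule poly_eqI)
  fix n
  have sum: "twist q i (sum c S) = (\<Sum>x\<in>S. twist q i (c x))" for c :: "nat \<Rightarrow> 'l poly" and S i
    by (induction S rule: infinite_finite_induct) (simp_all add: twist_mult(1)[OF q frob])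
  have "coeff (tmult q (tmult q f g) h) n =
      (\<Sum>k\<le>n. \<Sum>i\<le>k. coeff f i * twist q i (coeff g (k - i)) * twist q k (coeff h (n - k)))"
    by (simp add: coeff_tmult sum_distrib_right)
  also have "\<dots> = (\<Sum>(i,j)\<in>{(i,j). i + j \<le> n}.
      coeff f i * twist q i (coeff g j) * twist q (i + j) (coeff h (n - (i + j))))"
    by (subst sum.triangle_reindex_eq) simp
  also have "{(i,j). i + j \<le> n} = (SIGMA i:{..n}. {..n - i})"
    by auto
  also have "(\<Sum>(i,j)\<in>(SIGMA i:{..n}. {..n - i}).
      coeff f i * twist q i (coeff g j) * twist q (i + j) (coeff h (n - (i + j)))) =
      (\<Sum>i\<le>n. \<Sum>j\<le>n - i.
      coeff f i * twist q i (coeff g j) * twist q (i + j) (coeff h (n - (i + j))))"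
    by (simp add: sum.Sigma)
  also have "\<dots> = coeff (tmult q f (tmult q g h)) n"
    by (simp add: coeff_tmult sum twist_mult(2)[OF q frob] twist_mult(3)[OF q frob]
        sum_distrib_left mult.assoc)
  finally show "coeff (tmult q (tmult q f g) h) n = coeff (tmult q f (tmult q g h)) n" .
qed

text \<open>All residue bases have the same cardinality, so the degree of a place is well defined.\<close>

lemma (in function_field) place_degree_eq:
  assumes v: "v \<in> places emb" and B: "residue_basis emb v B"
  shows "place_degree emb v = card B"
proof -
  let ?O = "valuation_ring v" and ?m = "max_ideal v"
  have v0: "v x = Pinf \<longleftrightarrow> x = 0" and vM: "v x \<noteq> Minf" and vm: "v (x * y) = v x + v y"
    and va: "min (v x) (v y) \<le> v (x + y)" and vc: "c \<noteq> 0 \<Longrightarrow> v (const_emb emb c) = Fin 0"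
    for x y c
    using v by (auto simp: places_def)
  have v1: "v 1 = Fin 0"
    using vm[of 1 1] v0[of 1] vM[of 1] by (cases "v 1") auto
  have "v (- 1) = Fin 0"
    using vm[of "- 1" "- 1"] v0[of "- 1"] vM[of "- 1"] v1 by (cases "v (- 1)") auto
  then have vu: "v (- x) = v x" for x
    using vm[of "- 1" x] vM[of x] by (cases "v x") auto
  have c0: "const_emb emb 0 = 0"
    by (simp add: const_emb_def fract_collapse)
  have const: "const_emb emb c \<in> ?O" for c
    using vc[of c] v0[of 0] by (cases "c = 0") (simp_all add: valuation_ring_def c0)
  have add: "x + y \<in> ?O" if "x \<in> ?O" "y \<in> ?O" for x y
    using that va[of x y] by (auto simp: valuation_ring_def min_le_iff_disj)
  have mult: "x * y \<in> ?O" if "x \<in> ?O" "y \<in> ?O" for x y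
    using that vm[of x y] by (cases "v x"; cases "v y") (auto simp: valuation_ring_def)
  have zero: "0 \<in> ?O" "0 \<in> ?m"
    using v0[of 0] by (simp_all add: valuation_ring_def max_ideal_def)
  have diff: "x - y \<in> ?m" if "x \<in> ?m" "y \<in> ?m" for x y
    using that va[of x "- y"] vu[of y] by (auto simp: max_ideal_def min_def split: if_splits)
  define s where "s C c = (\<Sum>b\<in>C. const_emb emb (c b) * b)" for C and c :: "'l \<Rightarrow> 'k"
  have s_in: "s C c \<in> ?O" if "residue_basis emb v C" for C c
  proof -
    have "finite C" "C \<subseteq> ?O" using that by (auto simp: residue_basis_def)
    then show ?thesis unfolding s_def
      by (induction C rule: finite_induct) (auto simp: zero intro!: add mult const)
  qed
  have le: "card C \<le> card C'"
    if C: "residue_basis emb v C" and C': "residue_basis emb v C'" for C C'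
  proof -
    have ex: "\<exists>c'. c' \<in> C' \<rightarrow>\<^sub>E UNIV \<and> s C c - s C' c' \<in> ?m" for c
      using C' s_in[OF C, of c] unfolding residue_basis_def s_def by blast
    then obtain f where f: "\<And>c. f c \<in> C' \<rightarrow>\<^sub>E UNIV" "\<And>c. s C c - s C' (f c) \<in> ?m"
      by metis
    have "inj_on f (C \<rightarrow>\<^sub>E UNIV)"
    proof (rule inj_onI)
      fix c1 c2 :: "'l \<Rightarrow> 'k"
      assume c: "c1 \<in> C \<rightarrow>\<^sub>E UNIV" "c2 \<in> C \<rightarrow>\<^sub>E UNIV" and eq: "f c1 = f c2"
      have "s C c1 - s C c2 \<in> ?m"
        using diff[OF f(2)[of c1] f(2)[of c2]] by (simp add: eq)
      moreover have "s C c1 - s C c1 \<in> ?m" by (simp add: zero)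
      moreover have "\<exists>!c. c \<in> C \<rightarrow>\<^sub>E UNIV \<and> s C c1 - s C c \<in> ?m"
        using C s_in[OF C, of c1] unfolding residue_basis_def s_def by blast
      ultimately show "c1 = c2" using c by blast
    qed
    moreover have fin: "finite C" "finite C'"
      using C C' by (auto simp: residue_basis_def)
    ultimately have "card (C \<rightarrow>\<^sub>E (UNIV :: 'k set)) \<le> card (C' \<rightarrow>\<^sub>E (UNIV :: 'k set))"
      using f(1) by (intro card_inj_on_le[of f] finite_PiE image_subsetI) simp_all
    then have "CARD('k) ^ card C \<le> CARD('k) ^ card C'"
      using fin by (simp add: card_PiE)
    moreover have "card {0, 1 :: 'k} \<le> CARD('k)" by (intro card_mono) auto
    ultimately show ?thesis by (simp add: power_le_imp_le_exp)
  qed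
  show ?thesis
    unfolding place_degree_def using B le by (blast intro: the_equality order_antisym)
qed

end

theory Submission
  imports Defs
begin

text \<open>
  Row \<open>k\<close> of the triangularizing matrix is a non-zero vector \<open>a = (a\<^sub>1, \<dots>, a\<^sub>k)\<close> that annihilates
  the first \<open>k - 1\<close> columns of the upper left \<open>k \<times> k\<close> block of \<open>B\<close>.  This is a linear system for the
  coefficients of the \<open>a\<^sub>l\<close>, because they stand on the left of the twisted product.  With
  \<open>N = (r k + 1)(k - 1)\<close>, the prescribed degrees leave \<open>(N + 1)(N u + 1)\<close> unknowns and
  \<open>N (N u + u + 1)\<close> equations, that is, one unknown more than equations.  If the unknowns are taken
  from \<open>\<L>(D)\<close>, the values of the equations lie in \<open>\<L>(D + q\<^sup>R E)\<close>, where \<open>E\<close> is the divisor of poles of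
  \<open>B\<close> and \<open>R = r (k - 1)\<close>.  Both spaces are finite, and adding the effective divisor \<open>q\<^sup>R E\<close> enlarges
  the space by a factor of at most \<open>q\<close> to the power \<open>q\<^sup>R deg E\<close>.  So the pigeonhole principle yields a
  non-zero solution (\<open>Siegel_row\<close>) once the dimension of \<open>\<L>(D)\<close> exceeds the number of equations times
  \<open>q\<^sup>R deg E\<close>, which is what the bound on \<open>deg D\<close> gives, by Riemann's inequality
  \<open>dim \<L>(D) \<ge> deg D + 1 - g\<close> (\<open>Riemann_inequality\<close>).

  The diagonal entries do not vanish because \<open>\<partial>B\<close> is upper triangular with non-zero diagonal: looking
  at the lowest power of \<open>\<tau>\<close>, one sees that no non-zero row annihilates all columns of an upper left
  block of \<open>B\<close> (\<open>triangular_row_eq_0\<close>).  If \<open>a\<^sub>k\<close> were \<open>0\<close> the block of size \<open>k - 1\<close> would be annihilated,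
  and if the last entry of the product were \<open>0\<close> the block of size \<open>k\<close> would be.

  Since the genus is the largest value of \<open>deg A - dim \<L>(A) + 1\<close>, Riemann's inequality amounts to this
  quantity being bounded.  The proof counts elements.  Fix a basis of \<open>L\<close> over \<open>K\<close>, with \<open>n\<close> elements.
  The combinations of the basis with coefficients in \<open>\<F>\<^sub>q[\<theta>]\<close> of degree at most \<open>c\<close> are
  \<open>q\<close> to the power \<open>n (c + 1)\<close> in number, and comparing this growth in \<open>c\<close> with
  the number of digit expansions in base \<open>z\<close> bounds the number of residue classes modulo \<open>z\<close> of any ring that contains \<open>z\<close>
  (\<open>card_incongruent_le\<close>).  This one estimate gives the finiteness of residue fields and of the set of
  zeros, a bound on the number of zeros of \<open>z\<close> counted with degrees, equal to \<open>[L : \<F>\<^sub>q(z)]\<close> for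
  \<open>z = 1/\<theta>\<close> and for the non-constant polynomials \<open>z\<close> in \<open>\<theta>\<close> (\<open>sum_valuations_le\<close>), and
  the discreteness of the valuation rings supplied by Zorn's lemma, hence enough places for the elements without poles to be the constants (\<open>no_poles_imp_constant\<close>).  The
  bounded combinations themselves are the many functions that Riemann's inequality asks for
  (\<open>Riemann_bound\<close>).
\<close>

section \<open>Counting polynomials\<close>

definition polys_over :: "'a::zero set \<Rightarrow> nat \<Rightarrow> 'a poly set" where
  "polys_over V n = {p. degree p \<le> n \<and> (\<forall>i. coeff p i \<in> V)}"

lemma polys_over_0:
  assumes "0 \<in> V" shows "polys_over V 0 = (\<lambda>a. [:a:]) ` V"
proof -
  have "p \<in> (\<lambda>a. [:a:]) ` V" if "p \<in> polys_over V 0" for p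
  proof -
    have "degree p = 0" using that by (simp add: polys_over_def)
    then obtain a where a: "p = [:a:]" by (elim degree_eq_zeroE)
    have "coeff p 0 \<in> V" using that by (simp add: polys_over_def)
    then show ?thesis using a by simp
  qed
  moreover have "[:a:] \<in> polys_over V 0" if "a \<in> V" for a
  proof -
    have "coeff [:a:] i \<in> V" for i using that assms by (cases i) simp_all
    then show ?thesis unfolding polys_over_def by simp
  qed
  ultimately show ?thesis by blast
qed

lemma polys_over_Suc:
  "polys_over V (Suc n) = (\<lambda>(a, p). pCons a p) ` (V \<times> polys_over V n)"
proof -
  have "p \<in> (\<lambda>(a, p). pCons a p) ` (V \<times> polys_over V n)" if p: "p \<in> polys_over V (Suc n)" for p
  proof (cases p)
    case (pCons a p')
    have "coeff p (Suc i) = coeff p' i" for i by (simp add: pCons)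
    with p have "\<forall>i. coeff p' i \<in> V" by (metis (mono_tags, lifting) mem_Collect_eq polys_over_def)
    moreover have "degree p' \<le> n"
      using p pCons by (cases "p' = 0") (auto simp: polys_over_def)
    moreover have "a \<in> V"
      using p pCons by (auto simp: polys_over_def dest!: spec[of _ 0])
    ultimately show ?thesis using pCons by (auto simp: polys_over_def)
  qed
  moreover have "pCons a p \<in> polys_over V (Suc n)" if "a \<in> V" "p \<in> polys_over V n" for a p
  proof -
    have "coeff (pCons a p) i \<in> V" for i using that by (cases i) (simp_all add: polys_over_def)
    moreover have "degree (pCons a p) \<le> Suc n"
      using that(2) degree_pCons_le[of a p] unfolding polys_over_def
      by (metis (mono_tags, lifting) Suc_le_mono le_trans mem_Collect_eq)
    ultimately show ?thesis unfolding polys_over_def by blast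
  qed
  ultimately show ?thesis by (intro subset_antisym subsetI) auto
qed

lemma card_polys_over:
  assumes "0 \<in> V" "finite V"
  shows "finite (polys_over V n) \<and> card (polys_over V n) = card V ^ Suc n"
proof (induction n)
  case 0
  have "inj_on (\<lambda>a. [:a:]) V" by (rule inj_onI) simp
  then show ?case using assms by (simp add: polys_over_0 card_image)
next
  case (Suc n)
  have "inj_on (\<lambda>(a, p). pCons a p) (V \<times> polys_over V n)" by (auto intro!: inj_onI)
  then show ?case using assms Suc by (simp add: polys_over_Suc card_image card_cartesian_product)
qed

lemma zero_in_polys_over: "0 \<in> V \<Longrightarrow> 0 \<in> polys_over V n"
  by (simp add: polys_over_def)

section \<open>Expansions in a fixed base and residue classes\<close>

definition is_subring :: "'a::field set \<Rightarrow> bool" where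
  "is_subring R \<longleftrightarrow> 1 \<in> R \<and> (\<forall>x\<in>R. \<forall>y\<in>R. x - y \<in> R \<and> x * y \<in> R)"

lemma
  assumes "is_subring R"
  shows subring_1: "1 \<in> R" and subring_diff: "x \<in> R \<Longrightarrow> y \<in> R \<Longrightarrow> x - y \<in> R"
    and subring_mult: "x \<in> R \<Longrightarrow> y \<in> R \<Longrightarrow> x * y \<in> R"
    and subring_0: "0 \<in> R" and subring_add: "x \<in> R \<Longrightarrow> y \<in> R \<Longrightarrow> x + y \<in> R"
    and subring_uminus: "x \<in> R \<Longrightarrow> - x \<in> R"
proof -
  show *: "1 \<in> R" "x \<in> R \<Longrightarrow> y \<in> R \<Longrightarrow> x - y \<in> R" "x \<in> R \<Longrightarrow> y \<in> R \<Longrightarrow> x * y \<in> R" for x y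
    using assms by (auto simp: is_subring_def)
  show 0: "0 \<in> R" using *(1) *(2)[of 1 1] by simp
  show u: "x \<in> R \<Longrightarrow> - x \<in> R" for x using *(2)[of 0 x] 0 by simp
  show "x \<in> R \<Longrightarrow> y \<in> R \<Longrightarrow> x + y \<in> R" for x y using *(2)[of x "- y"] u by simp
qed

text \<open>
  The shape in which the counts of digit expansions are used: exponential growth determines the base,
  whatever the constant factor.
\<close>

lemma power_growth_le:
  fixes y a C :: nat
  assumes "\<And>l. y ^ l \<le> C * a ^ l" and "a > 0" shows "y \<le> a"
proof (rule ccontr)
  assume "\<not> y \<le> a"
  then have "1 < real y / real a" using assms(2) by simp
  then obtain l where l: "real C < (real y / real a) ^ l" using real_arch_pow by blast
  have "real (y ^ l) \<le> real (C * a ^ l)" using assms(1)[of l] of_nat_mono by blast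
  then have "(real y / real a) ^ l \<le> real C"
    using assms(2) by (simp add: power_divide field_simps)
  with l show False by simp
qed

context function_field
begin

definition poly_emb :: "'k poly \<Rightarrow> 'l" where
  "poly_emb p = emb (to_fract p)"

lemma poly_emb_hom [simp]:
  "poly_emb 0 = 0" "poly_emb 1 = 1" "poly_emb (p + r) = poly_emb p + poly_emb r"
  "poly_emb (p * r) = poly_emb p * poly_emb r" "poly_emb (- p) = - poly_emb p"
  "poly_emb (p - r) = poly_emb p - poly_emb r" "poly_emb p = 0 \<longleftrightarrow> p = 0"
  by (simp_all add: poly_emb_def hom_distribs)

lemma poly_emb_power [simp]: "poly_emb (p ^ m) = poly_emb p ^ m"
  by (induction m) simp_all

lemma const_emb_eq: "const_emb emb c = poly_emb [:c:]"
  by (simp add: const_emb_def poly_emb_def to_fract_def)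

lemma card_gt_1: "CARD('k) > 1"
proof -
  have "card {0, 1 :: 'k} \<le> CARD('k)" by (intro card_mono) auto
  then show ?thesis by simp
qed

end

locale function_field_basis = function_field emb
  for emb :: "'k::{finite,field} poly fract \<Rightarrow> 'l::field" +
  fixes U :: "'l set"
  assumes finite_U: "finite U"
    and span_U: "\<exists>k. x = (\<Sum>u\<in>U. emb (k u) * u)"
    and indep_U: "(\<Sum>u\<in>U. emb (k u) * u) = 0 \<Longrightarrow> u \<in> U \<Longrightarrow> k u = 0"

lemma (in function_field) basis_exists: "\<exists>U. function_field_basis emb U"
proof -
  interpret vs: vector_space "\<lambda>c x. emb c * x"
    by unfold_locales (simp_all add: hom_distribs algebra_simps)
  obtain S where S: "finite S" "vs.span S = UNIV" using finite_degree by blast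
  obtain U where U: "U \<subseteq> S" "vs.independent U" "S \<subseteq> vs.span U"
    using vs.maximal_independent_subset[of S] by blast
  have fin: "finite U" using U S finite_subset by blast
  have "vs.span U = UNIV"
    using vs.span_mono[OF U(3)] S by (auto simp: vs.span_span)
  then have "range (\<lambda>k. \<Sum>u\<in>U. emb (k u) * u) = UNIV" using vs.span_finite[OF fin] by simp
  then have "\<exists>k. x = (\<Sum>u\<in>U. emb (k u) * u)" for x
    by (metis (mono_tags, lifting) UNIV_I imageE)
  moreover have "k u = 0" if "(\<Sum>u\<in>U. emb (k u) * u) = 0" "u \<in> U" for k u
    using vs.independentD[OF U(2) fin subset_refl that] .
  ultimately have "function_field_basis emb U"
    using fin by unfold_locales auto
  then show ?thesis by blast
qed

context function_field_basis
begin

text \<open>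
  Elements of bounded degree with respect to the basis \<open>U\<close>; in the limit, their number measures
  the size of \<open>L\<close> as \<open>n\<close> copies of \<open>\<F>\<^sub>q(\<theta>)\<close>.
\<close>

definition lat :: "nat \<Rightarrow> 'l set" where
  "lat c = {\<Sum>u\<in>U. poly_emb (G u) * u | G. \<forall>u\<in>U. degree (G u) \<le> c}"

lemma latI: "(\<And>u. u \<in> U \<Longrightarrow> degree (G u) \<le> c) \<Longrightarrow> (\<Sum>u\<in>U. poly_emb (G u) * u) \<in> lat c"
  by (auto simp: lat_def)

lemma latE:
  assumes "x \<in> lat c"
  obtains G where "\<And>u. u \<in> U \<Longrightarrow> degree (G u) \<le> c" "x = (\<Sum>u\<in>U. poly_emb (G u) * u)"
  using assms by (auto simp: lat_def)

lemma lat_0: "0 \<in> lat c"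
  using latI[of "\<lambda>_. 0"] by simp

lemma lat_mono: "x \<in> lat c \<Longrightarrow> c \<le> c' \<Longrightarrow> x \<in> lat c'"
  unfolding lat_def using order_trans by blast

lemma lat_add:
  assumes "x \<in> lat c" "y \<in> lat c" shows "x + y \<in> lat c"
proof -
  obtain G where G: "\<And>u. u \<in> U \<Longrightarrow> degree (G u) \<le> c" "x = (\<Sum>u\<in>U. poly_emb (G u) * u)"
    using latE[OF assms(1)] by metis
  obtain H where H: "\<And>u. u \<in> U \<Longrightarrow> degree (H u) \<le> c" "y = (\<Sum>u\<in>U. poly_emb (H u) * u)"
    using latE[OF assms(2)] by metis
  show ?thesis using latI[of "\<lambda>u. G u + H u" c] G H
    by (simp add: degree_add_le algebra_simps sum.distrib)
qed

lemma lat_poly_mult: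
  assumes "x \<in> lat c" "degree p \<le> m" shows "poly_emb p * x \<in> lat (c + m)"
proof -
  obtain G where G: "\<And>u. u \<in> U \<Longrightarrow> degree (G u) \<le> c" "x = (\<Sum>u\<in>U. poly_emb (G u) * u)"
    using latE[OF assms(1)] by metis
  have "degree (p * G u) \<le> c + m" if "u \<in> U" for u
    using G(1)[OF that] assms(2) degree_mult_le[of p "G u"] by linarith
  then show ?thesis using latI[of "\<lambda>u. p * G u" "c + m"] G(2)
    by (simp add: sum_distrib_left mult.assoc)
qed

lemma lat_sum: "(\<And>i. i \<in> I \<Longrightarrow> f i \<in> lat c) \<Longrightarrow> sum f I \<in> lat c"
  by (induction I rule: infinite_finite_induct) (auto simp: lat_0 lat_add)

lemma card_lat: "finite (lat c)" "card (lat c) = CARD('k) ^ (card U * Suc c)"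
proof -
  let ?P = "{p :: 'k poly. degree p \<le> c}"
  have P: "?P = polys_over UNIV c" by (simp add: polys_over_def)
  have cP: "finite ?P" "card ?P = CARD('k) ^ Suc c"
    using card_polys_over[of "UNIV :: 'k set" c] unfolding P by simp_all
  let ?f = "\<lambda>G. \<Sum>u\<in>U. poly_emb (G u) * u"
  have "inj_on ?f (U \<rightarrow>\<^sub>E ?P)"
  proof (rule inj_onI)
    fix G H assume GH: "G \<in> U \<rightarrow>\<^sub>E ?P" "H \<in> U \<rightarrow>\<^sub>E ?P" and "?f G = ?f H"
    then have "(\<Sum>u\<in>U. emb (to_fract (G u - H u)) * u) = 0"
      by (simp only: poly_emb_def[symmetric] poly_emb_hom left_diff_distrib sum_subtractf) simp
    from indep_U[OF this] have "\<And>u. u \<in> U \<Longrightarrow> G u = H u" by simp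
    then show "G = H" using GH by (meson PiE_ext)
  qed
  moreover have "lat c = ?f ` (U \<rightarrow>\<^sub>E ?P)"
  proof
    show "?f ` (U \<rightarrow>\<^sub>E ?P) \<subseteq> lat c" by (auto intro!: latI)
    show "lat c \<subseteq> ?f ` (U \<rightarrow>\<^sub>E ?P)"
    proof
      fix x assume x: "x \<in> lat c"
      obtain G where G: "\<And>u. u \<in> U \<Longrightarrow> degree (G u) \<le> c" "x = ?f G" using latE[OF x] by metis
      then have "restrict G U \<in> U \<rightarrow>\<^sub>E ?P" "x = ?f (restrict G U)" by auto
      then show "x \<in> ?f ` (U \<rightarrow>\<^sub>E ?P)" by blast
    qed
  qed
  ultimately have "finite (lat c)" "card (lat c) = (CARD('k) ^ Suc c) ^ card U"
    using finite_U cP by (auto simp: card_image card_PiE finite_PiE simp del: power_Suc)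
  then show "finite (lat c)" "card (lat c) = CARD('k) ^ (card U * Suc c)"
    by (simp_all only: power_mult[symmetric] mult.commute)
qed

lemma denominator: "\<exists>h c. h \<noteq> 0 \<and> poly_emb h * x \<in> lat c"
proof -
  obtain k where k: "x = (\<Sum>u\<in>U. emb (k u) * u)" using span_U by blast
  have "\<exists>a b. b \<noteq> 0 \<and> k u = Fract a b" for u by (cases "k u") auto
  then obtain a b where ab: "\<And>u. b u \<noteq> 0" "\<And>u. k u = Fract (a u) (b u)" by metis
  define h where "h = (\<Prod>u\<in>U. b u)"
  have h: "h \<noteq> 0" using ab finite_U by (simp add: h_def)
  define G where "G u = a u * (\<Prod>w\<in>U - {u}. b w)" for u
  have "poly_emb h * (emb (k u) * u) = poly_emb (G u) * u" if "u \<in> U" for u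
  proof -
    have "to_fract h * k u = to_fract (G u)"
      using ab that finite_U by (simp add: to_fract_def h_def G_def eq_fract prod.remove)
    then have "poly_emb h * emb (k u) = poly_emb (G u)"
      by (metis hom_mult poly_emb_def)
    then show ?thesis by (metis mult.assoc)
  qed
  then have "poly_emb h * x = (\<Sum>u\<in>U. poly_emb (G u) * u)"
    unfolding k sum_distrib_left by (intro sum.cong refl)
  moreover have "(\<Sum>u\<in>U. poly_emb (G u) * u) \<in> lat (Max (insert 0 ((\<lambda>u. degree (G u)) ` U)))"
    using finite_U by (intro latI) (auto intro!: Max_ge)
  ultimately show ?thesis using h by metis
qed

lemma common_denominator:
  assumes "finite Y" shows "\<exists>h c. h \<noteq> 0 \<and> (\<forall>y\<in>Y. poly_emb h * y \<in> lat c)"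
  using assms
proof (induction Y rule: finite_induct)
  case empty
  show ?case by (rule exI[of _ 1]) simp
next
  case (insert x Y)
  then obtain h c where h: "h \<noteq> 0" "\<forall>y\<in>Y. poly_emb h * y \<in> lat c" by blast
  obtain h' c' where h': "h' \<noteq> 0" "poly_emb h' * x \<in> lat c'" using denominator by blast
  have "poly_emb (h * h') * y \<in> lat (c + c' + degree h + degree h')" if "y \<in> insert x Y" for y
  proof (cases "y = x")
    case True
    have "poly_emb h * (poly_emb h' * x) \<in> lat (c' + degree h)"
      using lat_poly_mult[OF h'(2) order_refl] .
    then show ?thesis using True lat_mono by (simp add: mult.assoc)
  next
    case False
    with that h have "poly_emb h' * (poly_emb h * y) \<in> lat (c + degree h')"
      by (intro lat_poly_mult) auto
    then show ?thesis using lat_mono by (simp add: ac_simps)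
  qed
  then show ?case using h h' by (metis mult_eq_0_iff)
qed

text \<open>
  Up to a denominator \<open>h\<close> of degree at most \<open>m\<close>, multiplication by \<open>z\<close> raises degrees by at most \<open>m\<close>.  The
  \<open>l\<close>-th powers of \<open>z\<close> then raise degrees by at most \<open>l m\<close>, so \<open>card U * m\<close> plays the part of the
  degree \<open>[L : \<F>\<^sub>q(z)]\<close>; it is equal to it for \<open>z = p(\<theta>)\<close> with \<open>m = deg p \<ge> 1\<close>, and for
  \<open>z = 1/\<theta>\<close> with \<open>m = 1\<close>.
\<close>

definition height_le :: "'l \<Rightarrow> nat \<Rightarrow> bool" where
  "height_le z m \<longleftrightarrow> (\<exists>h. h \<noteq> 0 \<and> degree h \<le> m \<and> (\<forall>u\<in>U. poly_emb h * z * u \<in> lat m))"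

lemma U_in_lat: "u \<in> U \<Longrightarrow> u \<in> lat 0"
  using latI[of "\<lambda>w. if w = u then 1 else 0" 0] finite_U
  by (simp add: if_distrib[of poly_emb] if_distrib[of "\<lambda>x. x * _"] cong: if_cong)

lemma height_le_poly: "height_le (poly_emb p) (degree p)"
  unfolding height_le_def using lat_poly_mult[OF U_in_lat, of _ p "degree p"]
  by (intro exI[of _ 1]) simp

lemma height_le_inverse_X: "height_le (inverse (poly_emb [:0, 1:])) 1"
  unfolding height_le_def using lat_mono[OF U_in_lat, of _ 1]
  by (intro exI[of _ "[:0, 1:]"]) simp

lemma height_le_exists: "\<exists>m. height_le z m"
proof -
  obtain h c where h: "h \<noteq> 0" "\<forall>y\<in>(\<lambda>u. z * u) ` U. poly_emb h * y \<in> lat c"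
    using common_denominator[of "(\<lambda>u. z * u) ` U"] finite_U by blast
  then have "height_le z (c + degree h)"
    unfolding height_le_def using lat_mono[of _ c "c + degree h"]
    by (intro exI[of _ h]) (auto simp: mult.assoc)
  then show ?thesis ..
qed

lemma height_leE:
  assumes "height_le z m"
  obtains h where "h \<noteq> 0" "degree h \<le> m"
    "\<And>x c. x \<in> lat c \<Longrightarrow> poly_emb h * z * x \<in> lat (c + m)"
proof -
  obtain h where h: "h \<noteq> 0" "degree h \<le> m" "\<And>u. u \<in> U \<Longrightarrow> poly_emb h * z * u \<in> lat m"
    using assms by (auto simp: height_le_def)
  have "poly_emb h * z * x \<in> lat (c + m)" if x: "x \<in> lat c" for x c
  proof -
    obtain G where G: "\<And>u. u \<in> U \<Longrightarrow> degree (G u) \<le> c" "x = (\<Sum>u\<in>U. poly_emb (G u) * u)"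
      using latE[OF x] by metis
    have "poly_emb h * z * x = (\<Sum>u\<in>U. poly_emb (G u) * (poly_emb h * z * u))"
      by (simp add: G sum_distrib_left ac_simps)
    also have "\<dots> \<in> lat (m + c)" by (intro lat_sum lat_poly_mult h G)
    finally show ?thesis by (simp add: add.commute)
  qed
  then show ?thesis using that h by blast
qed

text \<open>
  Digit sums \<open>y\<^sub>0 + y\<^sub>1 z + \<dots>\<close> with \<open>l\<close> digits in \<open>Y\<close> are pairwise distinct, as incongruent digits can be
  recovered one after the other modulo \<open>z\<close>.  After multiplication by a common denominator they all
  have degree at most \<open>l m\<close> plus a constant, so there are no more than a constant times
  \<open>q\<close> to the power \<open>card U * m * l\<close> of them.  Letting \<open>l\<close> grow bounds \<open>card Y\<close>.
\<close>

lemma card_incongruent_le: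
  assumes R: "is_subring R" and z: "z \<in> R" "z \<noteq> 0" and m: "height_le z m"
    and Y: "finite Y" "Y \<subseteq> R"
    and incong: "\<And>y y'. y \<in> Y \<Longrightarrow> y' \<in> Y \<Longrightarrow> y \<noteq> y' \<Longrightarrow> (y - y') / z \<notin> R"
  shows "card Y \<le> CARD('k) ^ (card U * m)"
proof -
  \<comment> \<open>Evaluation of a list of digits at \<open>z\<close>.\<close>
  define ev where "ev ys = foldr (\<lambda>y s. y + z * s) ys 0" for ys
  have ev_R: "ev ys \<in> R" if "set ys \<subseteq> R" for ys
    using that by (induction ys) (auto simp: ev_def subring_0[OF R] intro!: subring_add[OF R] subring_mult[OF R] z)
  have ev_inj: "ys = ys'" if "set ys \<subseteq> Y" "set ys' \<subseteq> Y" "length ys = length ys'" "ev ys = ev ys'"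
    for ys ys'
    using that(3,1,2,4)
  proof (induction ys ys' rule: list_induct2)
    case (Cons y ys y' ys')
    have eq: "y + z * ev ys = y' + z * ev ys'" using Cons.prems by (simp add: ev_def)
    then have "(y - y') / z = ev ys' - ev ys" using z by (simp add: field_simps)
    moreover have "ev ys' - ev ys \<in> R"
      using Cons.prems Y by (intro subring_diff[OF R] ev_R) auto
    ultimately have "y = y'" using incong[of y y'] Cons.prems by auto
    with eq z Cons show ?case by simp
  qed simp
  obtain h where h: "h \<noteq> 0" "degree h \<le> m"
    "\<And>x c. x \<in> lat c \<Longrightarrow> poly_emb h * z * x \<in> lat (c + m)"
    using height_leE[OF m] by blast
  obtain g c where g: "g \<noteq> 0" "\<forall>y\<in>Y. poly_emb g * y \<in> lat c"
    using common_denominator[OF Y(1)] by blast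
  have mem: "poly_emb h ^ length ys * poly_emb g * ev ys \<in> lat (c + length ys * m)"
    if "set ys \<subseteq> Y" for ys
    using that
  proof (induction ys)
    case Nil
    then show ?case by (simp add: ev_def lat_0)
  next
    case (Cons y ys)
    let ?l = "length ys"
    have "degree (h ^ Suc ?l) \<le> degree h * Suc ?l" by (rule degree_power_le)
    also have "\<dots> \<le> Suc ?l * m" using h(2) by (simp add: mult.commute mult_le_mono add_mono)
    finally have "poly_emb (h ^ Suc ?l) * (poly_emb g * y) \<in> lat (c + Suc ?l * m)"
      using g Cons.prems by (intro lat_poly_mult) auto
    moreover have "poly_emb h * z * (poly_emb h ^ ?l * poly_emb g * ev ys) \<in> lat (c + ?l * m + m)"
      using Cons by (intro h) auto
    ultimately show ?case
      using lat_add[of "poly_emb (h ^ Suc ?l) * (poly_emb g * y)" "c + Suc ?l * m"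
          "poly_emb h * z * (poly_emb h ^ ?l * poly_emb g * ev ys)"]
      by (simp add: ev_def algebra_simps)
  qed
  have "card Y ^ l \<le> CARD('k) ^ (card U * Suc c) * (CARD('k) ^ (card U * m)) ^ l" for l
  proof -
    let ?L = "{ys. set ys \<subseteq> Y \<and> length ys = l}"
    let ?f = "\<lambda>ys. poly_emb h ^ l * poly_emb g * ev ys"
    have "inj_on ?f ?L" using ev_inj h g by (auto intro!: inj_onI)
    moreover have "?f ` ?L \<subseteq> lat (c + l * m)" using mem by auto
    ultimately have "card ?L \<le> card (lat (c + l * m))"
      by (intro card_inj_on_le card_lat) 
    moreover have "card U * Suc (c + l * m) = card U * Suc c + card U * m * l"
      by (simp add: algebra_simps)
    ultimately show ?thesis
      using card_lists_length_eq[OF Y(1), of l] by (simp only: card_lat(2) power_add power_mult)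
  qed
  then show ?thesis by (rule power_growth_le) simp
qed

end

section \<open>Valuations\<close>

text \<open>
  The integer value at a place, meaningful for non-zero arguments only; \<open>val_ge\<close> below covers \<open>0\<close>, whose
  value is infinite, so that it is stable under sums without case distinctions.
\<close>

definition int_val :: "'l valuation \<Rightarrow> 'l \<Rightarrow> int" where
  "int_val v x = (THE n. v x = Fin n)"

definition val_ge :: "'l::zero valuation \<Rightarrow> int \<Rightarrow> 'l \<Rightarrow> bool" where
  "val_ge v n x \<longleftrightarrow> Fin n \<le> v x"

context function_field
begin

lemma const_emb_hom:
  "const_emb emb 0 = 0" "const_emb emb 1 = 1" "const_emb emb (a * b) = const_emb emb a * const_emb emb b"
  "const_emb emb (a + b) = const_emb emb a + const_emb emb b"
  "const_emb emb (a - b) = const_emb emb a - const_emb emb b"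
  "const_emb emb a = 0 \<longleftrightarrow> a = 0"
proof -
  have "[:a * b:] = [:a:] * [:b:]" "[:a + b:] = [:a:] + [:b:]" "[:a - b:] = [:a:] - [:b:]" by simp_all
  then show "const_emb emb 0 = 0" "const_emb emb 1 = 1" "const_emb emb (a * b) = const_emb emb a * const_emb emb b"
    "const_emb emb (a + b) = const_emb emb a + const_emb emb b"
    "const_emb emb (a - b) = const_emb emb a - const_emb emb b"
    "const_emb emb a = 0 \<longleftrightarrow> a = 0"
    unfolding const_emb_eq by (simp_all only: poly_emb_hom) (simp_all add: one_pCons[symmetric])
qed

context
  fixes v :: "'l valuation"
  assumes v: "v \<in> places emb"
begin

lemma place_eq_Pinf: "v x = Pinf \<longleftrightarrow> x = 0" and place_mult: "v (x * y) = v x + v y"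
  using v by (auto simp: places_def)

lemma place_int_val: "x \<noteq> 0 \<Longrightarrow> v x = Fin (int_val v x)"
  using v by (cases "v x") (auto simp: places_def int_val_def)

lemma val_ge_0 [simp]: "val_ge v n 0"
  using place_eq_Pinf[of 0] by (simp add: val_ge_def)

lemma val_ge_iff: "x \<noteq> 0 \<Longrightarrow> val_ge v n x \<longleftrightarrow> n \<le> int_val v x"
  by (simp add: val_ge_def place_int_val)

lemma int_val_mult: "x \<noteq> 0 \<Longrightarrow> y \<noteq> 0 \<Longrightarrow> int_val v (x * y) = int_val v x + int_val v y"
  using place_mult[of x y] by (simp add: place_int_val)

lemma int_val_1 [simp]: "int_val v 1 = 0"
  using int_val_mult[of 1 1] by simp

lemma int_val_uminus: "x \<noteq> 0 \<Longrightarrow> int_val v (- x) = int_val v x"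
  using int_val_mult[of "- 1" "- 1"] int_val_mult[of "- 1" x] by simp

lemma int_val_inverse: "x \<noteq> 0 \<Longrightarrow> int_val v (inverse x) = - int_val v x"
  using int_val_mult[of x "inverse x"] by simp

lemma int_val_divide: "x \<noteq> 0 \<Longrightarrow> y \<noteq> 0 \<Longrightarrow> int_val v (x / y) = int_val v x - int_val v y"
  by (simp add: divide_inverse int_val_mult int_val_inverse)

lemma int_val_power: "x \<noteq> 0 \<Longrightarrow> int_val v (x ^ m) = int m * int_val v x"
  by (induction m) (simp_all add: int_val_mult algebra_simps)

lemma val_ge_add: "val_ge v n x \<Longrightarrow> val_ge v n y \<Longrightarrow> val_ge v n (x + y)"
proof -
  assume "val_ge v n x" "val_ge v n y"
  then have "Fin n \<le> min (v x) (v y)" by (simp add: val_ge_def)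
  also have "\<dots> \<le> v (x + y)" using v by (auto simp: places_def)
  finally show ?thesis by (simp add: val_ge_def)
qed

lemma val_ge_uminus: "val_ge v n x \<Longrightarrow> val_ge v n (- x)"
  by (cases "x = 0") (simp_all add: val_ge_iff int_val_uminus)

lemma val_ge_diff: "val_ge v n x \<Longrightarrow> val_ge v n y \<Longrightarrow> val_ge v n (x - y)"
  using val_ge_add[of n x "- y"] val_ge_uminus[of n y] by simp

lemma val_ge_sum: "(\<And>i. i \<in> I \<Longrightarrow> val_ge v n (f i)) \<Longrightarrow> val_ge v n (sum f I)"
  by (induction I rule: infinite_finite_induct) (simp_all add: val_ge_add)

lemma val_ge_mult: "val_ge v m x \<Longrightarrow> val_ge v n y \<Longrightarrow> val_ge v (m + n) (x * y)"
  by (cases "x = 0"; cases "y = 0") (simp_all add: val_ge_iff int_val_mult)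

lemma val_ge_mult_iff: "x \<noteq> 0 \<Longrightarrow> val_ge v n (x * y) \<longleftrightarrow> val_ge v (n - int_val v x) y"
  by (cases "y = 0") (auto simp: val_ge_iff int_val_mult)

lemma val_ge_divide_iff: "x \<noteq> 0 \<Longrightarrow> val_ge v n (y / x) \<longleftrightarrow> val_ge v (n + int_val v x) y"
  by (cases "y = 0") (auto simp: val_ge_iff int_val_divide)

lemma val_ge_power: "val_ge v n x \<Longrightarrow> val_ge v (int m * n) (x ^ m)"
  by (cases "x = 0") (auto simp: val_ge_iff int_val_power power_0_left mult_left_mono)

lemma val_ge_mono: "val_ge v n x \<Longrightarrow> m \<le> n \<Longrightarrow> val_ge v m x"
  by (cases "x = 0") (simp_all add: val_ge_iff)

lemma int_val_const: "c \<noteq> 0 \<Longrightarrow> int_val v (const_emb emb c) = 0"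
  using v place_int_val[of "const_emb emb c"] by (auto simp: places_def const_emb_eq)

lemma val_ge_const: "val_ge v 0 (const_emb emb c)"
  by (cases "c = 0") (simp_all add: val_ge_iff int_val_const const_emb_hom)

lemma val_ge_1: "val_ge v 0 1"
  by (simp add: val_ge_iff)

lemma int_val_add_eq:
  assumes "x \<noteq> 0" "val_ge v (int_val v x + 1) y"
  shows "x + y \<noteq> 0 \<and> int_val v (x + y) = int_val v x"
proof -
  have *: "\<not> val_ge v (int_val v x + 1) (x + y)"
    using val_ge_diff[of "int_val v x + 1" "x + y" y] assms by (auto simp: val_ge_iff)
  then have "x + y \<noteq> 0" by auto
  moreover have "val_ge v (int_val v x) (x + y)"
    using assms by (intro val_ge_add) (auto simp: val_ge_iff intro: val_ge_mono)
  ultimately show ?thesis using * by (auto simp: val_ge_iff)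
qed

lemma uniformizer: "\<exists>p. p \<noteq> 0 \<and> int_val v p = 1"
proof -
  obtain p where "v p = Fin 1" using v by (auto simp: places_def)
  then show ?thesis using place_eq_Pinf[of p] place_int_val[of p] by (intro exI[of _ p]) auto
qed

lemma is_subring_valuation_ring: "is_subring {x. val_ge v 0 x}"
  using val_ge_mult[of 0 _ 0] by (auto simp: is_subring_def val_ge_1 val_ge_diff)

lemma valuation_ring_iff: "x \<in> valuation_ring v \<longleftrightarrow> val_ge v 0 x"
  by (simp add: valuation_ring_def val_ge_def)

lemma max_ideal_iff: "x \<in> max_ideal v \<longleftrightarrow> val_ge v 1 x"
  using place_eq_Pinf[of 0] by (cases "x = 0") (auto simp: max_ideal_def val_ge_def place_int_val)

lemma val_ge_poly_emb:
  assumes "val_ge v 0 (poly_emb [:0, 1:])" shows "val_ge v 0 (poly_emb p)"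
proof (induction p)
  case (pCons a p)
  have "pCons a p = [:a:] + [:0, 1:] * p" by simp
  then have "poly_emb (pCons a p) = const_emb emb a + poly_emb [:0, 1:] * poly_emb p"
    by (simp only: poly_emb_hom const_emb_eq)
  then show ?case
    using val_ge_add[OF val_ge_const, of _ a] val_ge_mult[OF assms pCons(2)] by simp
qed simp

end

text \<open>
  Otherwise the valuation ring of \<open>v\<close> would be contained in that of \<open>w\<close>.  Units of \<open>v\<close> would then be
  units of \<open>w\<close>, so that \<open>w\<close> would be a multiple of \<open>v\<close>, and equal to it by normalisation.
\<close>

lemma place_separation:
  assumes v: "v \<in> places emb" and w: "w \<in> places emb" and ne: "v \<noteq> w"
  shows "\<exists>x. x \<noteq> 0 \<and> int_val v x \<ge> 0 \<and> int_val w x < 0"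
proof (rule ccontr)
  assume "\<not> ?thesis"
  then have le: "int_val w x \<ge> 0" if "x \<noteq> 0" "int_val v x \<ge> 0" for x using that by force
  have unit: "int_val w x = 0" if "x \<noteq> 0" "int_val v x = 0" for x
    using le[of x] le[of "inverse x"] that by (simp add: int_val_inverse[OF v] int_val_inverse[OF w])
  obtain p where p: "p \<noteq> 0" "int_val v p = 1" using uniformizer[OF v] by blast
  obtain r where r: "r \<noteq> 0" "int_val w r = 1" using uniformizer[OF w] by blast
  have scale: "int_val w x = int_val v x * int_val w p" if x: "x \<noteq> 0" for x
  proof (cases "int_val v x \<ge> 0")
    case True
    have "int_val v (x / p ^ nat (int_val v x)) = 0"
      using x p True by (simp add: int_val_divide[OF v] int_val_power[OF v])
    then have "int_val w (x / p ^ nat (int_val v x)) = 0" using unit x p by simp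
    then show ?thesis using x p True by (simp add: int_val_divide[OF w] int_val_power[OF w])
  next
    case False
    have "int_val v (x * p ^ nat (- int_val v x)) = 0"
      using x p False by (simp add: int_val_mult[OF v] int_val_power[OF v])
    then have "int_val w (x * p ^ nat (- int_val v x)) = 0" using unit x p by simp
    then show ?thesis using x p False by (simp add: int_val_mult[OF w] int_val_power[OF w])
  qed
  have "int_val w p \<ge> 0" using le[of p] p by simp
  moreover have "int_val v r * int_val w p = 1" using scale[OF r(1)] r by simp
  ultimately have "int_val w p = 1" by (metis pos_zmult_eq_1_iff mult.commute not_le order_le_less zero_neq_one mult_zero_left)
  then have "int_val w x = int_val v x" if "x \<noteq> 0" for x using scale[OF that] by simp
  then have "v x = w x" for x
    using place_int_val[OF v, of x] place_int_val[OF w, of x] place_eq_Pinf[OF v, of x] place_eq_Pinf[OF w, of x]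
    by (cases "x = 0") auto
  with ne show False by auto
qed

lemma place_separation_strict:
  assumes v: "v \<in> places emb" and w: "w \<in> places emb" and ne: "v \<noteq> w"
  shows "\<exists>x. x \<noteq> 0 \<and> int_val v x > 0 \<and> int_val w x < 0"
proof -
  obtain x where x: "x \<noteq> 0" "int_val v x \<ge> 0" "int_val w x < 0"
    using place_separation[OF v w ne] by blast
  obtain y where y: "y \<noteq> 0" "int_val w y \<ge> 0" "int_val v y < 0"
    using place_separation[OF w v] ne by blast
  show ?thesis
    using x y by (intro exI[of _ "x / y"]) (simp add: int_val_divide[OF v] int_val_divide[OF w])
qed

text \<open>
  By induction on \<open>S\<close>: if \<open>y\<close> serves for \<open>S\<close> but not for the new place \<open>w\<close>, add a high power of an element
  \<open>z\<close> that separates \<open>v\<close> from \<open>w\<close>.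
\<close>

lemma place_separation_finite:
  assumes "finite S" "S \<subseteq> places emb" and v: "v \<in> places emb" "v \<notin> S"
  shows "\<exists>x. x \<noteq> 0 \<and> int_val v x > 0 \<and> (\<forall>w\<in>S. int_val w x < 0)"
  using assms(1,2,4)
proof (induction S rule: finite_induct)
  case empty
  then show ?case using uniformizer[OF v(1)] by fastforce
next
  case (insert w S)
  then obtain y where y: "y \<noteq> 0" "int_val v y > 0" "\<And>w. w \<in> S \<Longrightarrow> int_val w y < 0" by auto
  have w: "w \<in> places emb" and S: "\<And>w'. w' \<in> S \<Longrightarrow> w' \<in> places emb" using insert.prems by auto
  show ?case
  proof (cases "int_val w y < 0")
    case True
    then show ?thesis using y by blast
  next
    case False
    have "v \<noteq> w" using insert.prems by auto
    then obtain z where z: "z \<noteq> 0" "int_val v z > 0" "int_val w z < 0"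
      using place_separation_strict[OF v(1) w] by blast
    \<comment> \<open>A power of \<open>z\<close> whose value differs from that of \<open>y\<close> at every place of \<open>S\<close>, so that no
      cancellation occurs in the sum.\<close>
    define m where "m = Suc (nat (\<Sum>w\<in>S. \<bar>int_val w y\<bar>))"
    have m: "\<bar>int_val w' y\<bar> < int m" if "w' \<in> S" for w'
      using member_le_sum[OF that, of "\<lambda>w. \<bar>int_val w y\<bar>"] insert.hyps by (simp add: m_def)
    have m_pos: "0 < int m" by (simp only: m_def of_nat_0_less_iff zero_less_Suc)
    have neg: "y + z ^ m \<noteq> 0 \<and> int_val w' (y + z ^ m) < 0" if w': "w' \<in> insert w S" for w'
    proof -
      have p: "w' \<in> places emb" using w' w S by auto
      have zm: "int_val w' (z ^ m) = int m * int_val w' z" using z by (simp add: int_val_power[OF p])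
      have "int_val w' (z ^ m) < int_val w' y \<and> int_val w' (z ^ m) < 0 \<or>
        int_val w' y < int_val w' (z ^ m) \<and> int_val w' y < 0"
      proof (cases "w' \<in> S")
        case True
        show ?thesis
        proof (cases "int_val w' z < 0")
          case neg: True
          then have "int m * int_val w' z \<le> int m * (- 1)" by (intro mult_left_mono) auto
          then have "int_val w' (z ^ m) \<le> - int m" using zm by simp
          then show ?thesis using m[OF True] m_pos by linarith
        next
          case False
          then have "0 \<le> int m * int_val w' z" by simp
          then show ?thesis using y(3)[OF True] zm by simp
        qed
      next
        case False
        then have "w' = w" using w' by simp
        moreover have "int m * int_val w z < 0" using z m_pos by (intro mult_pos_neg)
        ultimately show ?thesis using zm \<open>\<not> int_val w y < 0\<close> by simp
      qed
      then show ?thesis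
      proof
        assume a: "int_val w' (z ^ m) < int_val w' y \<and> int_val w' (z ^ m) < 0"
        show ?thesis using int_val_add_eq[OF p, of "z ^ m" y] a y z by (auto simp: val_ge_iff[OF p] add.commute)
      next
        assume a: "int_val w' y < int_val w' (z ^ m) \<and> int_val w' y < 0"
        show ?thesis using int_val_add_eq[OF p, of y "z ^ m"] a y z by (auto simp: val_ge_iff[OF p])
      qed
    qed
    have "int_val v (z ^ m) > 0" using z m_pos by (simp add: int_val_power[OF v(1)])
    then have "val_ge v 1 (y + z ^ m)"
      using y z by (intro val_ge_add[OF v(1)]) (auto simp: val_ge_iff[OF v(1)])
    moreover have "y + z ^ m \<noteq> 0" using neg by blast
    ultimately show ?thesis using neg
      by (intro exI[of _ "y + z ^ m"]) (auto simp: val_ge_iff[OF v(1)])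
  qed
qed

text \<open>
  If \<open>x\<close> has a zero at \<open>v\<close> and poles at \<open>S\<close>, then \<open>1 / (1 + x\<^sup>m)\<close> tends to \<open>1\<close> at \<open>v\<close> and to \<open>0\<close> at \<open>S\<close> as
  \<open>m\<close> grows.
\<close>

lemma approximate_indicator:
  assumes S: "finite S" "S \<subseteq> places emb" and v: "v \<in> places emb" "v \<notin> S"
  shows "\<exists>e. val_ge v (int N) (e - 1) \<and> (\<forall>w\<in>S. val_ge w (int N) e)"
proof -
  obtain x where x: "x \<noteq> 0" "int_val v x > 0" "\<And>w. w \<in> S \<Longrightarrow> int_val w x < 0"
    using place_separation_finite[OF S v] by blast
  define m where "m = Suc N"
  have xm: "int_val v (x ^ m) \<ge> int m"
    using x mult_left_mono[of 1 "int_val v x" "int m"] by (simp add: int_val_power[OF v(1)])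
  have 1: "1 + x ^ m \<noteq> 0 \<and> int_val v (1 + x ^ m) = 0"
    using int_val_add_eq[OF v(1), of 1 "x ^ m"] xm x by (simp add: val_ge_iff[OF v(1)] int_val_1[OF v(1)] m_def)
  have "inverse (1 + x ^ m) - 1 = - (x ^ m / (1 + x ^ m))"
    using 1 by (simp add: field_simps)
  moreover have "val_ge v (int N) (x ^ m / (1 + x ^ m))"
    using 1 x xm int_val_divide[OF v(1), of "x ^ m" "1 + x ^ m"]
    by (simp add: val_ge_iff[OF v(1)] m_def)
  ultimately have "val_ge v (int N) (inverse (1 + x ^ m) - 1)"
    using val_ge_uminus[OF v(1)] by simp
  moreover have "val_ge w (int N) (inverse (1 + x ^ m))" if w: "w \<in> S" for w
  proof -
    have p: "w \<in> places emb" using S w by auto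
    have "int m * int_val w x \<le> int m * (- 1)" using x(3)[OF w] by (intro mult_left_mono) auto
    then have le: "int_val w (x ^ m) \<le> - int m" using x by (simp add: int_val_power[OF p])
    then have "int_val w (x ^ m + 1) = int_val w (x ^ m)"
      using int_val_add_eq[OF p, of "x ^ m" 1] x by (simp add: val_ge_iff[OF p] int_val_1[OF p] m_def)
    then show ?thesis using le 1
      by (simp add: val_ge_iff[OF p] int_val_inverse[OF p] add.commute m_def)
  qed
  ultimately show ?thesis by blast
qed

lemma weak_approximation:
  assumes S: "finite S" "S \<subseteq> places emb"
  shows "\<exists>y. \<forall>v\<in>S. val_ge v N (y - a v)"
proof -
  \<comment> \<open>The indicators are needed to a precision that survives multiplication by the targets.\<close>
  define M where "M = nat N + nat (\<Sum>v\<in>S. \<Sum>w\<in>S. \<bar>int_val v (a w)\<bar>)"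
  have "\<exists>e. val_ge w (int M) (e - 1) \<and> (\<forall>v\<in>S - {w}. val_ge v (int M) e)" if "w \<in> S" for w
    using approximate_indicator[of "S - {w}" w M] S that by auto
  then obtain e where e: "\<And>w. w \<in> S \<Longrightarrow> val_ge w (int M) (e w - 1)"
    "\<And>w v. w \<in> S \<Longrightarrow> v \<in> S \<Longrightarrow> v \<noteq> w \<Longrightarrow> val_ge v (int M) (e w)"
    by (metis DiffI singletonD)
  have "val_ge v N ((\<Sum>w\<in>S. e w * a w) - a v)" if v: "v \<in> S" for v
  proof -
    have p: "v \<in> places emb" using v S by auto
    have small: "val_ge v N (x * a w)" if "w \<in> S" "val_ge v (int M) x" for x w
    proof (cases "a w = 0")
      case False
      have "\<bar>int_val v (a w)\<bar> \<le> (\<Sum>w\<in>S. \<bar>int_val v (a w)\<bar>)"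
        using that S by (intro member_le_sum) auto
      also have "\<dots> \<le> (\<Sum>v\<in>S. \<Sum>w\<in>S. \<bar>int_val v (a w)\<bar>)"
        using v S by (intro member_le_sum[of v S "\<lambda>v. \<Sum>w\<in>S. \<bar>int_val v (a w)\<bar>"]) (auto intro: sum_nonneg)
      finally have "\<bar>int_val v (a w)\<bar> \<le> (\<Sum>v\<in>S. \<Sum>w\<in>S. \<bar>int_val v (a w)\<bar>)" .
      then have "N \<le> int M + int_val v (a w)" unfolding M_def by linarith
      then show ?thesis
        using val_ge_mult[OF p that(2), of "int_val v (a w)" "a w"] False
        by (auto simp: val_ge_iff[OF p] intro: val_ge_mono[OF p])
    qed (simp add: val_ge_0[OF p])
    have "(\<Sum>w\<in>S. e w * a w) - a v = (e v - 1) * a v + (\<Sum>w\<in>S - {v}. e w * a w)"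
      using v S by (simp add: sum.remove algebra_simps)
    moreover have "val_ge v N ((e v - 1) * a v)" using small v e by blast
    moreover have "val_ge v N (\<Sum>w\<in>S - {v}. e w * a w)"
      using e v by (intro val_ge_sum[OF p] small) auto
    ultimately show ?thesis using val_ge_add[OF p] by simp
  qed
  then show ?thesis by blast
qed

end

context function_field_basis
begin

text \<open>
  Elements independent modulo the maximal ideal have \<open>q\<close> to the power of their number many pairwise
  incongruent combinations, and \<open>card_incongruent_le\<close>, applied to a uniformizer, limits these.  A
  largest independent set is a basis.
\<close>

lemma residue_basis_exists:
  assumes v: "v \<in> places emb" shows "\<exists>B. residue_basis emb v B"
proof -
  let ?O = "{x. val_ge v 0 x}"
  obtain p where p: "p \<noteq> 0" "int_val v p = 1" using uniformizer[OF v] by blast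
  obtain m where m: "height_le p m" using height_le_exists by blast
  define s where "s C c = (\<Sum>b\<in>C. const_emb emb (c b) * b)" for C and c :: "'l \<Rightarrow> 'k"
  define indep where "indep C \<longleftrightarrow> finite C \<and> C \<subseteq> ?O \<and>
    (\<forall>c c'. val_ge v 1 (s C c - s C c') \<longrightarrow> (\<forall>b\<in>C. c b = c' b))" for C
  have s_O: "val_ge v 0 (s C c)" if "C \<subseteq> ?O" for C c
    unfolding s_def using that val_ge_mult[OF v val_ge_const[OF v]]
    by (intro val_ge_sum[OF v]) auto
  have bound: "card C \<le> card U * m" if C: "indep C" for C
  proof -
    let ?E = "C \<rightarrow>\<^sub>E (UNIV :: 'k set)"
    have inj: "c = c'" if "c \<in> ?E" "c' \<in> ?E" "val_ge v 1 (s C c - s C c')" for c c'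
      using that C unfolding indep_def by (metis PiE_ext)
    have "card (s C ` ?E) \<le> CARD('k) ^ (card U * m)"
    proof (rule card_incongruent_le[OF is_subring_valuation_ring[OF v] _ p(1) m])
      show "p \<in> ?O" using p by (simp add: val_ge_iff[OF v])
      show "finite (s C ` ?E)" using C by (auto simp: indep_def intro!: finite_PiE)
      show "s C ` ?E \<subseteq> ?O" using C s_O by (auto simp: indep_def)
      fix y y' assume "y \<in> s C ` ?E" "y' \<in> s C ` ?E" "y \<noteq> y'"
      then show "(y - y') / p \<notin> ?O" using inj p by (auto simp: val_ge_divide_iff[OF v])
    qed
    moreover have "inj_on (s C) ?E" using inj by (auto intro!: inj_onI simp: val_ge_0[OF v])
    moreover have "card ?E = CARD('k) ^ card C" using C by (simp add: indep_def card_PiE)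
    ultimately have "CARD('k) ^ card C \<le> CARD('k) ^ (card U * m)" by (metis card_image)
    then show ?thesis by (rule power_le_imp_le_exp[OF card_gt_1])
  qed
  have "indep {}" by (simp add: indep_def)
  then obtain C where C: "indep C" and max: "\<And>C'. indep C' \<Longrightarrow> card C' \<le> card C"
    using ex_has_greatest_nat[of indep "{}" card "Suc (card U * m)"] bound le_imp_less_Suc by metis
  have span: "\<exists>c. val_ge v 1 (x - s C c)" if x: "val_ge v 0 x" for x
  proof (rule ccontr)
    assume no: "\<not> ?thesis"
    have fin: "finite C" "C \<subseteq> ?O" using C by (auto simp: indep_def)
    have "x \<notin> C"
    proof
      assume "x \<in> C"
      then have "s C (\<lambda>b. if b = x then 1 else 0) = x"
        using fin by (simp add: s_def if_distrib[of "const_emb emb"] const_emb_hom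
            if_distrib[of "\<lambda>a. a * _"] cong: if_cong)
      with no show False using val_ge_0[OF v, of 1] by (metis diff_self)
    qed
    have "indep (insert x C)"
      unfolding indep_def
    proof (intro conjI allI impI)
      show "finite (insert x C)" "insert x C \<subseteq> ?O" using fin x by auto
      fix c c' assume "val_ge v 1 (s (insert x C) c - s (insert x C) c')"
      then have *: "val_ge v 1 (const_emb emb (c x - c' x) * x + (s C c - s C c'))"
        using fin \<open>x \<notin> C\<close>
        by (simp add: s_def const_emb_hom algebra_simps)
      have "c x = c' x"
      proof (rule ccontr)
        assume "c x \<noteq> c' x"
        define a where "a = c x - c' x"
        have a: "a \<noteq> 0" using \<open>c x \<noteq> c' x\<close> by (simp add: a_def)
        have inv: "const_emb emb (inverse a) * const_emb emb a = 1"
          using a by (simp add: const_emb_hom flip: const_emb_hom(3))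
        let ?d = "\<lambda>b. inverse a * (c' b - c b)"
        have sd: "s C ?d = const_emb emb (inverse a) * (s C c' - s C c)"
          by (simp add: s_def const_emb_hom sum_subtractf sum_distrib_left algebra_simps)
        have "val_ge v (0 + 1) (const_emb emb (inverse a) * (const_emb emb a * x + (s C c - s C c')))"
          using * unfolding a_def[symmetric] by (intro val_ge_mult[OF v] val_ge_const[OF v])
        moreover have "const_emb emb (inverse a) * (const_emb emb a * x + (s C c - s C c')) = x - s C ?d"
          using inv unfolding sd by (simp add: algebra_simps)
        ultimately show False using no by simp
      qed
      moreover from this have "val_ge v 1 (s C c - s C c')"
        using * by (simp add: const_emb_hom)
      then have "\<forall>b\<in>C. c b = c' b" using C by (simp add: indep_def)
      ultimately show "\<forall>b\<in>insert x C. c b = c' b" by simp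
    qed
    then have "card (insert x C) \<le> card C" by (rule max)
    with fin \<open>x \<notin> C\<close> show False by simp
  qed
  have "\<exists>!c. c \<in> C \<rightarrow>\<^sub>E UNIV \<and> val_ge v 1 (x - s C c)" if x: "val_ge v 0 x" for x
  proof -
    obtain c where c: "val_ge v 1 (x - s C c)" using span[OF x] by blast
    have "s C (restrict c C) = s C c" by (simp add: s_def)
    moreover have "c1 = c2" if "c1 \<in> C \<rightarrow>\<^sub>E UNIV" "c2 \<in> C \<rightarrow>\<^sub>E UNIV"
      "val_ge v 1 (x - s C c1)" "val_ge v 1 (x - s C c2)" for c1 c2
    proof -
      have "val_ge v 1 (s C c1 - s C c2)" using val_ge_diff[OF v that(4,3)] by simp
      then show ?thesis using C that(1,2) unfolding indep_def by (metis PiE_ext)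
    qed
    ultimately show ?thesis using c by (intro ex_ex1I exI[of _ "restrict c C"]) auto
  qed
  then have "residue_basis emb v C"
    using C unfolding residue_basis_def indep_def s_def
    by (auto simp: valuation_ring_iff[OF v] max_ideal_iff[OF v])
  then show ?thesis ..
qed

text \<open>
  The number of residue classes at a place is all that matters about its degree.
\<close>

lemma residue_system:
  assumes v: "v \<in> places emb"
  obtains T where "finite T" "card T = CARD('k) ^ place_degree emb v"
    "\<And>t. t \<in> T \<Longrightarrow> val_ge v 0 t"
    "\<And>t t'. t \<in> T \<Longrightarrow> t' \<in> T \<Longrightarrow> val_ge v 1 (t - t') \<Longrightarrow> t = t'"
    "\<And>x. val_ge v 0 x \<Longrightarrow> \<exists>t\<in>T. val_ge v 1 (x - t)"
proof -
  obtain B where B: "residue_basis emb v B" using residue_basis_exists[OF v] by blast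
  define s where "s c = (\<Sum>b\<in>B. const_emb emb (c b) * b)" for c
  let ?E = "B \<rightarrow>\<^sub>E (UNIV :: 'k set)"
  have fin: "finite B" and BO: "b \<in> B \<Longrightarrow> val_ge v 0 b" for b
    using B by (auto simp: residue_basis_def valuation_ring_iff[OF v])
  have ex1: "\<exists>!c. c \<in> ?E \<and> val_ge v 1 (x - s c)" if "val_ge v 0 x" for x
    using B that unfolding residue_basis_def s_def
    by (auto simp: valuation_ring_iff[OF v] max_ideal_iff[OF v])
  have s_O: "val_ge v 0 (s c)" for c
    unfolding s_def using BO val_ge_mult[OF v val_ge_const[OF v]] by (intro val_ge_sum[OF v]) fastforce
  have inj: "c = c'" if "c \<in> ?E" "c' \<in> ?E" "val_ge v 1 (s c - s c')" for c c'
    using ex1[OF s_O[of c]] that val_ge_0[OF v, of 1] by (metis diff_self)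
  show ?thesis
  proof (rule that[of "s ` ?E"])
    have "inj_on s ?E" using inj by (auto intro!: inj_onI simp: val_ge_0[OF v])
    then show "card (s ` ?E) = CARD('k) ^ place_degree emb v"
      using fin by (simp add: card_image card_PiE place_degree_eq[OF v B])
    show "finite (s ` ?E)" using fin by (auto intro!: finite_PiE)
    show "\<exists>t\<in>s ` ?E. val_ge v 1 (x - t)" if "val_ge v 0 x" for x using ex1[OF that] by blast
  qed (use inj s_O in auto)
qed

lemma place_degree_pos:
  assumes v: "v \<in> places emb" shows "place_degree emb v > 0"
proof (rule ccontr)
  assume "\<not> ?thesis"
  then obtain T where T: "card T = 1" "\<And>x. val_ge v 0 x \<Longrightarrow> \<exists>t\<in>T. val_ge v 1 (x - t)"
    using residue_system[OF v] by (metis not_gr_zero power_0)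
  obtain t where "T = {t}" using T(1) card_1_singletonE by blast
  then have "val_ge v 1 (1 - t)" "val_ge v 1 (0 - t)"
    using T(2)[of 1] T(2)[of 0] val_ge_1[OF v] val_ge_0[OF v] by auto
  then have "val_ge v 1 1" using val_ge_diff[OF v, of 1 "1 - t" "0 - t"] by simp
  then show False by (simp add: val_ge_iff[OF v] int_val_1[OF v])
qed

text \<open>
  Representatives modulo the \<open>e\<close>-th power of the maximal ideal are the digit sums of length \<open>e\<close> in a
  uniformizer, with digits from a residue system.
\<close>

lemma incongruent_system:
  assumes v: "v \<in> places emb"
  shows "\<exists>Y. finite Y \<and> card Y = CARD('k) ^ (e * place_degree emb v) \<and> (\<forall>y\<in>Y. val_ge v 0 y) \<and>
    (\<forall>y\<in>Y. \<forall>y'\<in>Y. val_ge v (int e) (y - y') \<longrightarrow> y = y')"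
proof (induction e)
  case 0
  show ?case by (rule exI[of _ "{0}"]) (simp add: val_ge_0[OF v])
next
  case (Suc e)
  then obtain Y where Y: "finite Y" "card Y = CARD('k) ^ (e * place_degree emb v)"
    "\<And>y. y \<in> Y \<Longrightarrow> val_ge v 0 y"
    "\<And>y y'. y \<in> Y \<Longrightarrow> y' \<in> Y \<Longrightarrow> val_ge v (int e) (y - y') \<Longrightarrow> y = y'" by metis
  obtain T where T: "finite T" "card T = CARD('k) ^ place_degree emb v"
    "\<And>t. t \<in> T \<Longrightarrow> val_ge v 0 t"
    "\<And>t t'. t \<in> T \<Longrightarrow> t' \<in> T \<Longrightarrow> val_ge v 1 (t - t') \<Longrightarrow> t = t'"
    using residue_system[OF v] by metis
  obtain p where p: "p \<noteq> 0" "int_val v p = 1" using uniformizer[OF v] by blast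
  let ?f = "\<lambda>(t, y). t + p * y"
  have inc: "t = t' \<and> y = y'" if "t \<in> T" "t' \<in> T" "y \<in> Y" "y' \<in> Y"
    "val_ge v (int (Suc e)) (t + p * y - (t' + p * y'))" for t t' y y'
  proof -
    have "val_ge v 0 (y - y')" using Y that by (intro val_ge_diff[OF v])
    then have "val_ge v 1 (p * (y - y'))" using p by (simp add: val_ge_mult_iff[OF v])
    moreover have "val_ge v 1 (t + p * y - (t' + p * y'))"
      using that(5) by (rule val_ge_mono[OF v]) simp
    ultimately have "val_ge v 1 (t + p * y - (t' + p * y') - p * (y - y'))"
      using val_ge_diff[OF v] by blast
    then have t: "t = t'" using T(4) that by (simp add: algebra_simps)
    then have "val_ge v (int (Suc e)) (p * (y - y'))" using that(5) by (simp add: algebra_simps)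
    then have "val_ge v (int e) (y - y')" using p by (simp add: val_ge_mult_iff[OF v])
    then show ?thesis using t Y that by blast
  qed
  have "inj_on ?f (T \<times> Y)"
  proof (rule inj_onI, clarsimp)
    fix t y t' y' assume "t \<in> T" "y \<in> Y" "t' \<in> T" "y' \<in> Y" "t + p * y = t' + p * y'"
    then show "t = t' \<and> y = y'" using inc val_ge_0[OF v] by simp
  qed
  then have "card (?f ` (T \<times> Y)) = CARD('k) ^ (Suc e * place_degree emb v)"
    using T Y by (simp add: card_image card_cartesian_product power_add)
  moreover have "\<forall>y\<in>?f ` (T \<times> Y). val_ge v 0 y"
  proof clarsimp
    fix t y assume "t \<in> T" "y \<in> Y"
    moreover have "val_ge v 0 p" using p by (simp add: val_ge_iff[OF v])
    ultimately show "val_ge v 0 (t + p * y)"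
      using T Y val_ge_mult[OF v, of 0 p 0 y] by (intro val_ge_add[OF v]) auto
  qed
  moreover have "\<forall>y\<in>?f ` (T \<times> Y). \<forall>y'\<in>?f ` (T \<times> Y). val_ge v (int (Suc e)) (y - y') \<longrightarrow> y = y'"
    using inc by fastforce
  ultimately show ?case using T Y by (intro exI[of _ "?f ` (T \<times> Y)"]) simp
qed

text \<open>
  The classical bound of the number of zeros, counted with multiplicity and degree, by
  \<open>[L : \<F>\<^sub>q(z)]\<close>, with \<open>card U * m\<close> in place of this degree.  By weak approximation, residue classes at the places of \<open>S\<close> can be prescribed
  independently, so the ring of elements integral on \<open>S\<close> has at least \<open>q\<close> to that number many classes
  modulo \<open>z\<close>.
\<close>

lemma sum_valuations_le:
  assumes z: "z \<noteq> 0" "height_le z m" and S: "finite S" "S \<subseteq> places emb"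
    and nonneg: "\<And>v. v \<in> S \<Longrightarrow> int_val v z \<ge> 0"
  shows "(\<Sum>v\<in>S. int_val v z * int (place_degree emb v)) \<le> int (card U * m)"
proof -
  let ?R = "{x. \<forall>v\<in>S. val_ge v 0 x}"
  define e where "e v = nat (int_val v z)" for v
  have "\<exists>Y. finite Y \<and> card Y = CARD('k) ^ (e v * place_degree emb v) \<and> (\<forall>y\<in>Y. val_ge v 0 y) \<and>
    (\<forall>y\<in>Y. \<forall>y'\<in>Y. val_ge v (int (e v)) (y - y') \<longrightarrow> y = y')" if "v \<in> S" for v
    using incongruent_system that S by blast
  then obtain Y where Y: "\<And>v. v \<in> S \<Longrightarrow> finite (Y v)"
    "\<And>v. v \<in> S \<Longrightarrow> card (Y v) = CARD('k) ^ (e v * place_degree emb v)"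
    "\<And>v y. v \<in> S \<Longrightarrow> y \<in> Y v \<Longrightarrow> val_ge v 0 y"
    "\<And>v y y'. v \<in> S \<Longrightarrow> y \<in> Y v \<Longrightarrow> y' \<in> Y v \<Longrightarrow> val_ge v (int (e v)) (y - y') \<Longrightarrow> y = y'"
    by metis
  define N where "N = (\<Sum>v\<in>S. int_val v z)"
  have eN: "int (e v) = int_val v z \<and> int_val v z \<le> N" if "v \<in> S" for v
    using nonneg S that member_le_sum[of v S "\<lambda>v. int_val v z"] by (simp add: N_def e_def)
  have "\<exists>y. \<forall>f. \<forall>v\<in>S. val_ge v N (y f - f v)"
    using weak_approximation[OF S, of N] by (intro choice allI) blast
  then obtain y where y: "\<And>f v. v \<in> S \<Longrightarrow> val_ge v N (y f - f v)" by blast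
  have inc: "f v = g v" if "v \<in> S" "f \<in> Pi\<^sub>E S Y" "g \<in> Pi\<^sub>E S Y" "val_ge v (int_val v z) (y f - y g)" for f g v
  proof -
    have p: "v \<in> places emb" using that S by auto
    have "val_ge v (int_val v z) (y f - f v)" "val_ge v (int_val v z) (y g - g v)"
      using y eN that(1) val_ge_mono[OF p] by blast+
    then have "val_ge v (int_val v z) ((y f - y g) - (y f - f v) + (y g - g v))"
      using val_ge_add[OF p val_ge_diff[OF p that(4)]] by blast
    then show ?thesis using that eN[OF that(1)] by (intro Y(4)[OF that(1)]) (auto simp: PiE_iff)
  qed
  have inj: "inj_on y (Pi\<^sub>E S Y)"
  proof (rule inj_onI)
    fix f g assume *: "f \<in> Pi\<^sub>E S Y" "g \<in> Pi\<^sub>E S Y" "y f = y g"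
    have "f v = g v" if "v \<in> S" for v using inc[OF that *(1,2)] * val_ge_0 that S by auto
    then show "f = g" using * by (meson PiE_ext)
  qed
  have "card (y ` Pi\<^sub>E S Y) \<le> CARD('k) ^ (card U * m)"
  proof (rule card_incongruent_le[OF _ _ z])
    show "is_subring ?R"
      using is_subring_valuation_ring S unfolding is_subring_def by blast
    show "z \<in> ?R" using nonneg z S by (auto simp: val_ge_iff)
    show "finite (y ` Pi\<^sub>E S Y)" using Y S by (auto intro!: finite_PiE)
    show "y ` Pi\<^sub>E S Y \<subseteq> ?R"
    proof clarsimp
      fix f v assume *: "f \<in> Pi\<^sub>E S Y" "v \<in> S"
      then have p: "v \<in> places emb" using S by auto
      have "val_ge v 0 (f v)" using * Y(3) by (auto simp: PiE_iff)
      moreover have "val_ge v 0 (y f - f v)"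
        using y[OF *(2), of f] eN[OF *(2)] nonneg[OF *(2)] by (auto intro: val_ge_mono[OF p])
      ultimately show "val_ge v 0 (y f)" using val_ge_add[OF p, of 0 "y f - f v" "f v"] by simp
    qed
    fix a b assume "a \<in> y ` Pi\<^sub>E S Y" "b \<in> y ` Pi\<^sub>E S Y" "a \<noteq> b"
    then obtain f g where fg: "f \<in> Pi\<^sub>E S Y" "g \<in> Pi\<^sub>E S Y" "a = y f" "b = y g" "f \<noteq> g" by blast
    then obtain v where v: "v \<in> S" "f v \<noteq> g v" by (meson PiE_ext)
    then have "\<not> val_ge v 0 ((a - b) / z)"
      using inc[OF v(1) fg(1,2)] fg z S by (auto simp: val_ge_divide_iff)
    then show "(a - b) / z \<notin> ?R" using v by blast
  qed
  moreover have "card (y ` Pi\<^sub>E S Y) = CARD('k) ^ (\<Sum>v\<in>S. e v * place_degree emb v)"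
    using inj S Y by (simp add: card_image card_PiE power_sum)
  ultimately have "(\<Sum>v\<in>S. e v * place_degree emb v) \<le> card U * m"
    using power_le_imp_le_exp[OF card_gt_1] by simp
  then have "int (\<Sum>v\<in>S. e v * place_degree emb v) \<le> int (card U * m)" by (simp only: of_nat_le_iff)
  moreover have "int (\<Sum>v\<in>S. e v * place_degree emb v) =
      (\<Sum>v\<in>S. int_val v z * int (place_degree emb v))"
    using eN by (simp cong: sum.cong)
  ultimately show ?thesis by simp
qed

text \<open>
  Every zero contributes at least \<open>1\<close> to the sum bounded in \<open>sum_valuations_le\<close>.
\<close>

lemma finite_zeros:
  assumes z: "z \<noteq> 0" shows "finite {v \<in> places emb. int_val v z > 0}"
proof -
  obtain m where m: "height_le z m" using height_le_exists by blast
  have "card S \<le> card U * m" if S: "S \<subseteq> {v \<in> places emb. int_val v z > 0}" "finite S" for S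
  proof -
    have "int (card S) = (\<Sum>v\<in>S. 1)" by simp
    also have "\<dots> \<le> (\<Sum>v\<in>S. int_val v z * int (place_degree emb v))"
    proof (rule sum_mono)
      fix v assume "v \<in> S"
      then have "0 < int_val v z" "0 < int (place_degree emb v)" using S place_degree_pos by auto
      then have "0 < int_val v z * int (place_degree emb v)" by simp
      then show "1 \<le> int_val v z * int (place_degree emb v)" by linarith
    qed
    also have "\<dots> \<le> int (card U * m)" using S by (intro sum_valuations_le z m) auto
    finally show ?thesis by linarith
  qed
  then show ?thesis using finite_if_finite_subsets_card_bdd by blast
qed

lemma finite_poles:
  assumes z: "z \<noteq> 0" shows "finite {v \<in> places emb. int_val v z < 0}"
proof -
  have "{v \<in> places emb. int_val v z < 0} = {v \<in> places emb. int_val v (inverse z) > 0}"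
    using z by (auto simp: int_val_inverse)
  then show ?thesis using finite_zeros[of "inverse z"] z by simp
qed

end

section \<open>Existence of places\<close>

definition poly_adjoin :: "'a::field set \<Rightarrow> 'a \<Rightarrow> 'a set" where
  "poly_adjoin R z = {poly f z | f. \<forall>i. coeff f i \<in> R}"

lemma subring_sum:
  assumes "is_subring R" shows "(\<And>i. i \<in> I \<Longrightarrow> f i \<in> R) \<Longrightarrow> sum f I \<in> R"
  by (induction I rule: infinite_finite_induct)
     (simp_all add: subring_0[OF assms] subring_add[OF assms])

lemma subring_power:
  assumes "is_subring R" "x \<in> R" shows "x ^ n \<in> R"
  by (induction n) (simp_all add: subring_1[OF assms(1)] subring_mult[OF assms(1)] assms)

lemma is_subring_poly_adjoin:
  assumes R: "is_subring R" shows "is_subring (poly_adjoin R z)"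
  unfolding is_subring_def
proof (intro conjI ballI)
  show "1 \<in> poly_adjoin R z"
    unfolding poly_adjoin_def
    by (intro CollectI exI[of _ 1]) (simp add: coeff_1 subring_0[OF R] subring_1[OF R])
  fix a b assume "a \<in> poly_adjoin R z" "b \<in> poly_adjoin R z"
  then obtain f g where f: "a = poly f z" "\<And>i. coeff f i \<in> R" and g: "b = poly g z" "\<And>i. coeff g i \<in> R"
    unfolding poly_adjoin_def by blast
  show "a - b \<in> poly_adjoin R z"
    unfolding poly_adjoin_def
    by (intro CollectI exI[of _ "f - g"]) (simp add: f g subring_diff[OF R])
  show "a * b \<in> poly_adjoin R z"
    unfolding poly_adjoin_def
    by (intro CollectI exI[of _ "f * g"])
       (simp add: f g coeff_mult subring_sum[OF R] subring_mult[OF R])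
qed

lemma poly_adjoin_base:
  assumes R: "is_subring R" shows "R \<subseteq> poly_adjoin R z" "z \<in> poly_adjoin R z"
proof -
  show "R \<subseteq> poly_adjoin R z"
  proof
    fix a assume "a \<in> R"
    then have "coeff [:a:] i \<in> R" for i by (cases i) (simp_all add: subring_0[OF R])
    then show "a \<in> poly_adjoin R z"
      unfolding poly_adjoin_def by (intro CollectI exI[of _ "[:a:]"]) simp
  qed
  have "coeff [:0, 1:] i \<in> R" for i
    by (simp add: subring_0[OF R] subring_1[OF R] coeff_pCons split: nat.split)
  then show "z \<in> poly_adjoin R z"
    unfolding poly_adjoin_def by (intro CollectI exI[of _ "[:0, 1:]"]) simp
qed

text \<open>
  If the inverse of \<open>c = 1 - y b\<close> were missing, adjoining it would, by maximality, produce \<open>1 / y\<close>.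
  Multiplying by a power of \<open>c\<close> gives \<open>c\<^sup>n / y \<in> R\<close>; but \<open>c\<^sup>n\<close> is \<open>1\<close> modulo \<open>y\<close>, so \<open>1 / y\<close> would lie in
  \<open>R\<close> already.
\<close>

lemma maximal_subring_one_minus:
  fixes R :: "'a::field set"
  assumes R: "is_subring R" and y: "y \<in> R" "inverse y \<notin> R"
    and max: "\<And>S. is_subring S \<Longrightarrow> R \<subseteq> S \<Longrightarrow> inverse y \<notin> S \<Longrightarrow> S = R"
    and b: "b \<in> R"
  shows "inverse (1 - y * b) \<in> R"
proof (rule ccontr)
  assume no: "inverse (1 - y * b) \<notin> R"
  let ?c = "1 - y * b"
  have y0: "y \<noteq> 0" using y subring_0[OF R] by auto
  have c0: "?c \<noteq> 0" using no subring_0[OF R] by auto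
  have "inverse y \<in> poly_adjoin R (inverse ?c)"
    using max[OF is_subring_poly_adjoin[OF R]] poly_adjoin_base[OF R, of "inverse ?c"] no by auto
  then obtain f where f: "inverse y = poly f (inverse ?c)" "\<And>i. coeff f i \<in> R"
    unfolding poly_adjoin_def by blast
  have "?c \<in> R" using R b y by (intro subring_diff[OF R] subring_mult[OF R] subring_1[OF R])
  have "?c ^ degree f * inverse y = (\<Sum>i\<le>degree f. coeff f i * ?c ^ (degree f - i))"
    unfolding f(1) poly_altdef sum_distrib_left
    using c0 by (intro sum.cong refl) (simp add: power_diff field_simps)
  also have "\<dots> \<in> R"
    using f \<open>?c \<in> R\<close> by (intro subring_sum[OF R] subring_mult[OF R] subring_power[OF R])
  finally have *: "?c ^ degree f * inverse y \<in> R" .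
  have "\<exists>b'\<in>R. ?c ^ n = 1 - y * b'" for n
  proof (induction n)
    case 0
    show ?case using subring_0[OF R] by force
  next
    case (Suc n)
    then obtain b' where b': "b' \<in> R" "?c ^ n = 1 - y * b'" by blast
    have "?c ^ Suc n = 1 - y * (b + (?c * b'))" unfolding power_Suc b'(2) by (simp add: algebra_simps)
    then show ?case
      using b b'(1) \<open>?c \<in> R\<close> by (intro bexI[of _ "b + ?c * b'"]) (auto intro!: subring_add[OF R] subring_mult[OF R])
  qed
  then obtain b' where b': "b' \<in> R" "?c ^ degree f = 1 - y * b'" by blast
  have "inverse y - b' \<in> R" using * y0 unfolding b'(2) by (simp add: field_simps)
  then have "inverse y \<in> R" using subring_add[OF R _ b'(1)] by fastforce
  with y show False by simp
qed

text \<open>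
  In the relation \<open>1 = y g(1/z)\<close> the constant term of \<open>g\<close> can be moved to the left, as \<open>1 - y g\<^sub>0\<close> is
  invertible.  Multiplied by \<open>z\<^sup>n\<close>, \<open>n = deg f\<close>, the relation then expresses \<open>z\<^sup>n\<close> by lower powers of \<open>z\<close>,
  and these replace the leading term of \<open>f\<close>.
\<close>

lemma reduce_degree:
  fixes R :: "'a::field set"
  assumes R: "is_subring R" and y: "y \<in> R" "inverse y \<notin> R"
    and inv: "\<And>b. b \<in> R \<Longrightarrow> inverse (1 - y * b) \<in> R"
    and z: "z \<noteq> 0"
    and f: "\<And>i. coeff f i \<in> R" "inverse y = poly f z"
    and g: "\<And>i. coeff g i \<in> R" "inverse y = poly g (inverse z)"
    and deg: "degree g \<le> degree f"
  shows "\<exists>f'. (\<forall>i. coeff f' i \<in> R) \<and> inverse y = poly f' z \<and> degree f' < degree f"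
proof -
  let ?n = "degree f" and ?c = "1 - y * coeff g 0"
  have y0: "y \<noteq> 0" using y subring_0[OF R] by auto
  have c0: "?c \<noteq> 0"
  proof
    assume "?c = 0"
    then have "inverse y = coeff g 0" using y0 by (simp add: field_simps)
    then show False using g(1)[of 0] y by simp
  qed
  have n0: "?n > 0"
  proof (rule ccontr)
    assume "\<not> ?n > 0"
    then have "inverse y = coeff f 0" using f(2) by (simp add: poly_altdef)
    then show False using f(1)[of 0] y by simp
  qed
  define w where "w = y * inverse ?c"
  have w: "w \<in> R" unfolding w_def using inv[OF g(1)] y by (intro subring_mult[OF R])
  define h where "h = (\<Sum>j=1..degree g. monom (w * coeff g j) (?n - j))"
  have "1 = y * poly g (inverse z)" using g(2) y0 by (metis right_inverse)
  also have "\<dots> = y * coeff g 0 + y * (\<Sum>j=1..degree g. coeff g j * inverse z ^ j)"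
    unfolding poly_altdef by (simp add: atMost_atLeast0 sum.atLeast_Suc_atMost algebra_simps)
  finally have "?c = y * (\<Sum>j=1..degree g. coeff g j * inverse z ^ j)"
    by (simp add: algebra_simps)
  then have one: "w * (\<Sum>j=1..degree g. coeff g j * inverse z ^ j) = 1"
    using c0 by (simp add: w_def field_simps)
  have "z ^ ?n = z ^ ?n * (w * (\<Sum>j=1..degree g. coeff g j * inverse z ^ j))"
    unfolding one by simp
  also have "\<dots> = poly h z"
    unfolding h_def poly_sum sum_distrib_left
  proof (intro sum.cong refl)
    fix j assume "j \<in> {1..degree g}"
    then have "j \<le> ?n" using deg by simp
    then have "z ^ ?n * inverse z ^ j = z ^ (?n - j)" using z by (simp add: power_diff field_simps)
    then show "z ^ ?n * (w * (coeff g j * inverse z ^ j)) = poly (monom (w * coeff g j) (?n - j)) z"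
      by (simp add: poly_monom algebra_simps)
  qed
  finally have h: "poly h z = z ^ ?n" by simp
  have h_R: "coeff h i \<in> R" for i
    unfolding h_def coeff_sum using w g(1)
    by (intro subring_sum[OF R]) (auto simp: subring_0[OF R] intro: subring_mult[OF R])
  have h_deg: "coeff h i = 0" if "i \<ge> ?n" for i
    unfolding h_def coeff_sum using that n0 by (intro sum.neutral) auto
  define f' where "f' = f - monom (lead_coeff f) ?n + Polynomial.smult (lead_coeff f) h"
  have "poly f' z = inverse y" by (simp add: f'_def h f(2) poly_monom)
  moreover have "coeff f' i \<in> R" for i
    unfolding f'_def using f(1) h_R
    by (auto simp: subring_0[OF R] intro!: subring_add[OF R] subring_diff[OF R] subring_mult[OF R])
  moreover have "degree f' \<le> ?n - 1"
    by (rule degree_le) (use n0 h_deg in \<open>auto simp: f'_def coeff_eq_0\<close>)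
  then have "degree f' < ?n" using n0 by linarith
  ultimately show ?thesis by metis
qed

text \<open>
  If neither \<open>z\<close> nor \<open>1 / z\<close> belonged to \<open>R\<close>, adjoining either one would produce \<open>1 / y\<close>.  Of two such
  representations of least degree, the longer one can be shortened.
\<close>

lemma maximal_subring_valuation:
  fixes R :: "'a::field set"
  assumes R: "is_subring R" and y: "y \<in> R" "inverse y \<notin> R"
    and max: "\<And>S. is_subring S \<Longrightarrow> R \<subseteq> S \<Longrightarrow> inverse y \<notin> S \<Longrightarrow> S = R"
    and z: "z \<noteq> 0"
  shows "z \<in> R \<or> inverse z \<in> R"
proof (rule ccontr)
  assume no: "\<not> ?thesis"
  have inv: "inverse (1 - y * b) \<in> R" if "b \<in> R" for b
    using maximal_subring_one_minus[OF R y _ that] max by blast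
  define F where "F x f \<longleftrightarrow> (\<forall>i. coeff f i \<in> R) \<and> inverse y = poly f x" for x f
  have ex: "\<exists>f. F x f" if "x \<notin> R" for x
  proof -
    have "inverse y \<in> poly_adjoin R x"
      using max[OF is_subring_poly_adjoin[OF R]] poly_adjoin_base[OF R, of x] that by auto
    then show ?thesis by (auto simp: poly_adjoin_def F_def)
  qed
  have minimal: "\<exists>f. F x f \<and> (\<forall>f'. F x f' \<longrightarrow> degree f \<le> degree f')" if "x \<notin> R" for x
    using ex_has_least_nat[of "F x" _ degree] ex[OF that] by blast
  obtain f where f: "F z f" "\<And>f'. F z f' \<Longrightarrow> degree f \<le> degree f'" using minimal no by blast
  obtain g where g: "F (inverse z) g" "\<And>f'. F (inverse z) f' \<Longrightarrow> degree g \<le> degree f'"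
    using minimal no by blast
  show False
  proof (cases "degree g \<le> degree f")
    case True
    then show False
      using reduce_degree[OF R y inv z, of f g] f g unfolding F_def by (metis not_le)
  next
    case False
    then show False
      using reduce_degree[OF R y inv, of "inverse z" g f] f g z unfolding F_def
      by (metis inverse_inverse_eq inverse_nonzero_iff_nonzero nle_le not_le)
  qed
qed

context function_field_basis
begin

text \<open>
  In a valuation ring, elements of different value are incongruent modulo any \<open>z\<close> of larger value, so
  \<open>card_incongruent_le\<close> allows only finitely many values below that of a given non-unit \<open>z\<close>.  Hence a
  smallest positive value exists, and its multiples exhaust the value group: the valuation is discrete.
\<close>

lemma discrete_valuation_ring_place:
  assumes R: "is_subring R" and const: "range (const_emb emb) \<subseteq> R"
    and val: "\<And>z. z \<noteq> 0 \<Longrightarrow> z \<in> R \<or> inverse z \<in> R"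
    and y: "y \<in> R" "inverse y \<notin> R"
  shows "\<exists>v\<in>places emb. int_val v y > 0"
proof -
  \<comment> \<open>The non-zero non-units of \<open>R\<close>.\<close>
  define M where "M = {x \<in> R. inverse x \<notin> R}"
  have M0: "x \<noteq> 0" if "x \<in> M" for x using that subring_0[OF R] by (auto simp: M_def)
  have MR: "x \<in> R" if "x \<in> M" for x using that by (simp add: M_def)
  have M1: "1 \<notin> M" using subring_1[OF R] by (simp add: M_def)
  have M_mult: "x * r \<in> M" if "x \<in> M" "r \<in> R" "r \<noteq> 0" for x r
  proof -
    have eq: "r * inverse (x * r) = inverse x" using that M0 by (simp add: field_simps)
    have "inverse (x * r) \<notin> R"
    proof
      assume "inverse (x * r) \<in> R"
      then have "inverse x \<in> R" using subring_mult[OF R that(2)] eq by metis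
      then show False using that(1) unfolding M_def by blast
    qed
    then show ?thesis using subring_mult[OF R MR[OF that(1)] that(2)] unfolding M_def by blast
  qed
  have M_or: "x \<in> R \<or> inverse x \<in> M" if "x \<noteq> 0" for x
    using val[OF that] by (auto simp: M_def)
  have unit1: "inverse (1 - x) \<in> R" if x: "x \<in> M" for x
  proof (cases "x / (1 - x) \<in> R")
    case True
    have "1 - x \<noteq> 0" using x M1 by auto
    then have "inverse (1 - x) = 1 + x / (1 - x)" by (simp add: field_simps)
    then show ?thesis using True subring_1[OF R] subring_add[OF R] by metis
  next
    case False
    then have "x / (1 - x) \<noteq> 0" using subring_0[OF R] by auto
    then have "inverse (x / (1 - x)) \<in> R" using False val by blast
    moreover have "inverse (x / (1 - x)) = inverse x - 1" using M0[OF x] by (simp add: field_simps)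
    ultimately have "inverse x \<in> R" using subring_add[OF R _ subring_1[OF R], of "inverse x - 1"] by simp
    then show ?thesis using x by (simp add: M_def)
  qed
  have bound: "\<exists>k. \<forall>Y. finite Y \<longrightarrow> Y \<subseteq> R \<longrightarrow> (\<forall>a\<in>Y. a \<noteq> 0 \<and> z / a \<in> M) \<longrightarrow>
      (\<forall>a\<in>Y. \<forall>b\<in>Y. a \<noteq> b \<longrightarrow> a / b \<in> M \<or> b / a \<in> M) \<longrightarrow> card Y \<le> k" if z: "z \<in> M" for z
  proof -
    obtain m where m: "height_le z m" using height_le_exists by blast
    show ?thesis
    proof (intro exI allI impI)
      fix Y assume Y: "finite Y" "Y \<subseteq> R" "\<forall>a\<in>Y. a \<noteq> 0 \<and> z / a \<in> M"
        "\<forall>a\<in>Y. \<forall>b\<in>Y. a \<noteq> b \<longrightarrow> a / b \<in> M \<or> b / a \<in> M"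
      have key: "(a - b) / z \<notin> R" if ab: "a \<in> Y" "b \<in> Y" "b / a \<in> M" for a b
      proof
        assume *: "(a - b) / z \<in> R"
        have a: "a \<noteq> 0" "z / a \<in> M" using ab Y by auto
        have "1 - b / a = (a - b) / a" using a by (simp add: field_simps)
        moreover have "a - b \<noteq> 0" using ab M1 a by auto
        ultimately have "inverse (z / a) = (a - b) / z * inverse (1 - b / a)"
          using a by simp
        also have "\<dots> \<in> R" using * unit1[OF ab(3)] by (intro subring_mult[OF R])
        finally show False using a by (simp add: M_def)
      qed
      show "card Y \<le> CARD('k) ^ (card U * m)"
      proof (rule card_incongruent_le[OF R MR[OF z] M0[OF z] m Y(1,2)])
        fix a b assume ab: "a \<in> Y" "b \<in> Y" "a \<noteq> b"
        then consider "b / a \<in> M" | "a / b \<in> M" using Y by blast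
        then show "(a - b) / z \<notin> R"
        proof cases
          case 2
          have "(b - a) / z = - ((a - b) / z)" by (metis minus_diff_eq minus_divide_left)
          then show ?thesis using key[OF ab(2,1) 2] subring_uminus[OF R, of "(a - b) / z"] by auto
        qed (use key ab in blast)
      qed
    qed
  qed
  have yM: "y \<in> M" using y by (simp add: M_def)
  \<comment> \<open>Without a generator of the maximal ideal, \<open>y\<close> would start an infinite chain of decreasing values.\<close>
  have "\<exists>p\<in>M. \<forall>x\<in>M. x / p \<in> R"
  proof (rule ccontr)
    assume no: "\<not> ?thesis"
    have "\<exists>x. x \<in> M \<and> p / x \<in> M" if p: "p \<in> M" for p
    proof -
      obtain x where x: "x \<in> M" "x / p \<notin> R" using no p by blast
      then show ?thesis using M_or[of "x / p"] M0 p by (intro exI[of _ x]) auto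
    qed
    then obtain g where g: "\<And>p. p \<in> M \<Longrightarrow> g p \<in> M \<and> p / g p \<in> M" by metis
    define s where "s i = (g ^^ i) y" for i
    have sM: "s i \<in> M" for i using g yM by (induction i) (auto simp: s_def)
    have step: "s i / s (Suc i) \<in> M" for i using g[OF sM[of i]] by (simp add: s_def)
    have lt: "s i / s j \<in> M" if "i < j" for i j
      using that
    proof (induction j)
      case (Suc j)
      show ?case
      proof (cases "i = j")
        case False
        then have "s i / s j * (s j / s (Suc j)) \<in> M"
          using Suc step M0[OF step] by (intro M_mult MR) auto
        then show ?thesis using M0[OF sM[of j]] by simp
      qed (use step in simp)
    qed simp
    have neq: "s i \<noteq> s j" if "i < j" for i j
    proof
      assume "s i = s j"
      then have "s i / s j = 1" using M0[OF sM] by simp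
      then show False using lt[OF that] M1 by simp
    qed
    obtain k where k: "\<And>Y. finite Y \<Longrightarrow> Y \<subseteq> R \<Longrightarrow> (\<forall>a\<in>Y. a \<noteq> 0 \<and> y / a \<in> M) \<Longrightarrow>
      (\<forall>a\<in>Y. \<forall>b\<in>Y. a \<noteq> b \<longrightarrow> a / b \<in> M \<or> b / a \<in> M) \<Longrightarrow> card Y \<le> k"
      using bound[OF yM] by blast
    have "s 0 = y" by (simp add: s_def)
    have "card (s ` {1..Suc k}) \<le> k"
    proof (rule k)
      show "\<forall>a\<in>s ` {1..Suc k}. a \<noteq> 0 \<and> y / a \<in> M"
        using lt[of 0] M0[OF sM] \<open>s 0 = y\<close> by auto
      show "\<forall>a\<in>s ` {1..Suc k}. \<forall>b\<in>s ` {1..Suc k}. a \<noteq> b \<longrightarrow> a / b \<in> M \<or> b / a \<in> M"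
      proof (intro ballI impI)
        fix a b assume "a \<in> s ` {1..Suc k}" "b \<in> s ` {1..Suc k}" "a \<noteq> b"
        then obtain i j where ij: "a = s i" "b = s j" "i \<noteq> j" by auto
        then consider "i < j" | "j < i" by linarith
        then show "a / b \<in> M \<or> b / a \<in> M" using lt ij(1,2) by cases auto
      qed
    qed (use sM MR in auto)
    moreover have "inj_on s {1..Suc k}"
      using neq by (intro inj_onI) (metis linorder_neqE_nat)
    ultimately show False by (simp add: card_image)
  qed
  then obtain p where p: "p \<in> M" "\<And>x. x \<in> M \<Longrightarrow> x / p \<in> R" by blast
  have p0: "p \<noteq> 0" using M0 p by blast
  define unit where "unit x \<longleftrightarrow> x \<in> R \<and> inverse x \<in> R \<and> x \<noteq> 0" for x
  have unit_mult: "unit (a * b)" if "unit a" "unit b" for a b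
    using that by (auto simp: unit_def intro!: subring_mult[OF R])
  have unit_inverse: "unit (inverse a)" if "unit a" for a
    using that by (auto simp: unit_def)
  have p_pow: "p ^ Suc k \<in> M" for k
    using p p0 by (induction k) (auto intro!: M_mult subring_power[OF R] dest: MR)
  \<comment> \<open>A non-zero element is not divisible by all powers of \<open>p\<close>, as these are pairwise incongruent modulo it.\<close>
  have factor_nat: "\<exists>k::nat. unit (z / p ^ k)" if z: "z \<in> R" "z \<noteq> 0" for z
  proof -
    have "\<exists>k. z / p ^ k \<notin> M"
    proof (rule ccontr)
      assume "\<not> ?thesis"
      then have all: "z / p ^ k \<in> M" for k by blast
      obtain k where k: "\<And>Y. finite Y \<Longrightarrow> Y \<subseteq> R \<Longrightarrow> (\<forall>a\<in>Y. a \<noteq> 0 \<and> z / a \<in> M) \<Longrightarrow>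
        (\<forall>a\<in>Y. \<forall>b\<in>Y. a \<noteq> b \<longrightarrow> a / b \<in> M \<or> b / a \<in> M) \<Longrightarrow> card Y \<le> k"
        using bound[of z] all[of 0] by (metis div_by_1 power_0)
      have lt: "p ^ j / p ^ i \<in> M" if "i < j" for i j :: nat
      proof -
        have "p ^ j / p ^ i = p ^ (j - i)" using that p0 by (simp add: power_diff)
        also have "\<dots> = p ^ Suc (j - Suc i)" using that by (simp add: Suc_diff_Suc del: power_Suc)
        finally show ?thesis using p_pow by metis
      qed
      have "card ((\<lambda>i. p ^ i) ` {..k}) \<le> k"
      proof (rule k)
        show "(\<lambda>i. p ^ i) ` {..k} \<subseteq> R" using MR[OF p(1)] by (auto intro: subring_power[OF R])
        show "\<forall>a\<in>(\<lambda>i. p ^ i) ` {..k}. a \<noteq> 0 \<and> z / a \<in> M" using all p0 by auto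
        show "\<forall>a\<in>(\<lambda>i. p ^ i) ` {..k}. \<forall>b\<in>(\<lambda>i. p ^ i) ` {..k}. a \<noteq> b \<longrightarrow> a / b \<in> M \<or> b / a \<in> M"
        proof (intro ballI impI)
          fix a b assume "a \<in> (\<lambda>i. p ^ i) ` {..k}" "b \<in> (\<lambda>i. p ^ i) ` {..k}" "a \<noteq> b"
          then obtain i j where ij: "a = p ^ i" "b = p ^ j" "i \<noteq> j" by auto
          then consider "i < j" | "j < i" by linarith
          then show "a / b \<in> M \<or> b / a \<in> M" using lt ij(1,2) by cases auto
        qed
      qed simp
      moreover have "inj_on (\<lambda>i. p ^ i) {..k}"
      proof (rule linorder_inj_onI)
        fix i j :: nat assume "i < j"
        then have "p ^ j / p ^ i \<noteq> 1" using lt M1 by metis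
        then show "p ^ i \<noteq> p ^ j" using p0 by auto
      qed auto
      ultimately show False by (simp add: card_image)
    qed
    then obtain k where k: "z / p ^ k \<notin> M" and least: "\<And>j. j < k \<Longrightarrow> z / p ^ j \<in> M"
      using exists_least_iff[of "\<lambda>k. z / p ^ k \<notin> M"] by blast
    have "z / p ^ k \<in> R"
    proof (cases k)
      case (Suc j)
      then show ?thesis using p(2)[OF least[of j]] by (simp add: field_simps)
    qed (use z in simp)
    then have "unit (z / p ^ k)" using k z p0 by (simp add: unit_def M_def)
    then show ?thesis ..
  qed
  have factor: "\<exists>k. unit (z / p powi k)" if z: "z \<noteq> 0" for z
  proof (cases "z \<in> R")
    case True
    then obtain k where "unit (z / p ^ k)" using factor_nat z by blast
    then show ?thesis by (intro exI[of _ "int k"]) simp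
  next
    case False
    then obtain k where "unit (inverse z / p ^ k)" using factor_nat[of "inverse z"] z val by auto
    then have "unit (inverse (inverse z / p ^ k))" by (rule unit_inverse)
    then show ?thesis using p0 by (intro exI[of _ "- int k"]) (simp add: field_simps power_int_minus)
  qed
  have R_iff: "z \<in> R \<longleftrightarrow> k \<ge> 0" if u: "unit (z / p powi k)" for z k
  proof
    assume "k \<ge> 0"
    then have "p powi k \<in> R" using MR[OF p(1)] by (simp add: power_int_def subring_power[OF R])
    moreover have "z = z / p powi k * p powi k" using p0 by simp
    ultimately show "z \<in> R" using u subring_mult[OF R] by (metis unit_def)
  next
    assume z: "z \<in> R"
    show "k \<ge> 0"
    proof (rule ccontr)
      assume "\<not> k \<ge> 0"
      define j where "j = nat (- k) - 1"
      have k: "p powi k = inverse (p ^ Suc j)"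
        using \<open>\<not> k \<ge> 0\<close> by (simp add: j_def power_int_def power_inverse del: power_Suc)
      have "inverse (p ^ Suc j) = z * inverse (z / p powi k)"
        using u p0 by (simp add: k unit_def del: power_Suc)
      also have "\<dots> \<in> R" using z u by (intro subring_mult[OF R]) (simp_all add: unit_def)
      finally show False using p_pow[of j] by (simp add: M_def)
    qed
  qed
  have unique: "k = l" if u: "unit (z / p powi k)" "unit (z / p powi l)" for z k l
  proof -
    have z: "z \<noteq> 0" using u by (auto simp: unit_def)
    have le: "l \<le> k" if u: "unit (z / p powi k)" "unit (z / p powi l)" for k l
    proof -
      have "unit (z / p powi l / p powi (k - l))"
        using u(1) p0 by (simp add: power_int_diff)
      then show ?thesis using R_iff u(2) by (metis diff_ge_0_iff_ge unit_def)
    qed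
    show ?thesis using le[OF u] le[OF u(2,1)] by simp
  qed
  define v where "v z = (if z = 0 then Pinf else Fin (THE k. unit (z / p powi k)))" for z
  have v_eq: "v z = Fin k" if "unit (z / p powi k)" for z k
    using that unique[OF _ that] unfolding v_def by (auto simp: unit_def intro!: the_equality)
  have v_fin: "\<exists>k. v z = Fin k \<and> unit (z / p powi k)" if "z \<noteq> 0" for z
    using factor[OF that] v_eq by blast
  have v_mult: "v (a * b) = v a + v b" for a b
  proof (cases "a = 0 \<or> b = 0")
    case True
    then show ?thesis by (cases "a = 0"; cases "b = 0") (auto simp: v_def)
  next
    case False
    then obtain k l where kl: "v a = Fin k" "unit (a / p powi k)" "v b = Fin l" "unit (b / p powi l)"
      using v_fin by metis
    have "a * b / p powi (k + l) = a / p powi k * (b / p powi l)"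
      using p0 by (simp add: power_int_add)
    then have "v (a * b) = Fin (k + l)" using unit_mult kl v_eq by metis
    then show ?thesis using kl by simp
  qed
  have v_R: "Fin 0 \<le> v z \<longleftrightarrow> z \<in> R" for z
  proof (cases "z = 0")
    case False
    then obtain k where "v z = Fin k" "unit (z / p powi k)" using v_fin by blast
    then show ?thesis using R_iff by simp
  qed (simp add: v_def subring_0[OF R])
  have v_add': "v a \<le> v (a + b)" if "v a \<le> v b" and a0: "a \<noteq> 0" for a b
  proof -
    obtain k where k: "v a = Fin k" using v_fin[OF a0] by blast
    have eq: "a * (b / a) = b" "a * (1 + b / a) = a + b" using that(2) by (simp_all add: distrib_left)
    have ab: "v a + v (b / a) = v b" by (simp only: v_mult[symmetric] eq)
    have sum: "v (a + b) = v a + v (1 + b / a)" by (simp only: v_mult[symmetric] eq)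
    have "Fin 0 \<le> v (b / a)"
      using ab that k by (cases "v (b / a)"; cases "v b") auto
    then have "1 + b / a \<in> R" using v_R subring_add[OF R subring_1[OF R]] by blast
    then have "Fin 0 \<le> v (1 + b / a)" using v_R by blast
    then show ?thesis using k sum by (cases "v (1 + b / a)") auto
  qed
  have v_add: "min (v a) (v b) \<le> v (a + b)" for a b
  proof (cases "a = 0 \<or> b = 0")
    case False
    then show ?thesis using v_add'[of a b] v_add'[of b a]
      by (auto simp: min_def add.commute)
  qed (auto simp: min_def)
  have unit_const: "v (const_emb emb c) = Fin 0" if "c \<noteq> 0" for c
  proof -
    have "const_emb emb c * const_emb emb (inverse c) = 1"
      using that by (simp add: const_emb_hom flip: const_emb_hom(3))
    then have "inverse (const_emb emb c) = const_emb emb (inverse c)" by (rule inverse_unique)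
    then have "unit (const_emb emb c / p powi 0)"
      using that const by (auto simp: unit_def const_emb_hom)
    then show ?thesis by (rule v_eq)
  qed
  have v_pm: "v z = Pinf \<longleftrightarrow> z = 0" "v z \<noteq> Minf" for z by (auto simp: v_def)
  have place: "v \<in> places emb"
    unfolding places_def
  proof (intro CollectI conjI allI impI)
    show "\<exists>x. v x = Fin 1"
      using p0 subring_1[OF R] by (intro exI[of _ p] v_eq) (simp add: unit_def)
  qed (use v_pm v_mult v_add unit_const in \<open>simp_all\<close>)
  have "int_val v y > 0"
  proof (rule ccontr)
    assume "\<not> ?thesis"
    then have "val_ge v 0 (inverse y)"
      using M0[OF yM] by (simp add: val_ge_iff[OF place] int_val_inverse[OF place])
    then have "inverse y \<in> R" using v_R by (simp add: val_ge_def)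
    then show False using y by simp
  qed
  then show ?thesis using place by blast
qed

text \<open>
  As \<open>\<F>\<^sub>q\<close> is the full constant field, \<open>y\<close> is transcendental and its inverse is not in \<open>\<F>\<^sub>q[y]\<close>.  Zorn's lemma extends
  \<open>\<F>\<^sub>q[y]\<close> to a subring maximal among those without \<open>1 / y\<close>, which is the valuation ring of the place.
\<close>

lemma place_exists:
  assumes y: "y \<notin> range (const_emb emb)"
  shows "\<exists>v\<in>places emb. int_val v y > 0"
proof -
  interpret c: comm_ring_hom "const_emb emb" by unfold_locales (simp_all add: const_emb_hom)
  interpret cp: map_poly_comm_ring_hom "const_emb emb" ..
  define ev where "ev p = poly (map_poly (const_emb emb) p) y" for p
  have ev_hom: "ev (p - r) = ev p - ev r" "ev (p * r) = ev p * ev r" "ev 1 = 1" for p r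
    by (simp_all add: ev_def hom_distribs)
  define F where "F = {R. is_subring R \<and> range (const_emb emb) \<subseteq> R \<and> y \<in> R \<and> inverse y \<notin> R}"
  have "y \<noteq> 0" using y const_emb_hom(1) by (metis rangeI)
  have "range ev \<in> F"
    unfolding F_def
  proof (intro CollectI conjI)
    show "is_subring (range ev)"
      unfolding is_subring_def by (auto simp flip: ev_hom)
    have "ev [:c:] = const_emb emb c" for c by (simp add: ev_def c.map_poly_pCons_hom)
    then show "range (const_emb emb) \<subseteq> range ev" by (metis image_subsetI rangeI)
    have "ev [:0, 1:] = y" by (simp add: ev_def c.map_poly_pCons_hom const_emb_hom)
    then show "y \<in> range ev" by (metis rangeI)
    show "inverse y \<notin> range ev"
    proof
      assume "inverse y \<in> range ev"
      then obtain p where "inverse y = ev p" by blast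
      then have "y * ev p = 1" using \<open>y \<noteq> 0\<close> by (metis right_inverse)
      then have "poly (map_poly (const_emb emb) (pCons (- 1) p)) y = 0"
        by (simp add: ev_def c.map_poly_pCons_hom hom_distribs)
      moreover have "pCons (- 1) p \<noteq> 0" by simp
      ultimately show False using full_constant_field y by blast
    qed
  qed
  then have "F \<noteq> {}" by blast
  moreover have "\<Union>C \<in> F" if C: "C \<noteq> {}" "subset.chain F C" for C
  proof -
    have C': "X \<in> F" if "X \<in> C" for X using C that by (auto simp: subset.chain_def)
    have "is_subring (\<Union>C)"
      unfolding is_subring_def
    proof (intro conjI ballI)
      show "1 \<in> \<Union>C" using C C' subring_1 by (force simp: F_def)
      fix a b assume "a \<in> \<Union>C" "b \<in> \<Union>C"
      then obtain A B where AB: "A \<in> C" "a \<in> A" "B \<in> C" "b \<in> B" by blast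
      have "A \<subseteq> B \<or> B \<subseteq> A" using C(2) AB by (auto simp: subset_chain_def)
      then obtain X where X: "X \<in> C" "a \<in> X" "b \<in> X" using AB by blast
      then have "is_subring X" using C' by (simp add: F_def)
      then show "a - b \<in> \<Union>C" "a * b \<in> \<Union>C" using X subring_diff subring_mult by blast+
    qed
    then show ?thesis using C(1) C' unfolding F_def by blast
  qed
  ultimately obtain R where R: "R \<in> F" and max: "\<And>X. X \<in> F \<Longrightarrow> R \<subseteq> X \<Longrightarrow> X = R"
    using subset_Zorn_nonempty[of F] by metis
  have R': "is_subring R" "range (const_emb emb) \<subseteq> R" "y \<in> R" "inverse y \<notin> R"
    using R by (auto simp: F_def)
  have "S = R" if "is_subring S" "R \<subseteq> S" "inverse y \<notin> S" for S
    using that R' max[of S] by (auto simp: F_def)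
  then have "z \<in> R \<or> inverse z \<in> R" if "z \<noteq> 0" for z
    using maximal_subring_valuation[OF R'(1,3,4)] that by blast
  then show ?thesis using discrete_valuation_ring_place[OF R'(1,2)] R'(3,4) by blast
qed

lemma no_poles_imp_constant:
  assumes "\<And>v. v \<in> places emb \<Longrightarrow> val_ge v 0 x"
  shows "x \<in> range (const_emb emb)"
proof (rule ccontr)
  assume x: "x \<notin> range (const_emb emb)"
  have x0: "x \<noteq> 0" using x const_emb_hom(1) by (metis rangeI)
  have "inverse x \<notin> range (const_emb emb)"
  proof
    assume "inverse x \<in> range (const_emb emb)"
    then obtain c where c: "inverse x = const_emb emb c" by blast
    have "c \<noteq> 0" using c x0 const_emb_hom(1) by auto
    then have "const_emb emb c * const_emb emb (inverse c) = 1"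
      by (simp add: const_emb_hom flip: const_emb_hom(3))
    then have "x = const_emb emb (inverse c)" using c x0 by (metis inverse_inverse_eq inverse_unique)
    with x show False by blast
  qed
  then obtain v where v: "v \<in> places emb" "int_val v (inverse x) > 0" using place_exists by blast
  then show False using assms[OF v(1)] x0 by (simp add: val_ge_iff int_val_inverse)
qed

end

section \<open>Riemann's inequality\<close>

context function_field_basis
begin

lemma RR_space_iff: "f \<in> RR_space emb A \<longleftrightarrow> (\<forall>v\<in>places emb. val_ge v (- A v) f)"
proof (cases "f = 0")
  case False
  have "Fin 0 \<le> v f + Fin (A v) \<longleftrightarrow> val_ge v (- A v) f" if "v \<in> places emb" for v
    using that False by (auto simp: place_int_val val_ge_iff)
  then show ?thesis using False by (auto simp: RR_space_def)
qed (auto simp: RR_space_def)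

lemma RR_space_0: "0 \<in> RR_space emb A" by (simp add: RR_space_def)

lemma RR_space_add: "f \<in> RR_space emb A \<Longrightarrow> g \<in> RR_space emb A \<Longrightarrow> f + g \<in> RR_space emb A"
  by (simp add: RR_space_iff val_ge_add)

lemma RR_space_diff: "f \<in> RR_space emb A \<Longrightarrow> g \<in> RR_space emb A \<Longrightarrow> f - g \<in> RR_space emb A"
  by (simp add: RR_space_iff val_ge_diff)

lemma RR_space_sum: "(\<And>i. i \<in> I \<Longrightarrow> f i \<in> RR_space emb A) \<Longrightarrow> sum f I \<in> RR_space emb A"
  by (simp add: RR_space_iff val_ge_sum)

lemma RR_space_const: "f \<in> RR_space emb A \<Longrightarrow> const_emb emb c * f \<in> RR_space emb A"
  unfolding RR_space_iff using val_ge_mult[OF _ val_ge_const] by fastforce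

lemma RR_space_mono:
  "f \<in> RR_space emb A \<Longrightarrow> (\<And>v. v \<in> places emb \<Longrightarrow> A v \<le> A' v) \<Longrightarrow> f \<in> RR_space emb A'"
  unfolding RR_space_iff by (meson neg_le_iff_le val_ge_mono)

text \<open>
  Allowing one more pole at \<open>v\<close> adds one leading coefficient, an element of the residue field; functions
  with the same leading coefficient differ by an element of the smaller space.
\<close>

lemma card_RR_space_step:
  assumes fin: "finite (RR_space emb A)" and v: "v \<in> places emb"
  shows "finite (RR_space emb (A(v := A v + 1))) \<and>
    card (RR_space emb (A(v := A v + 1))) \<le> card (RR_space emb A) * CARD('k) ^ place_degree emb v"
proof -
  let ?A' = "A(v := A v + 1)"
  obtain T where T: "finite T" "card T = CARD('k) ^ place_degree emb v"
    "\<And>x. val_ge v 0 x \<Longrightarrow> \<exists>t\<in>T. val_ge v 1 (x - t)"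
    using residue_system[OF v] by metis
  obtain p where p: "p \<noteq> 0" "int_val v p = 1" using uniformizer[OF v] by blast
  define s where "s = (if A v + 1 \<ge> 0 then p ^ nat (A v + 1) else inverse p ^ nat (- (A v + 1)))"
  have s: "s \<noteq> 0" "int_val v s = A v + 1"
    using p by (auto simp: s_def int_val_power[OF v] int_val_inverse[OF v])
  define lead where "lead f t \<longleftrightarrow> t \<in> T \<and> val_ge v 1 (s * f - t)" for f t
  have lead: "\<exists>t. lead f t" if "f \<in> RR_space emb ?A'" for f
  proof -
    have "val_ge v (- (A v + 1)) f" using that v by (force simp: RR_space_iff)
    then have "val_ge v 0 (s * f)" using s by (simp add: val_ge_mult_iff[OF v])
    then show ?thesis using T(3) unfolding lead_def by blast
  qed
  define rep where "rep t = (SOME f. f \<in> RR_space emb ?A' \<and> lead f t)" for t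
  have rep: "rep t \<in> RR_space emb ?A' \<and> lead (rep t) t" if "f \<in> RR_space emb ?A'" "lead f t" for f t
    unfolding rep_def by (rule someI[where P = "\<lambda>f. f \<in> RR_space emb ?A' \<and> lead f t"]) (use that in blast)
  have "f \<in> (\<lambda>(g, t). g + rep t) ` (RR_space emb A \<times> T)" if f: "f \<in> RR_space emb ?A'" for f
  proof -
    obtain t where t: "lead f t" using lead[OF f] by blast
    have rt: "rep t \<in> RR_space emb ?A'" "lead (rep t) t" using rep[OF f t] by auto
    have "val_ge v 1 (s * f - t - (s * rep t - t))"
      using t rt val_ge_diff[OF v] by (simp only: lead_def)
    then have "val_ge v 1 (s * (f - rep t))" by (simp add: algebra_simps)
    then have *: "val_ge v (- A v) (f - rep t)" using s by (simp add: val_ge_mult_iff[OF v])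
    have "f - rep t \<in> RR_space emb ?A'" using f rt by (intro RR_space_diff)
    then have "f - rep t \<in> RR_space emb A" using *
      by (auto simp: RR_space_iff split: if_splits)
    then have "(f - rep t, t) \<in> RR_space emb A \<times> T" using t by (simp add: lead_def)
    then show ?thesis by (intro image_eqI[of _ _ "(f - rep t, t)"]) auto
  qed
  then have sub: "RR_space emb ?A' \<subseteq> (\<lambda>(g, t). g + rep t) ` (RR_space emb A \<times> T)" by blast
  have fin': "finite (RR_space emb A \<times> T)" using fin T by simp
  have "card (RR_space emb ?A') \<le> card (RR_space emb A \<times> T)"
    using sub fin' by (meson card_image_le card_mono finite_imageI le_trans)
  then show ?thesis
    using sub fin' T by (auto simp: card_cartesian_product intro: finite_subset)
qed

lemma card_RR_space_multiple:
  assumes fin: "finite (RR_space emb A)" and v: "v \<in> places emb"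
  shows "finite (RR_space emb (A(v := A v + int m))) \<and>
    card (RR_space emb (A(v := A v + int m))) \<le>
      card (RR_space emb A) * CARD('k) ^ (m * place_degree emb v)"
proof (induction m)
  case (Suc m)
  let ?A = "A(v := A v + int m)"
  have *: "A(v := A v + int (Suc m)) = ?A(v := ?A v + 1)" by auto
  have step: "finite (RR_space emb (?A(v := ?A v + 1)))"
    "card (RR_space emb (?A(v := ?A v + 1))) \<le> card (RR_space emb ?A) * CARD('k) ^ place_degree emb v"
    using card_RR_space_step[OF _ v, of ?A] Suc by auto
  note step(2)
  also have "card (RR_space emb ?A) * CARD('k) ^ place_degree emb v \<le>
    card (RR_space emb A) * CARD('k) ^ (m * place_degree emb v) * CARD('k) ^ place_degree emb v"
    by (intro mult_le_mono1 conjunct2[OF Suc])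
  also have "\<dots> = card (RR_space emb A) * CARD('k) ^ (Suc m * place_degree emb v)"
    by (simp add: power_add)
  finally show ?case unfolding * using step(1) by blast
qed (simp add: fin)

lemma card_RR_space_support:
  assumes fin: "finite (RR_space emb A)" and S: "finite S" "S \<subseteq> places emb"
  shows "finite (RR_space emb (\<lambda>v. A v + (if v \<in> S then int (m v) else 0))) \<and>
    card (RR_space emb (\<lambda>v. A v + (if v \<in> S then int (m v) else 0))) \<le>
      card (RR_space emb A) * CARD('k) ^ (\<Sum>v\<in>S. m v * place_degree emb v)"
  using S
proof (induction S rule: finite_induct)
  case (insert w S)
  let ?A = "\<lambda>v. A v + (if v \<in> S then int (m v) else 0)"
  have *: "(\<lambda>v. A v + (if v \<in> insert w S then int (m v) else 0)) = ?A(w := ?A w + int (m w))"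
    by (rule ext) (use insert.hyps in auto)
  have step: "finite (RR_space emb (?A(w := ?A w + int (m w))))"
    "card (RR_space emb (?A(w := ?A w + int (m w)))) \<le>
      card (RR_space emb ?A) * CARD('k) ^ (m w * place_degree emb w)"
    using card_RR_space_multiple[of ?A w "m w"] insert by auto
  note step(2)
  also have "card (RR_space emb ?A) * CARD('k) ^ (m w * place_degree emb w) \<le>
    card (RR_space emb A) * CARD('k) ^ (\<Sum>v\<in>S. m v * place_degree emb v) *
      CARD('k) ^ (m w * place_degree emb w)"
    using insert by (intro mult_le_mono1) auto
  also have "\<dots> = card (RR_space emb A) * CARD('k) ^ (\<Sum>v\<in>insert w S. m v * place_degree emb v)"
    using insert.hyps by (simp add: power_add mult_ac)
  finally show ?case unfolding * using step(1) by blast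
qed (simp add: fin)

lemma div_degree_eq_sum:
  assumes "finite S" "{v. A v \<noteq> 0} \<subseteq> S"
  shows "div_degree emb A = (\<Sum>v\<in>S. A v * int (place_degree emb v))"
  unfolding div_degree_def using assms by (intro sum.mono_neutral_left) auto

lemma divisors_add:
  assumes "A \<in> divisors emb" "E \<in> divisors emb"
  shows "(\<lambda>v. A v + E v) \<in> divisors emb"
    and "div_degree emb (\<lambda>v. A v + E v) = div_degree emb A + div_degree emb E"
proof -
  let ?S = "{v. A v \<noteq> 0} \<union> {v. E v \<noteq> 0}"
  have fin: "finite ?S" and sub: "{v. A v + E v \<noteq> 0} \<subseteq> ?S" using assms by (auto simp: divisors_def)
  then have "finite {v. A v + E v \<noteq> 0}" by (rule rev_finite_subset)
  then show "(\<lambda>v. A v + E v) \<in> divisors emb" using assms sub by (auto simp: divisors_def)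
  show "div_degree emb (\<lambda>v. A v + E v) = div_degree emb A + div_degree emb E"
    using div_degree_eq_sum[OF fin sub] div_degree_eq_sum[OF fin, of A] div_degree_eq_sum[OF fin, of E]
    by (auto simp: sum.distrib algebra_simps)
qed

lemma divisors_scale:
  assumes "A \<in> divisors emb"
  shows "(\<lambda>v. c * A v) \<in> divisors emb"
    and "div_degree emb (\<lambda>v. c * A v) = c * div_degree emb A"
proof -
  have fin: "finite {v. A v \<noteq> 0}" and sub: "{v. c * A v \<noteq> 0} \<subseteq> {v. A v \<noteq> 0}"
    using assms by (auto simp: divisors_def)
  then have "finite {v. c * A v \<noteq> 0}" by (rule rev_finite_subset)
  then show "(\<lambda>v. c * A v) \<in> divisors emb" using assms sub by (auto simp: divisors_def)
  show "div_degree emb (\<lambda>v. c * A v) = c * div_degree emb A"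
    using div_degree_eq_sum[OF fin sub] div_degree_eq_sum[OF fin, of A]
    by (simp add: sum_distrib_left mult.assoc)
qed

text \<open>
  The space of the zero divisor consists of constants, and effective divisors are reached from it in
  finitely many steps.
\<close>

lemma finite_RR_space:
  assumes "A \<in> divisors emb" shows "finite (RR_space emb A)"
proof -
  let ?S = "{v. A v \<noteq> 0}"
  have S: "finite ?S" "?S \<subseteq> places emb" using assms by (auto simp: divisors_def)
  have "RR_space emb (\<lambda>_. 0) \<subseteq> range (const_emb emb)"
    by (auto simp: RR_space_iff intro!: no_poles_imp_constant)
  then have "finite (RR_space emb (\<lambda>_. 0))" by (rule finite_subset) simp
  from card_RR_space_support[OF this S, of "\<lambda>v. nat (A v)"]
  have "finite (RR_space emb (\<lambda>v. 0 + (if v \<in> ?S then int (nat (A v)) else 0)))" by blast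
  moreover have "RR_space emb A \<subseteq> RR_space emb (\<lambda>v. 0 + (if v \<in> ?S then int (nat (A v)) else 0))"
    by (auto elim!: RR_space_mono)
  ultimately show ?thesis by (rule rev_finite_subset)
qed

lemma card_RR_space_add:
  assumes A: "A \<in> divisors emb" and E: "E \<in> divisors emb" "effective E"
  shows "card (RR_space emb (\<lambda>v. A v + E v)) \<le>
    card (RR_space emb A) * CARD('k) ^ nat (div_degree emb E)"
proof -
  let ?S = "{v. E v \<noteq> 0}"
  have S: "finite ?S" "?S \<subseteq> places emb" using E by (auto simp: divisors_def)
  have nonneg: "E v \<ge> 0" for v using E by (simp add: effective_def)
  have "(\<lambda>v. A v + (if v \<in> ?S then int (nat (E v)) else 0)) = (\<lambda>v. A v + E v)"
    using nonneg by auto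
  moreover have "div_degree emb E = int (\<Sum>v\<in>?S. nat (E v) * place_degree emb v)"
    using nonneg by (simp add: div_degree_def)
  then have "nat (div_degree emb E) = (\<Sum>v\<in>?S. nat (E v) * place_degree emb v)"
    by (simp only: nat_int)
  ultimately show ?thesis
    using card_RR_space_support[OF finite_RR_space[OF A] S, of "\<lambda>v. nat (E v)"] by metis
qed

lemma card_RR_space:
  assumes A: "A \<in> divisors emb"
  shows "card (RR_space emb A) = CARD('k) ^ RR_dim emb A"
proof -
  let ?V = "RR_space emb A"
  interpret vs: vector_space "\<lambda>c x. const_emb emb c * x"
    by unfold_locales (simp_all add: const_emb_hom algebra_simps)
  obtain B where B: "B \<subseteq> ?V" "vs.independent B" "?V \<subseteq> vs.span B" "card B = vs.dim ?V"
    using vs.basis_exists by blast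
  have fin: "finite B" using B(1) finite_RR_space[OF A] by (rule finite_subset)
  define s where "s c = (\<Sum>b\<in>B. const_emb emb (c b) * b)" for c
  let ?E = "B \<rightarrow>\<^sub>E (UNIV :: 'k set)"
  have "inj_on s ?E"
  proof (rule inj_onI)
    fix c c' assume c: "c \<in> ?E" "c' \<in> ?E" "s c = s c'"
    then have "(\<Sum>b\<in>B. const_emb emb (c b - c' b) * b) = 0"
      by (simp add: s_def const_emb_hom algebra_simps sum_subtractf)
    from vs.independentD[OF B(2) fin subset_refl this] have "c b = c' b" if "b \<in> B" for b
      using that by force
    then show "c = c'" using c by (meson PiE_ext)
  qed
  moreover have "s ` ?E = ?V"
  proof
    show "s ` ?E \<subseteq> ?V"
      unfolding s_def using B(1) by (auto intro!: RR_space_sum RR_space_const)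
    show "?V \<subseteq> s ` ?E"
    proof
      fix x assume "x \<in> ?V"
      then obtain c where "x = s c" using B(3) vs.span_finite[OF fin] by (auto simp: s_def)
      then have "x = s (restrict c B)" by (simp add: s_def)
      then show "x \<in> s ` ?E" by auto
    qed
  qed
  ultimately have "card ?V = card ?E" by (metis card_image)
  then show ?thesis using fin B(4) by (simp add: card_PiE RR_dim_def)
qed

lemma RR_dim_add:
  assumes A: "A \<in> divisors emb" and E: "E \<in> divisors emb" "effective E"
  shows "int (RR_dim emb (\<lambda>v. A v + E v)) \<le> int (RR_dim emb A) + div_degree emb E"
proof -
  have "CARD('k) ^ RR_dim emb (\<lambda>v. A v + E v) \<le> CARD('k) ^ (RR_dim emb A + nat (div_degree emb E))"
    using card_RR_space_add[OF assms] card_RR_space[OF A] card_RR_space[OF divisors_add(1)[OF A E(1)]]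
    by (simp add: power_add)
  then have "RR_dim emb (\<lambda>v. A v + E v) \<le> RR_dim emb A + nat (div_degree emb E)"
    by (rule power_le_imp_le_exp[OF card_gt_1])
  moreover have "div_degree emb E \<ge> 0"
    using E(2) by (auto simp: div_degree_def effective_def intro!: sum_nonneg)
  ultimately show ?thesis by linarith
qed

text \<open>
  The divisor of zeros; the divisor of poles of \<open>z\<close> is \<open>zeros_of (inverse z)\<close>.
\<close>

definition zeros_of :: "'l \<Rightarrow> 'l divisor" where
  "zeros_of z v = (if v \<in> places emb then max 0 (int_val v z) else 0)"

lemma zeros_of:
  assumes z: "z \<noteq> 0"
  shows "zeros_of z \<in> divisors emb"
    and "height_le z m \<Longrightarrow> div_degree emb (zeros_of z) \<le> int (card U * m)"
proof -
  let ?S = "{v \<in> places emb. int_val v z > 0}"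
  have S: "{v. zeros_of z v \<noteq> 0} = ?S" by (auto simp: zeros_of_def max_def)
  show "zeros_of z \<in> divisors emb"
    using finite_zeros[OF z] by (simp add: divisors_def S)
  assume m: "height_le z m"
  have "div_degree emb (zeros_of z) = (\<Sum>v\<in>?S. int_val v z * int (place_degree emb v))"
    unfolding div_degree_def S by (intro sum.cong refl) (simp add: zeros_of_def)
  also have "\<dots> \<le> int (card U * m)"
    using finite_zeros[OF z] by (intro sum_valuations_le[OF z m]) auto
  finally show "div_degree emb (zeros_of z) \<le> int (card U * m)" .
qed

abbreviation X :: 'l where "X \<equiv> poly_emb [:0, 1:]"

text \<open>
  At a pole of \<open>\<theta>\<close> the leading term of a polynomial in \<open>\<theta>\<close> dominates.
\<close>

lemma int_val_poly_at_infinity: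
  assumes v: "v \<in> places emb" and X: "int_val v X < 0" and p: "p \<noteq> 0"
  shows "int_val v (poly_emb p) = int (degree p) * int_val v X"
  using p
proof (induction p)
  case (pCons a p)
  have "pCons a p = [:0, 1:] * p + [:a:]" by simp
  then have eq: "poly_emb (pCons a p) = X * poly_emb p + const_emb emb a"
    by (simp only: poly_emb_hom const_emb_eq)
  show ?case
  proof (cases "p = 0")
    case True
    then show ?thesis using pCons.prems eq by (simp add: int_val_const[OF v])
  next
    case False
    then have "int_val v (X * poly_emb p) = int (Suc (degree p)) * int_val v X"
      using pCons.IH by (simp add: int_val_mult[OF v] algebra_simps)
    moreover have "int (Suc (degree p)) * int_val v X < 0" using X by (intro mult_pos_neg) auto
    ultimately have "int_val v (X * poly_emb p + const_emb emb a) = int (Suc (degree p)) * int_val v X"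
      using int_val_add_eq[OF v, of "X * poly_emb p" "const_emb emb a"] False
        val_ge_mono[OF v val_ge_const[OF v]] by simp
    then show ?thesis using False eq by simp
  qed
qed simp

lemma val_ge_poly:
  assumes v: "v \<in> places emb" and p: "degree p \<le> c"
  shows "val_ge v (- (int c * zeros_of (inverse X) v)) (poly_emb p)"
proof (cases "p = 0")
  case False
  have inv: "int_val v (inverse X) = - int_val v X" by (rule int_val_inverse[OF v]) simp
  show ?thesis
  proof (cases "int_val v X < 0")
    case True
    have "int c * int_val v X \<le> int (degree p) * int_val v X"
      using p True by (intro mult_right_mono_neg) auto
    then show ?thesis
      using int_val_poly_at_infinity[OF v True False] False True v inv
      by (simp add: val_ge_iff[OF v] zeros_of_def)
  next
    case no: False
    then have "val_ge v 0 X" by (simp add: val_ge_iff[OF v])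
    then have "val_ge v 0 (poly_emb p)" by (rule val_ge_poly_emb[OF v])
    then show ?thesis using no v inv by (simp add: zeros_of_def)
  qed
qed (simp add: val_ge_0[OF v])

lemma U_nonzero: "u \<in> U \<Longrightarrow> u \<noteq> 0"
proof
  assume u: "u \<in> U" "u = 0"
  have "(\<Sum>w\<in>U. emb (if w = u then 1 else 0) * w) = 0"
    using u(2) by (intro sum.neutral) auto
  from indep_U[OF this u(1)] show False by simp
qed

text \<open>
  An effective divisor that accounts for all poles of the basis \<open>U\<close>.
\<close>

definition basis_poles :: "'l divisor" where
  "basis_poles v = (\<Sum>u\<in>U. zeros_of (inverse u) v)"

lemma basis_poles:
  "basis_poles \<in> divisors emb" "basis_poles v \<ge> 0"
  "u \<in> U \<Longrightarrow> v \<in> places emb \<Longrightarrow> val_ge v (- basis_poles v) u"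
proof -
  have nonneg: "zeros_of z v \<ge> 0" for z v by (simp add: zeros_of_def)
  show "basis_poles v \<ge> 0" by (simp add: basis_poles_def sum_nonneg nonneg)
  let ?S = "\<Union>u\<in>U. {v. zeros_of (inverse u) v \<noteq> 0}"
  have sub: "{v. basis_poles v \<noteq> 0} \<subseteq> ?S"
    unfolding basis_poles_def by (auto intro: ccontr sum.neutral)
  have "zeros_of (inverse u) \<in> divisors emb" if "u \<in> U" for u
    using U_nonzero[OF that] by (intro zeros_of) simp
  then have "finite ?S" "?S \<subseteq> places emb" using finite_U by (auto simp: divisors_def)
  then show "basis_poles \<in> divisors emb" using sub finite_subset by (auto simp: divisors_def)
  assume u: "u \<in> U" "v \<in> places emb"
  have "- int_val v u \<le> zeros_of (inverse u) v"
    using u U_nonzero[OF u(1)] by (simp add: zeros_of_def int_val_inverse)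
  also have "\<dots> \<le> basis_poles v"
    unfolding basis_poles_def using finite_U u nonneg by (intro member_le_sum) auto
  finally show "val_ge v (- basis_poles v) u" using u U_nonzero[OF u(1)] by (simp add: val_ge_iff)
qed

lemma val_ge_lat:
  assumes v: "v \<in> places emb" and x: "x \<in> lat c"
  shows "val_ge v (- (int c * zeros_of (inverse X) v) - basis_poles v) x"
proof -
  obtain G where G: "\<And>u. u \<in> U \<Longrightarrow> degree (G u) \<le> c" "x = (\<Sum>u\<in>U. poly_emb (G u) * u)"
    using latE[OF x] by metis
  have "val_ge v (- (int c * zeros_of (inverse X) v) + - basis_poles v) (poly_emb (G u) * u)"
    if "u \<in> U" for u
    using that G v by (intro val_ge_mult[OF v] val_ge_poly basis_poles(3)) auto
  then show ?thesis unfolding G(2) diff_conv_add_uminus by (rule val_ge_sum[OF v])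
qed

text \<open>
  If every non-zero polynomial in \<open>\<theta>\<close> were a unit at \<open>v\<close>, clearing denominators would not change values,
  so that all values at \<open>v\<close> would be bounded below by those of the basis.
\<close>

lemma poly_vanishing_at:
  assumes v: "v \<in> places emb" and X: "int_val v X \<ge> 0"
  shows "\<exists>h. h \<noteq> 0 \<and> int_val v (poly_emb h) > 0"
proof (rule ccontr)
  assume no: "\<not> ?thesis"
  have zero: "int_val v (poly_emb h) = 0" if "h \<noteq> 0" for h
  proof -
    have "val_ge v 0 X" using X by (simp add: val_ge_iff[OF v])
    then have "val_ge v 0 (poly_emb h)" by (rule val_ge_poly_emb[OF v])
    then show ?thesis using no that by (force simp: val_ge_iff[OF v])
  qed
  have inv: "int_val v (inverse X) = - int_val v X" by (rule int_val_inverse[OF v]) simp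
  then have pole: "zeros_of (inverse X) v = 0" using v X by (simp add: zeros_of_def)
  obtain p where p: "p \<noteq> 0" "int_val v p = 1" using uniformizer[OF v] by blast
  define x where "x = inverse (p ^ Suc (nat (basis_poles v)))"
  have x: "x \<noteq> 0" "int_val v x < - basis_poles v"
    using p by (simp_all add: x_def int_val_inverse[OF v] int_val_power[OF v] del: power_Suc)
  obtain h c where h: "h \<noteq> 0" "poly_emb h * x \<in> lat c" using denominator by blast
  have "val_ge v (- basis_poles v) (poly_emb h * x)"
    using val_ge_lat[OF v h(2)] pole by simp
  moreover have "int_val v (poly_emb h * x) = int_val v x" "poly_emb h * x \<noteq> 0"
    using x h zero[OF h(1)] by (simp_all add: int_val_mult[OF v])
  ultimately show False using x by (simp add: val_ge_iff[OF v])
qed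

lemma poly_vanishing_to_order:
  assumes A: "A \<in> divisors emb"
  shows "\<exists>h. h \<noteq> 0 \<and> (\<forall>v\<in>places emb. int_val v X \<ge> 0 \<longrightarrow> A v \<le> int_val v (poly_emb h))"
proof -
  let ?S = "{v \<in> places emb. A v \<noteq> 0 \<and> int_val v X \<ge> 0}"
  have S: "finite ?S" using A by (auto simp: divisors_def elim: rev_finite_subset)
  obtain h where h: "\<And>v. v \<in> ?S \<Longrightarrow> h v \<noteq> 0 \<and> int_val v (poly_emb (h v)) > 0"
    using poly_vanishing_at by (metis (no_types, lifting) mem_Collect_eq)
  define p where "p = (\<Prod>v\<in>?S. h v ^ nat (A v))"
  have p0: "p \<noteq> 0" using h S by (simp add: p_def)
  have "A v \<le> int_val v (poly_emb p)" if v: "v \<in> places emb" "int_val v X \<ge> 0" for v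
  proof -
    have nonneg: "int_val v (poly_emb r) \<ge> 0" if "r \<noteq> 0" for r
      using val_ge_poly_emb[OF v(1), of r] v that by (simp add: val_ge_iff[OF v(1)])
    show ?thesis
    proof (cases "A v = 0")
      case False
      then have vS: "v \<in> ?S" using v by simp
      define r where "r = (\<Prod>w\<in>?S - {v}. h w ^ nat (A w))"
      have r: "r \<noteq> 0" "p = h v ^ nat (A v) * r"
        using h S vS by (simp_all add: r_def p_def prod.remove[of _ v])
      have hv: "h v \<noteq> 0" "int_val v (poly_emb (h v)) \<ge> 1" using h[OF vS] by auto
      have "A v \<le> int (nat (A v)) * 1" by simp
      also have "\<dots> \<le> int (nat (A v)) * int_val v (poly_emb (h v))" using hv by (intro mult_left_mono) auto
      also have "\<dots> \<le> int (nat (A v)) * int_val v (poly_emb (h v)) + int_val v (poly_emb r)"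
        using nonneg[OF r(1)] by simp
      also have "\<dots> = int_val v (poly_emb p)"
        using hv r by (simp add: int_val_mult[OF v(1)] int_val_power[OF v(1)])
      finally show ?thesis .
    qed (use nonneg[OF p0] in simp)
  qed
  then show ?thesis using p0 by blast
qed

text \<open>
  Let \<open>C\<close> be the pole divisor of \<open>\<theta>\<close> and \<open>n\<close> the degree of \<open>L\<close> over \<open>K\<close>.  The difference
  \<open>deg A - dim \<L>(A)\<close> never decreases when \<open>A\<close> grows, so it suffices to bound it for the divisors
  \<open>A' = l C + (zeros of h(\<theta>)) + (poles of the basis)\<close>, which majorize all others.  Dividing by \<open>h(\<theta>)\<close> the
  combinations of the basis with coefficients of degree at most \<open>l + deg h\<close> gives elements of \<open>\<L>(A')\<close>,
  so its dimension is at least \<open>n (l + deg h + 1)\<close>, whereas \<open>deg A' \<le> n (l + deg h)\<close> up to a constant.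
\<close>

theorem Riemann_bound:
  assumes A: "A \<in> divisors emb"
  shows "div_degree emb A - int (RR_dim emb A) \<le> div_degree emb basis_poles - int (card U)"
proof -
  let ?C = "zeros_of (inverse X)"
  have C: "?C \<in> divisors emb" "div_degree emb ?C \<le> int (card U)"
    using zeros_of[of "inverse X"] zeros_of(2)[OF _ height_le_inverse_X] by auto
  obtain h where h: "h \<noteq> 0"
    "\<And>v. v \<in> places emb \<Longrightarrow> int_val v X \<ge> 0 \<Longrightarrow> A v \<le> int_val v (poly_emb h)"
    using poly_vanishing_to_order[OF A] by blast
  let ?Z = "zeros_of (poly_emb h)"
  have Z: "?Z \<in> divisors emb" "div_degree emb ?Z \<le> int (card U * degree h)"
    using zeros_of[of "poly_emb h"] zeros_of(2)[OF _ height_le_poly] h by auto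
  define l where "l = nat (\<Sum>v | A v \<noteq> 0. \<bar>A v\<bar>)"
  have l: "A v \<le> int l" for v
  proof (cases "A v = 0")
    case False
    have "\<bar>A v\<bar> \<le> (\<Sum>v | A v \<noteq> 0. \<bar>A v\<bar>)"
      using A False by (intro member_le_sum[of v _ "\<lambda>v. \<bar>A v\<bar>"]) (auto simp: divisors_def)
    then show ?thesis by (simp add: l_def)
  qed simp
  define A' where "A' v = int l * ?C v + ?Z v + basis_poles v" for v
  have A'_eq: "A' = (\<lambda>v. (int l * ?C v + ?Z v) + basis_poles v)" by (simp add: A'_def fun_eq_iff)
  note lC = divisors_scale[OF C(1), of "int l"]
  note lCZ = divisors_add[OF lC(1) Z(1)]
  have A': "A' \<in> divisors emb"
    unfolding A'_eq by (intro divisors_add lCZ basis_poles)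
  have "div_degree emb A' = int l * div_degree emb ?C + div_degree emb ?Z + div_degree emb basis_poles"
    unfolding A'_eq divisors_add(2)[OF lCZ(1) basis_poles(1)] lCZ(2) lC(2) ..
  also have "\<dots> \<le> int l * int (card U) + int (card U * degree h) + div_degree emb basis_poles"
    using C Z by (intro add_mono mult_left_mono) auto
  finally have deg: "div_degree emb A' \<le> int (card U * (l + degree h)) + div_degree emb basis_poles"
    by (simp add: algebra_simps)
  have inv: "int_val v (inverse X) = - int_val v X" if "v \<in> places emb" for v
    using int_val_inverse[OF that, of X] by simp
  have le: "A v \<le> A' v" if v: "v \<in> places emb" for v
  proof (cases "int_val v X \<ge> 0")
    case True
    then show ?thesis using h(2)[OF v True] v basis_poles(2)[of v] inv[OF v]
      by (simp add: A'_def zeros_of_def)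
  next
    case False
    then have "?C v \<ge> 1" using v inv[OF v] by (simp add: zeros_of_def)
    then have "int l * 1 \<le> int l * ?C v" by (intro mult_left_mono) auto
    moreover have "?Z v \<ge> 0" by (simp add: zeros_of_def)
    ultimately show ?thesis using l[of v] basis_poles(2)[of v] by (simp add: A'_def)
  qed
  have "val_ge v (- A' v) (x / poly_emb h)" if x: "x \<in> lat (l + degree h)" and v: "v \<in> places emb" for x v
  proof -
    have "- A' v + int_val v (poly_emb h) \<le> - (int (l + degree h) * ?C v) - basis_poles v"
    proof (cases "int_val v X \<ge> 0")
      case True
      then have "?C v = 0" using v inv[OF v] by (simp add: zeros_of_def)
      then show ?thesis using v by (simp add: A'_def zeros_of_def)
    next
      case False
      then have "?C v = - int_val v X" using v inv[OF v] by (simp add: zeros_of_def)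
      moreover have "int_val v (poly_emb h) = int (degree h) * int_val v X"
        using False h by (intro int_val_poly_at_infinity[OF v]) auto
      moreover have "?Z v \<ge> 0" by (simp add: zeros_of_def)
      ultimately show ?thesis by (simp add: A'_def algebra_simps)
    qed
    then show ?thesis
      using val_ge_mono[OF v val_ge_lat[OF v x]] h by (simp add: val_ge_divide_iff[OF v])
  qed
  then have "(\<lambda>x. x / poly_emb h) ` lat (l + degree h) \<subseteq> RR_space emb A'"
    by (auto simp only: RR_space_iff)
  moreover have "inj_on (\<lambda>x. x / poly_emb h) (lat (l + degree h))" using h by (auto intro: inj_onI)
  ultimately have "card (lat (l + degree h)) \<le> card (RR_space emb A')"
    by (metis card_image card_mono finite_RR_space[OF A'])
  then have "card U * Suc (l + degree h) \<le> RR_dim emb A'"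
    unfolding card_lat card_RR_space[OF A'] by (rule power_le_imp_le_exp[OF card_gt_1])
  then have "int (card U + card U * (l + degree h)) \<le> int (RR_dim emb A')"
    by (simp only: mult_Suc_right of_nat_le_iff)
  then have dim: "int (card U * (l + degree h)) + int (card U) \<le> int (RR_dim emb A')"
    by simp
  define E where "E v = A' v - A v" for v
  have E_eq: "E = (\<lambda>v. A' v + (- 1) * A v)" by (simp add: E_def fun_eq_iff)
  have E: "E \<in> divisors emb" unfolding E_eq by (intro divisors_add divisors_scale A A')
  have "effective E"
    unfolding effective_def
  proof
    fix v
    have "E v = 0" if "v \<notin> places emb" using E that unfolding divisors_def by blast
    then show "0 \<le> E v" using le[of v] by (cases "v \<in> places emb") (auto simp: E_def)
  qed
  moreover have "A' = (\<lambda>v. A v + E v)" by (simp add: E_def)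
  ultimately have "int (RR_dim emb A') \<le> int (RR_dim emb A) + div_degree emb E"
    and "div_degree emb A' = div_degree emb A + div_degree emb E"
    using RR_dim_add[OF A E] divisors_add(2)[OF A E] by auto
  then show ?thesis using deg dim by linarith
qed

text \<open>
  By \<open>Riemann_bound\<close> the greatest element that defines the genus exists.
\<close>

theorem Riemann_inequality:
  assumes A: "A \<in> divisors emb"
  shows "int (RR_dim emb A) \<ge> div_degree emb A + 1 - genus emb"
proof -
  define P where "P g \<longleftrightarrow> (\<exists>A\<in>divisors emb. g = div_degree emb A - int (RR_dim emb A) + 1)" for g
  define b where "b = div_degree emb basis_poles - int (card U) + 1"
  have bound: "g \<le> b" if "P g" for g using that Riemann_bound by (force simp: P_def b_def)
  define g0 where "g0 = div_degree emb A - int (RR_dim emb A) + 1"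
  have g0: "P g0" using A by (auto simp: P_def g0_def)
  obtain n where n: "P (b - int n)" "\<And>m. P (b - int m) \<Longrightarrow> n \<le> m"
    using ex_has_least_nat[of "\<lambda>n. P (b - int n)" "nat (b - g0)" "\<lambda>n. n"] g0 bound[OF g0] by auto
  have max: "g \<le> b - int n" if "P g" for g
    using n(2)[of "nat (b - g)"] that bound[OF that] by simp
  have "genus emb = b - int n"
    unfolding genus_def P_def[symmetric] using n(1) max by (intro Greatest_equality)
  then show ?thesis using max[OF g0] by (simp add: g0_def)
qed

end

section \<open>Twisted linear systems\<close>

lemma tmult_diff_left: "tmult q (f - g) h = tmult q f h - tmult q g h"
  by (intro poly_eqI) (simp add: coeff_tmult left_diff_distrib sum_subtractf)

lemma tmult_0_left [simp]: "tmult q 0 h = 0"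
  by (intro poly_eqI) (simp add: coeff_tmult)

lemma tmult_1_left: "tmult q 1 h = h"
proof (rule poly_eqI)
  fix n
  have "coeff (tmult q 1 h) n = (\<Sum>i\<le>n. if i = 0 then twist q i (coeff h (n - i)) else 0)"
    unfolding coeff_tmult by (intro sum.cong refl) (simp add: coeff_1)
  also have "\<dots> = coeff h n" by (simp add: twist_def map_poly_id)
  finally show "coeff (tmult q 1 h) n = coeff h n" .
qed

lemma twist_eq_0_iff: "q > 0 \<Longrightarrow> twist q i f = 0 \<longleftrightarrow> f = 0"
  by (simp add: poly_eq_iff coeff_twist)

lemma degree_twist_le: "degree (twist q i f) \<le> degree f"
  unfolding twist_def by (rule degree_map_poly_le)

text \<open>
  By induction on the power \<open>\<tau>\<^sup>n\<close>: if all lower coefficients of \<open>a\<close> vanish, the coefficients of \<open>\<tau>\<^sup>n\<close> are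
  annihilated by the \<open>n\<close>-th twist of the constant terms of \<open>b\<close>, a triangular matrix with non-zero
  diagonal, and vanish one after the other.
\<close>

lemma triangular_row_eq_0:
  fixes a :: "nat \<Rightarrow> 'a::field tpoly"
  assumes q: "q > 0"
    and rows: "\<And>j. j < m \<Longrightarrow> (\<Sum>l<m. tmult q (a l) (b l j)) = 0"
    and upper: "\<And>l j. l < m \<Longrightarrow> j < l \<Longrightarrow> coeff (b l j) 0 = 0"
    and diag: "\<And>j. j < m \<Longrightarrow> coeff (b j j) 0 \<noteq> 0"
    and l: "l < m"
  shows "a l = 0"
proof -
  have "\<forall>j<m. coeff (a j) n = 0" for n
  proof (induction n rule: less_induct)
    case (less n)
    have "coeff (a j) n = 0" if "j < m" for j
      using that
    proof (induction j rule: less_induct)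
      case (less j)
      have "0 = coeff (\<Sum>l<m. tmult q (a l) (b l j)) n" using rows[OF \<open>j < m\<close>] by simp
      also have "\<dots> = (\<Sum>l<m. \<Sum>i\<le>n. coeff (a l) i * twist q i (coeff (b l j) (n - i)))"
        by (simp add: coeff_sum coeff_tmult)
      also have "\<dots> = (\<Sum>l<m. if l = j then coeff (a j) n * twist q n (coeff (b j j) 0) else 0)"
      proof (intro sum.cong refl)
        fix l assume "l \<in> {..<m}"
        then have l: "l < m" by simp
        have "(\<Sum>i\<le>n. coeff (a l) i * twist q i (coeff (b l j) (n - i))) =
            (\<Sum>i\<le>n. if i = n then coeff (a l) n * twist q n (coeff (b l j) 0) else 0)"
          using \<open>\<And>y. y < n \<Longrightarrow> \<forall>j<m. coeff (a j) y = 0\<close> l by (intro sum.cong refl) auto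
        also have "\<dots> = coeff (a l) n * twist q n (coeff (b l j) 0)" by simp
        also have "\<dots> = (if l = j then coeff (a j) n * twist q n (coeff (b j j) 0) else 0)"
          using less.IH[of l] upper[OF l, of j] l by (cases l j rule: linorder_cases) auto
        finally show "(\<Sum>i\<le>n. coeff (a l) i * twist q i (coeff (b l j) (n - i))) =
          (if l = j then coeff (a j) n * twist q n (coeff (b j j) 0) else 0)" .
      qed
      also have "\<dots> = coeff (a j) n * twist q n (coeff (b j j) 0)" using \<open>j < m\<close> by simp
      finally show ?case using diag[OF \<open>j < m\<close>] twist_eq_0_iff[OF q] by (metis mult_eq_0_iff)
    qed
    then show ?case by blast
  qed
  then show ?thesis using l by (intro poly_eqI) simp
qed

lemma polys_over_diff:
  fixes f g :: "'a::ab_group_add poly"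
  assumes "\<And>x y. x \<in> V \<Longrightarrow> y \<in> V \<Longrightarrow> x - y \<in> V" "f \<in> polys_over V n" "g \<in> polys_over V n"
  shows "f - g \<in> polys_over V n"
  using assms degree_diff_le[of f n g] by (simp add: polys_over_def)

context function_field_basis
begin

text \<open>
  The coefficient of \<open>\<tau>\<^sup>i\<close> in \<open>a\<close>, \<open>i \<le> R\<close>, meets coefficients of \<open>b\<close> raised to the power \<open>q\<^sup>i\<close>, whose poles
  are multiplied by \<open>q\<^sup>i \<le> q\<^sup>R\<close>.
\<close>

lemma tmult_in_polys_over:
  assumes a: "a \<in> polys_over (polys_over (RR_space emb A) T) R"
    and b: "degree b \<le> r" "\<And>i. degree (coeff b i) \<le> u"
    and E: "effective E" "\<And>v i n. v \<in> places emb \<Longrightarrow> val_ge v (- E v) (coeff (coeff b i) n)"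
    and q: "q > 0"
  shows "tmult q a b \<in>
    polys_over (polys_over (RR_space emb (\<lambda>v. A v + int (q ^ R) * E v)) (T + u)) (R + r)"
proof -
  let ?V = "RR_space emb (\<lambda>v. A v + int (q ^ R) * E v)"
  have aR: "coeff a i = 0" if "i > R" for i using a that by (simp add: polys_over_def coeff_eq_0)
  have aT: "degree (coeff a i) \<le> T" and aV: "coeff (coeff a i) n \<in> RR_space emb A" for i n
    using a by (auto simp: polys_over_def)
  have deg: "degree (tmult q a b) \<le> R + r"
  proof (rule degree_le, intro allI impI)
    fix n assume n: "n > R + r"
    have "coeff a i * twist q i (coeff b (n - i)) = 0" for i
      using n b(1) aR[of i] by (cases "i > R") (auto simp: coeff_eq_0)
    then show "coeff (tmult q a b) n = 0" unfolding coeff_tmult by (intro sum.neutral) blast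
  qed
  have "degree (coeff (tmult q a b) n) \<le> T + u" for n
    unfolding coeff_tmult
  proof (rule degree_sum_le)
    fix i
    have "degree (twist q i (coeff b (n - i))) \<le> u"
      using degree_twist_le[of q i "coeff b (n - i)"] b(2)[of "n - i"] by linarith
    then show "degree (coeff a i * twist q i (coeff b (n - i))) \<le> T + u"
      using degree_mult_le[of "coeff a i" "twist q i (coeff b (n - i))"] aT[of i] by linarith
  qed simp
  moreover have "coeff (coeff (tmult q a b) n) m \<in> ?V" for n m
    unfolding coeff_tmult coeff_sum coeff_mult
  proof (intro RR_space_sum)
    fix i j
    show "coeff (coeff a i) j * coeff (twist q i (coeff b (n - i))) (m - j) \<in> ?V"
    proof (cases "i > R")
      case False
      let ?x = "coeff (coeff b (n - i)) (m - j)"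
      have "val_ge v (- (A v + int (q ^ R) * E v)) (coeff (coeff a i) j * ?x ^ (q ^ i))"
        if v: "v \<in> places emb" for v
      proof -
        have "int (q ^ i) * E v \<le> int (q ^ R) * E v"
          using False q E(1) by (intro mult_right_mono) (auto simp: effective_def intro: power_increasing)
        moreover have "val_ge v (- A v) (coeff (coeff a i) j)" using aV v by (simp add: RR_space_iff)
        then have "val_ge v (- A v + int (q ^ i) * (- E v)) (coeff (coeff a i) j * ?x ^ (q ^ i))"
          using val_ge_power[OF v E(2)[OF v]] by (rule val_ge_mult[OF v])
        ultimately show ?thesis by (rule_tac val_ge_mono[OF v]) auto
      qed
      then show ?thesis by (simp add: RR_space_iff coeff_twist[OF q])
    qed (simp add: aR RR_space_0)
  qed
  ultimately show ?thesis using deg by (simp add: polys_over_def)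
qed

text \<open>
  An analogue of Siegel's lemma.  Two different rows \<open>f\<close> and \<open>g\<close> with the same image exist because there
  are more candidates than possible images, and their difference is a solution.  If \<open>s\<close> is the number
  of equations and \<open>w\<close> the degree of \<open>q\<^sup>R E\<close>, the candidates number \<open>|\<L>(A)|\<^bsup>s + 1\<^esup>\<close> and the images at most
  \<open>|\<L>(A)|\<^sup>s q\<^bsup>s w\<^esup>\<close>, which is smaller as \<open>dim \<L>(A) > s w\<close>.
\<close>

lemma Siegel_row:
  fixes b :: "nat \<Rightarrow> nat \<Rightarrow> 'l tpoly"
  assumes A: "A \<in> divisors emb" and E: "E \<in> divisors emb" "effective E"
    and b: "\<And>l j. l < m \<Longrightarrow> j < e \<Longrightarrow> degree (b l j) \<le> r"
      "\<And>l j i. l < m \<Longrightarrow> j < e \<Longrightarrow> degree (coeff (b l j) i) \<le> u"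
      "\<And>l j v i n. l < m \<Longrightarrow> j < e \<Longrightarrow> v \<in> places emb \<Longrightarrow> val_ge v (- E v) (coeff (coeff (b l j) i) n)"
    and count: "m * (R + 1) * (T + 1) = e * (R + r + 1) * (T + u + 1) + 1"
    and deg: "int (e * (R + r + 1) * (T + u + 1) * CARD('k) ^ R) * div_degree emb E + genus emb - 1
      < div_degree emb A"
  shows "\<exists>a. (\<exists>l<m. a l \<noteq> 0) \<and> (\<forall>l<m. a l \<in> polys_over (polys_over (RR_space emb A) T) R) \<and>
    (\<forall>j<e. (\<Sum>l<m. tmult CARD('k) (a l) (b l j)) = 0)"
proof -
  define q where "q = CARD('k)"
  have q: "q > 1" using card_gt_1 by (simp add: q_def)
  define eqs where "eqs = e * (R + r + 1) * (T + u + 1)"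
  define A' where "A' = (\<lambda>v. A v + int (q ^ R) * E v)"
  define P where "P = polys_over (polys_over (RR_space emb A) T) R"
  define Q where "Q = polys_over (polys_over (RR_space emb A') (T + u)) (R + r)"
  have qE: "(\<lambda>v. int (q ^ R) * E v) \<in> divisors emb" "effective (\<lambda>v. int (q ^ R) * E v)"
    "div_degree emb (\<lambda>v. int (q ^ R) * E v) = int (q ^ R) * div_degree emb E"
    using divisors_scale[OF E(1)] E(2) by (auto simp: effective_def)
  have A': "A' \<in> divisors emb" unfolding A'_def by (intro divisors_add A qE)
  have degE: "div_degree emb E \<ge> 0"
    using E(2) by (auto simp: div_degree_def effective_def intro!: sum_nonneg)
  define N where "N = card (RR_space emb A)"
  define N' where "N' = card (RR_space emb A')"
  have "finite P \<and> card P = (N ^ (T + 1)) ^ (R + 1)"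
    using card_polys_over[OF zero_in_polys_over[OF RR_space_0]]
      card_polys_over[OF RR_space_0 finite_RR_space[OF A]]
    unfolding P_def N_def Suc_eq_plus1[symmetric] by simp
  then have card_P: "finite P" "card P = N ^ ((T + 1) * (R + 1))"
    by (simp_all only: power_mult)
  have "finite Q \<and> card Q = (N' ^ (T + u + 1)) ^ (R + r + 1)"
    using card_polys_over[OF zero_in_polys_over[OF RR_space_0]]
      card_polys_over[OF RR_space_0 finite_RR_space[OF A']]
    unfolding Q_def N'_def Suc_eq_plus1[symmetric] by simp
  then have card_Q: "finite Q" "card Q = N' ^ ((T + u + 1) * (R + r + 1))"
    by (simp_all only: power_mult)
  define w where "w = nat (int (q ^ R) * div_degree emb E)"
  have N: "N = q ^ RR_dim emb A" unfolding N_def q_def by (rule card_RR_space[OF A])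
  have N': "N' \<le> N * q ^ w"
    unfolding N'_def N_def A'_def w_def q_def
    using card_RR_space_add[OF A qE(1,2)] qE(3) by (simp only: q_def)
  have "int eqs * (int (q ^ R) * div_degree emb E) < int (RR_dim emb A)"
    using deg Riemann_inequality[OF A] by (simp add: eqs_def q_def algebra_simps)
  moreover have "int w = int (q ^ R) * div_degree emb E" using degE by (simp add: w_def)
  ultimately have "int (eqs * w) < int (RR_dim emb A)" by simp
  then have dim: "eqs * w < RR_dim emb A" by (simp only: of_nat_less_iff)
  have "N' ^ eqs \<le> (N * q ^ w) ^ eqs" using N' by (rule power_mono) simp
  also have "\<dots> = N ^ eqs * q ^ (eqs * w)" by (simp add: power_mult_distrib mult.commute flip: power_mult)
  also have "\<dots> < N ^ eqs * N"
    using q dim unfolding N by (intro mult_strict_left_mono power_strict_increasing) auto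
  finally have less: "N' ^ eqs < N ^ (eqs + 1)" by (simp add: mult.commute)
  define \<phi> where "\<phi> a = (\<lambda>j\<in>{..<e}. \<Sum>l<m. tmult q (a l) (b l j))" for a
  have "\<phi> a \<in> {..<e} \<rightarrow>\<^sub>E Q" if a: "a \<in> {..<m} \<rightarrow>\<^sub>E P" for a
  proof -
    have mem: "tmult q (a l) (b l j) \<in> Q" if "l < m" "j < e" for l j
    proof -
      have "a l \<in> P" using a that by auto
      then show ?thesis
        unfolding P_def Q_def A'_def using b[OF that] E(2) q by (intro tmult_in_polys_over) auto
    qed
    have Q_add: "f + g \<in> Q" if "f \<in> Q" "g \<in> Q" for f g
      using that unfolding Q_def polys_over_def
      by (auto simp: degree_add_le RR_space_add)
    have "(\<Sum>l\<in>S. tmult q (a l) (b l j)) \<in> Q" if "j < e" "S \<subseteq> {..<m}" for S j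
    proof -
      have "finite S" using that(2) finite_subset by blast
      then show ?thesis using that(2)
      proof (induction S rule: finite_induct)
        case empty
        show ?case unfolding Q_def by (simp add: zero_in_polys_over RR_space_0)
      next
        case (insert l S)
        then show ?case using mem[of l j] that(1) Q_add by simp
      qed
    qed
    then show ?thesis by (auto simp: \<phi>_def)
  qed
  then have sub: "\<phi> ` ({..<m} \<rightarrow>\<^sub>E P) \<subseteq> ({..<e} \<rightarrow>\<^sub>E Q)" by blast
  have "card ({..<m} \<rightarrow>\<^sub>E P) = N ^ (eqs + 1)"
  proof -
    have "(T + 1) * (R + 1) * m = eqs + 1" using count by (simp add: eqs_def algebra_simps)
    moreover have "card ({..<m} \<rightarrow>\<^sub>E P) = card P ^ m" by (simp add: card_PiE)
    ultimately show ?thesis by (simp only: card_P(2) power_mult[symmetric])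
  qed
  moreover have "card ({..<e} \<rightarrow>\<^sub>E Q) = N' ^ eqs"
  proof -
    have "(T + u + 1) * (R + r + 1) * e = eqs" by (simp add: eqs_def algebra_simps)
    moreover have "card ({..<e} \<rightarrow>\<^sub>E Q) = card Q ^ e" by (simp add: card_PiE)
    ultimately show ?thesis by (simp only: card_Q(2) power_mult[symmetric])
  qed
  ultimately have "card ({..<e} \<rightarrow>\<^sub>E Q) < card ({..<m} \<rightarrow>\<^sub>E P)" using less by simp
  moreover have "finite ({..<e} \<rightarrow>\<^sub>E Q)" using card_Q by (intro finite_PiE) auto
  ultimately have "\<not> inj_on \<phi> ({..<m} \<rightarrow>\<^sub>E P)"
    using card_inj_on_le[OF _ sub] by linarith
  then obtain f g where fg: "f \<in> {..<m} \<rightarrow>\<^sub>E P" "g \<in> {..<m} \<rightarrow>\<^sub>E P" "f \<noteq> g" "\<phi> f = \<phi> g"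
    unfolding inj_on_def by blast
  obtain l where l: "l < m" "f l \<noteq> g l" using PiE_ext[OF fg(1,2)] fg(3) by blast
  have "f l - g l \<in> P" if "l < m" for l
    using fg that unfolding P_def
    by (intro polys_over_diff RR_space_diff) (auto simp: PiE_iff)
  moreover have "(\<Sum>l<m. tmult q (f l - g l) (b l j)) = 0" if "j < e" for j
    using fun_cong[OF fg(4), of j] that by (simp add: \<phi>_def tmult_diff_left sum_subtractf)
  ultimately show ?thesis
    using l unfolding P_def q_def by (intro exI[of _ "\<lambda>l. f l - g l"]) auto
qed

definition coefficients :: "'l tpoly mat \<Rightarrow> 'l set" where
  "coefficients B = (\<Union>(i, j)\<in>{..<dim_row B} \<times> {..<dim_col B}. \<Union>k\<in>{..degree (B $$ (i, j))}.
     (\<lambda>n. coeff (coeff (B $$ (i, j)) k) n) ` {..degree (coeff (B $$ (i, j)) k)})"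

text \<open>
  Flattens the three nested minima, over the entries, the powers of \<open>\<tau>\<close> and the powers of \<open>t\<close>.
\<close>

lemma ord_mat_eq_Min:
  assumes "dim_row B > 0" "dim_col B > 0"
  shows "ord_mat v B = Min (v ` coefficients B)"
proof -
  let ?I = "{..<dim_row B} \<times> {..<dim_col B}"
  let ?c = "\<lambda>i j k n. coeff (coeff (B $$ (i, j)) k) n"
  have fin: "finite (coefficients B)" by (auto simp: coefficients_def)
  have memI: "?c i j k n \<in> coefficients B"
    if "i < dim_row B" "j < dim_col B" "k \<le> degree (B $$ (i, j))" "n \<le> degree (coeff (B $$ (i, j)) k)"
    for i j k n using that unfolding coefficients_def by blast
  have poly_le: "ord_poly v F \<le> v (coeff F n)" if "n \<le> degree F" for F n
    unfolding ord_poly_def using that by (intro Min_le) auto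
  have tpoly_le: "ord_tpoly v f \<le> ord_poly v (coeff f k)" if "k \<le> degree f" for f k
    unfolding ord_tpoly_def using that by (intro Min_le) auto
  have mat_le: "ord_mat v B \<le> ord_tpoly v (B $$ (i, j))" if "i < dim_row B" "j < dim_col B" for i j
    unfolding ord_mat_def using that by (intro Min_le) auto
  have "ord_mat v B \<in> (\<lambda>(i, j). ord_tpoly v (B $$ (i, j))) ` ?I"
    unfolding ord_mat_def using assms by (intro Min_in) auto
  then obtain i j where ij: "i < dim_row B" "j < dim_col B" "ord_mat v B = ord_tpoly v (B $$ (i, j))"
    by auto
  have "ord_tpoly v (B $$ (i, j)) \<in> (\<lambda>k. ord_poly v (coeff (B $$ (i, j)) k)) ` {..degree (B $$ (i, j))}"
    unfolding ord_tpoly_def by (intro Min_in) auto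
  then obtain k where k: "k \<le> degree (B $$ (i, j))" "ord_mat v B = ord_poly v (coeff (B $$ (i, j)) k)"
    using ij by auto
  have "ord_poly v (coeff (B $$ (i, j)) k) \<in> (\<lambda>n. v (?c i j k n)) ` {..degree (coeff (B $$ (i, j)) k)}"
    unfolding ord_poly_def by (intro Min_in) auto
  then obtain n where n: "n \<le> degree (coeff (B $$ (i, j)) k)" "ord_mat v B = v (?c i j k n)"
    using k by auto
  show ?thesis
  proof (rule Min_eqI[symmetric])
    show "ord_mat v B \<in> v ` coefficients B" using memI[OF ij(1,2) k(1) n(1)] n(2) by simp
    show "ord_mat v B \<le> y" if y: "y \<in> v ` coefficients B" for y
    proof -
      obtain i j k n where "i < dim_row B" "j < dim_col B" "k \<le> degree (B $$ (i, j))"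
        "n \<le> degree (coeff (B $$ (i, j)) k)" "y = v (?c i j k n)"
        using y unfolding coefficients_def by auto
      then show ?thesis using mat_le tpoly_le poly_le by (metis order_trans)
    qed
  qed (use fin in simp)
qed

lemma div_infinity:
  assumes dims: "dim_row B > 0" "dim_col B > 0"
  shows "div_infinity emb B \<in> divisors emb" "effective (div_infinity emb B)"
    and "i < dim_row B \<Longrightarrow> j < dim_col B \<Longrightarrow> v \<in> places emb \<Longrightarrow>
      val_ge v (- div_infinity emb B v) (coeff (coeff (B $$ (i, j)) k) n)"
proof -
  let ?C = "coefficients B"
  have fin: "finite ?C" by (auto simp: coefficients_def)
  have ne: "?C \<noteq> {}" using dims by (auto simp: coefficients_def)
  have at_place: "div_infinity emb B v \<ge> 0 \<and> (\<forall>x\<in>?C. val_ge v (- div_infinity emb B v) x) \<and>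
      (div_infinity emb B v \<noteq> 0 \<longrightarrow> (\<exists>x\<in>?C. x \<noteq> 0 \<and> int_val v x < 0))" if v: "v \<in> places emb" for v
  proof -
    have "Min (v ` ?C) \<in> v ` ?C" using fin ne by (intro Min_in) auto
    then obtain x where x: "x \<in> ?C" "Min (v ` ?C) = v x" by auto
    define n where "n = (if x = 0 then 0 else min (int_val v x) 0)"
    have min_n: "min (v x) (Fin 0) = Fin n"
      using place_eq_Pinf[OF v, of 0] by (simp add: n_def place_int_val[OF v])
    have n: "div_infinity emb B v = - n"
      using v by (simp add: div_infinity_def ord_mat_eq_Min[OF dims] x(2) min_n)
    have "Fin n \<le> v y" if y: "y \<in> ?C" for y
    proof -
      have "Fin n \<le> v x" unfolding min_n[symmetric] by simp
      also have "\<dots> \<le> v y" unfolding x(2)[symmetric] using fin y by (intro Min_le) auto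
      finally show ?thesis .
    qed
    then show ?thesis using x(1) n by (auto simp: n_def val_ge_def split: if_splits)
  qed
  have outside: "div_infinity emb B v = 0" if "v \<notin> places emb" for v
    using that by (simp add: div_infinity_def)
  show "effective (div_infinity emb B)"
    unfolding effective_def using at_place outside by (metis order_refl)
  have sub: "{v. div_infinity emb B v \<noteq> 0} \<subseteq> (\<Union>x\<in>?C - {0}. {v \<in> places emb. int_val v x < 0})"
    using at_place outside by blast
  moreover have "finite (\<Union>x\<in>?C - {0}. {v \<in> places emb. int_val v x < 0})"
    using fin finite_poles by auto
  ultimately have "finite {v. div_infinity emb B v \<noteq> 0}" by (rule finite_subset)
  then show "div_infinity emb B \<in> divisors emb" using sub by (auto simp: divisors_def)
  assume ij: "i < dim_row B" "j < dim_col B" and v: "v \<in> places emb"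
  show "val_ge v (- div_infinity emb B v) (coeff (coeff (B $$ (i, j)) k) n)"
  proof (cases "k \<le> degree (B $$ (i, j)) \<and> n \<le> degree (coeff (B $$ (i, j)) k)")
    case True
    then have "coeff (coeff (B $$ (i, j)) k) n \<in> ?C" using ij unfolding coefficients_def by blast
    then show ?thesis using at_place[OF v] by blast
  next
    case False
    then have "coeff (coeff (B $$ (i, j)) k) n = 0" by (auto simp: coeff_eq_0)
    then show ?thesis by (simp add: val_ge_0[OF v])
  qed
qed

end

text \<open>
  A Jordan matrix is triangular, so that its determinant is the product of its diagonal.
\<close>

lemma jordan_canonical_form_triangular:
  assumes A: "A \<in> carrier_mat d d" and J: "jordan_canonical_form A" and det: "det A \<noteq> (0 :: 'a::idom)"
  shows "\<And>i j. i < d \<Longrightarrow> j < i \<Longrightarrow> A $$ (i, j) = 0" and "\<And>i. i < d \<Longrightarrow> A $$ (i, i) \<noteq> 0"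
proof -
  obtain n_as where A_eq: "A = jordan_matrix n_as" using J by (auto simp: jordan_canonical_form_def)
  then have dim: "sum_list (map fst n_as) = d" using A jordan_matrix_dim(1)[of n_as] by auto
  show upper: "A $$ (i, j) = 0" if "i < d" "j < i" for i j
    unfolding A_eq by (rule jordan_matrix_upper_triangular) (use that dim in auto)
  have "upper_triangular A" using A upper by auto
  then have "prod_list (diag_mat A) \<noteq> 0" using det det_upper_triangular[OF _ A] by simp
  then have "0 \<notin> set (diag_mat A)" by (simp add: prod_list_zero_iff)
  then show "A $$ (i, i) \<noteq> 0" if "i < d" for i using that A by (force simp: diag_mat_def)
qed

section \<open>Triangularization\<close>

lemma mat_deg_le:
  assumes "i < dim_row B" "j < dim_col B"
  shows "degree (B $$ (i, j)) \<le> mat_deg_tau B" and "degree (coeff (B $$ (i, j)) k) \<le> mat_deg_t B"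
proof -
  have "deg_tau (B $$ (i, j)) \<le> mat_deg_tau B"
    unfolding mat_deg_tau_def using assms by (intro Max_ge) auto
  then show "degree (B $$ (i, j)) \<le> mat_deg_tau B" by (simp add: deg_tau_def)
  have "deg_t (B $$ (i, j)) \<le> mat_deg_t B"
    unfolding mat_deg_t_def using assms by (intro Max_ge) auto
  moreover have "degree (coeff (B $$ (i, j)) k) \<le> deg_t (B $$ (i, j))"
  proof (cases "k \<le> degree (B $$ (i, j))")
    case True
    then show ?thesis unfolding deg_t_def by (intro Max_ge) auto
  qed (simp add: coeff_eq_0)
  ultimately show "degree (coeff (B $$ (i, j)) k) \<le> mat_deg_t B" by linarith
qed

lemma deg_t_le: "(\<And>i. degree (coeff f i) \<le> n) \<Longrightarrow> deg_t f \<le> n"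
  unfolding deg_t_def by (intro Max.boundedI) auto

text \<open>
  Indices start at \<open>0\<close>: column \<open>k - 1\<close> carries the \<open>k\<close>-th diagonal entry of the product.
\<close>

lemma (in function_field_basis) triangularizing_row:
  fixes B :: "'l tpoly mat"
  assumes B: "B \<in> carrier_mat d d" and k: "1 \<le> k" "k \<le> d"
    and upper: "\<And>i j. i < d \<Longrightarrow> j < i \<Longrightarrow> coeff (B $$ (i, j)) 0 = 0"
    and diag: "\<And>i. i < d \<Longrightarrow> coeff (B $$ (i, i)) 0 \<noteq> 0"
    and A: "A \<in> divisors emb"
    and deg: "int ((mat_deg_tau B * k + 1) * (k - 1) *
        (mat_deg_t B + (mat_deg_tau B * k + 1) * (k - 1) * mat_deg_t B + 1) *
        CARD('k) ^ (mat_deg_tau B * (k - 1))) * height_infinity emb B + genus emb - 1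
      < div_degree emb A"
  shows "\<exists>a. (\<forall>l<k. a l \<in> polys_over (polys_over (RR_space emb A)
        ((mat_deg_tau B * k + 1) * (k - 1) * mat_deg_t B)) (mat_deg_tau B * (k - 1))) \<and>
    (\<forall>j<k - 1. (\<Sum>l<k. tmult CARD('k) (a l) (B $$ (l, j))) = 0) \<and>
    a (k - 1) \<noteq> 0 \<and> (\<Sum>l<k. tmult CARD('k) (a l) (B $$ (l, k - 1))) \<noteq> 0"
proof -
  define q where "q = CARD('k)"
  have q: "q > 0" using card_gt_1 by (simp add: q_def)
  define r u e where "r = mat_deg_tau B" and "u = mat_deg_t B" and "e = k - 1"
  have ke: "k = Suc e" using k by (simp add: e_def)
  have dims: "dim_row B = d" "dim_col B = d" "d > 0" using B k by auto
  define E where "E = div_infinity emb B"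
  have E: "E \<in> divisors emb" "effective E"
    and val: "\<And>i j v m n. i < d \<Longrightarrow> j < d \<Longrightarrow> v \<in> places emb \<Longrightarrow>
      val_ge v (- E v) (coeff (coeff (B $$ (i, j)) m) n)"
    using div_infinity[of B] dims by (auto simp: E_def)
  \<comment> \<open>With \<open>N = (r k + 1) e\<close> there are \<open>(N + 1) (N u + 1)\<close> unknowns and \<open>N (N u + u + 1)\<close> equations.\<close>
  have count: "k * (r * e + 1) * ((r * k + 1) * e * u + 1) =
    e * (r * e + r + 1) * ((r * k + 1) * e * u + u + 1) + 1"
    unfolding ke by (simp add: algebra_simps)
  have "e * (r * e + r + 1) * ((r * k + 1) * e * u + u + 1) * q ^ (r * e) =
    (r * k + 1) * (k - 1) * (u + (r * k + 1) * (k - 1) * u + 1) * q ^ (r * (k - 1))"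
    unfolding ke by (simp add: algebra_simps)
  then have deg': "int (e * (r * e + r + 1) * ((r * k + 1) * e * u + u + 1) * q ^ (r * e)) * div_degree emb E
      + genus emb - 1 < div_degree emb A"
    using deg by (simp only: r_def[symmetric] u_def[symmetric] q_def[symmetric] height_infinity_def E_def)
  have "\<exists>a. (\<exists>l<k. a l \<noteq> 0) \<and>
    (\<forall>l<k. a l \<in> polys_over (polys_over (RR_space emb A) ((r * k + 1) * e * u)) (r * e)) \<and>
    (\<forall>j<e. (\<Sum>l<k. tmult CARD('k) (a l) (B $$ (l, j))) = 0)"
  proof (rule Siegel_row[OF A E _ _ _ count deg'[unfolded q_def]])
    fix l j i v n assume "l < k" "j < e"
    then have lj: "l < d" "j < d" using k ke by auto
    show "degree (B $$ (l, j)) \<le> r" "degree (coeff (B $$ (l, j)) i) \<le> u"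
      using mat_deg_le[of l B j] lj dims by (simp_all add: r_def u_def)
    show "val_ge v (- E v) (coeff (coeff (B $$ (l, j)) i) n)" if "v \<in> places emb"
      using val lj that by blast
  qed
  then obtain a where a: "\<exists>l<k. a l \<noteq> 0"
    "\<forall>l<k. a l \<in> polys_over (polys_over (RR_space emb A) ((r * k + 1) * e * u)) (r * e)"
    "\<And>j. j < e \<Longrightarrow> (\<Sum>l<k. tmult q (a l) (B $$ (l, j))) = 0"
    unfolding q_def by blast
  have vanish: "a l = 0" if "m \<le> k" "l < m" "\<And>j. j < m \<Longrightarrow> (\<Sum>l<m. tmult q (a l) (B $$ (l, j))) = 0" for m l
    using that k upper diag
    by (intro triangular_row_eq_0[OF q, of m a "\<lambda>l j. B $$ (l, j)"]) auto
  have last: "a e \<noteq> 0"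
  proof
    assume "a e = 0"
    then have "(\<Sum>l<e. tmult q (a l) (B $$ (l, j))) = 0" if "j < e" for j
      using a(3)[OF that] by (simp add: ke)
    then have "a l = 0" if "l < e" for l using vanish[of e] ke that by auto
    then show False using a(1) \<open>a e = 0\<close> ke less_Suc_eq by auto
  qed
  have "(\<Sum>l<k. tmult q (a l) (B $$ (l, e))) \<noteq> 0"
  proof
    assume "(\<Sum>l<k. tmult q (a l) (B $$ (l, e))) = 0"
    then have all: "(\<Sum>l<k. tmult q (a l) (B $$ (l, j))) = 0" if "j < k" for j
      using a(3)[of j] that ke by (cases "j = e") auto
    have "a e = 0" by (rule vanish[OF order_refl _ all]) (simp_all add: ke)
    with last show False by simp
  qed
  then show ?thesis using a(2,3) last by (intro exI[of _ a]) (simp add: e_def r_def u_def q_def)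
qed

theorem theorem3p2p1:
  fixes emb :: "'k::{finite,field} poly fract \<Rightarrow> 'l::field"
    and B :: "'l tpoly mat"
    and D :: "nat \<Rightarrow> 'l divisor"
    and d r u q :: nat
  assumes L: "function_field emb"
    and q: "q = CARD('k)"
    and d: "1 \<le> d"
    and B: "B \<in> carrier_mat d d"
    and r: "mat_deg_tau B = r"
    and u: "mat_deg_t B = u"
    and jordan: "jordan_canonical_form (partial_mat B)"
    and det: "det (partial_mat B) \<noteq> 0"
    and D: "\<And>k. 2 \<le> k \<Longrightarrow> k \<le> d \<Longrightarrow> D k \<in> divisors emb \<and> effective (D k)"
    and deg_D: "\<And>k. 2 \<le> k \<Longrightarrow> k \<le> d \<Longrightarrow>
      div_degree emb (D k) > max (2 * genus emb - 2)
        (int ((r * k + 1) * (k - 1) * (u + (r * k + 1) * (k - 1) * u + 1) * q ^ (r * (k - 1)))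
          * height_infinity emb B + genus emb - 1)"
  shows "\<exists>A \<in> carrier_mat d d.
    entry A 1 1 = 1 \<and>
    (\<forall>i\<in>{1..d}. \<forall>j\<in>{1..d}. i < j \<longrightarrow> entry A i j = 0) \<and>
    upper_triangular (tmat_mult q A B) \<and>
    (\<forall>k\<in>{2..d}. entry A k k \<noteq> 0) \<and>
    (\<forall>k\<in>{1..d}. entry (tmat_mult q A B) k k \<noteq> 0) \<and>
    (\<forall>k\<in>{2..d}. (MAX l\<in>{1..k}. deg_tau (entry A k l)) \<le> r * (k - 1)) \<and>
    (\<forall>k\<in>{2..d}. (MAX l\<in>{1..k}. deg_t (entry A k l)) \<le> (r * k + 1) * (k - 1) * u) \<and>
    (\<forall>k\<in>{2..d}. \<forall>l\<in>{1..k}. entry A k l \<in> RR_space_t_tau emb (D k))"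
proof -
  interpret ff: function_field emb by (rule L)
  obtain U where "function_field_basis emb U" using ff.basis_exists by blast
  then interpret function_field_basis emb U .
  have pB: "partial_mat B \<in> carrier_mat d d" using B by (simp add: partial_mat_def)
  have pB_index: "partial_mat B $$ (i, j) = coeff (B $$ (i, j)) 0" if "i < d" "j < d" for i j
    using that B by (simp add: partial_mat_def)
  have upper: "coeff (B $$ (i, j)) 0 = 0" if "i < d" "j < i" for i j
    using jordan_canonical_form_triangular(1)[OF pB jordan det that] pB_index that by simp
  have diag: "coeff (B $$ (i, i)) 0 \<noteq> 0" if "i < d" for i
    using jordan_canonical_form_triangular(2)[OF pB jordan det that] pB_index that by simp
  define T where "T k = (r * k + 1) * (k - 1) * u" for k
  define good where "good k a \<longleftrightarrow>
      (\<forall>l<k. a l \<in> polys_over (polys_over (RR_space emb (D k)) (T k)) (r * (k - 1))) \<and>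
      (\<forall>j<k - 1. (\<Sum>l<k. tmult q (a l) (B $$ (l, j))) = 0) \<and>
      a (k - 1) \<noteq> 0 \<and> (\<Sum>l<k. tmult q (a l) (B $$ (l, k - 1))) \<noteq> 0" for k a
  have "\<exists>a. good k a" if k: "2 \<le> k" "k \<le> d" for k
    unfolding good_def T_def r[symmetric] u[symmetric] q
  proof (rule triangularizing_row[OF B _ k(2) upper diag])
    show "1 \<le> k" using k by simp
    show "D k \<in> divisors emb" using D[OF k] by blast
  qed (use deg_D[OF k] in \<open>simp_all add: r u q\<close>)
  note ex_good = this
  define a where "a k = (SOME b. good k b)" for k
  have good: "good k (a k)" if "2 \<le> k" "k \<le> d" for k
    unfolding a_def using ex_good[OF that] by (rule someI_ex)
  have a:
    "\<And>k l. 2 \<le> k \<Longrightarrow> k \<le> d \<Longrightarrow> l < k \<Longrightarrow> a k l \<in> polys_over (polys_over (RR_space emb (D k)) (T k)) (r * (k - 1))"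
    "\<And>k j. 2 \<le> k \<Longrightarrow> k \<le> d \<Longrightarrow> j < k - 1 \<Longrightarrow> (\<Sum>l<k. tmult q (a k l) (B $$ (l, j))) = 0"
    "\<And>k. 2 \<le> k \<Longrightarrow> k \<le> d \<Longrightarrow> a k (k - 1) \<noteq> 0"
    "\<And>k. 2 \<le> k \<Longrightarrow> k \<le> d \<Longrightarrow> (\<Sum>l<k. tmult q (a k l) (B $$ (l, k - 1))) \<noteq> 0"
    using good unfolding good_def by blast+
  define row where "row k = (if k = 1 then (\<lambda>_. 1) else a k)" for k
  define A where "A = mat d d (\<lambda>(i, j). if j \<le> i then row (Suc i) j else 0)"
  have A: "A \<in> carrier_mat d d" by (simp add: A_def)
  have A_entry: "entry A k l = (if l \<le> k then row k (l - 1) else 0)" if "k \<in> {1..d}" "l \<in> {1..d}" for k l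
    using that by (auto simp: entry_def A_def)
  have AB: "tmat_mult q A B $$ (k - 1, j) = (\<Sum>l<k. tmult q (row k l) (B $$ (l, j)))"
    if k: "k \<in> {1..d}" and j: "j < d" for k j
  proof -
    obtain m where m: "k = Suc m" using k by (cases k) auto
    have "tmat_mult q A B $$ (k - 1, j) =
        (\<Sum>l<d. tmult q (if l < k then row k l else 0) (B $$ (l, j)))"
      using k j B unfolding m by (simp add: tmat_mult_def A_def less_Suc_eq_le)
    also have "\<dots> = (\<Sum>l<k. tmult q (row k l) (B $$ (l, j)))"
      using k by (intro sum.mono_neutral_cong_right) auto
    finally show ?thesis .
  qed
  have upper_AB: "upper_triangular (tmat_mult q A B)"
  proof
    fix i j assume ij: "j < i" "i < dim_row (tmat_mult q A B)"
    then have "i < d" by (simp add: tmat_mult_def A_def)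
    then show "tmat_mult q A B $$ (i, j) = 0"
      using AB[of "Suc i" j] a(2)[of "Suc i" j] ij by (simp add: row_def)
  qed
  have diag_AB: "entry (tmat_mult q A B) k k \<noteq> 0" if k: "k \<in> {1..d}" for k
  proof (cases "k = 1")
    case True
    then show ?thesis using AB[OF k, of 0] diag[of 0] d by (auto simp: entry_def row_def tmult_1_left)
  next
    case False
    moreover have "k - 1 < d" using k by auto
    ultimately show ?thesis using AB[OF k, of "k - 1"] a(4)[of k] k by (simp add: entry_def row_def)
  qed
  have row_mem: "entry A k l \<in> polys_over (polys_over (RR_space emb (D k)) (T k)) (r * (k - 1))"
    if k: "k \<in> {2..d}" and l: "l \<in> {1..k}" for k l
  proof -
    have "entry A k l = a k (l - 1)" using A_entry[of k l] k l by (auto simp: row_def)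
    then show ?thesis using a(1)[of k "l - 1"] k l by auto
  qed
  show ?thesis
  proof (intro bexI[of _ A] conjI ballI impI A)
    show "entry A 1 1 = 1" using A_entry[of 1 1] d by (simp add: row_def)
    show "entry A i j = 0" if "i \<in> {1..d}" "j \<in> {1..d}" "i < j" for i j
      using A_entry[OF that(1,2)] that(3) by simp
    show "entry A k k \<noteq> 0" if "k \<in> {2..d}" for k
      using A_entry[of k k] a(3)[of k] that by (auto simp: row_def)
    show "(MAX l\<in>{1..k}. deg_tau (entry A k l)) \<le> r * (k - 1)" if "k \<in> {2..d}" for k
      using row_mem[OF that] that
      by (intro Max.boundedI) (auto simp: deg_tau_def polys_over_def)
    show "(MAX l\<in>{1..k}. deg_t (entry A k l)) \<le> (r * k + 1) * (k - 1) * u" if "k \<in> {2..d}" for k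
      using row_mem[OF that] that unfolding T_def
      by (intro Max.boundedI) (auto intro!: deg_t_le simp: polys_over_def)
    show "entry A k l \<in> RR_space_t_tau emb (D k)" if "k \<in> {2..d}" "l \<in> {1..k}" for k l
      using row_mem[OF that] by (auto simp: RR_space_t_tau_def RR_space_t_def polys_over_def)
  qed (use upper_AB diag_AB in auto)
qed

end
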